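(* Let $n\ge 2$, $m\in\{1,\dots,n-1\}$, $p>1$ and $p\neq mn$. Let $\mu$ be a discrete measure on $S^{n-1}$ that is not concentrated on any closed hemisphere. Then there exists a polytope $P\subset\mathbb{R}^n$ containing the origin in its interior such that $\widetilde{C}^a_{p,m}(P,\cdot)=\mu$.
   Context: $\mathcal{K}^n_{(o)}$ is the set of compact convex sets in $\mathbb{R}^n$ containing the origin $o$ in their interior. A discrete measure on $S^{n-1}$ is a finite sum $\sum_{i=1}^k \alpha_i\delta_{u_i}$ with $\alpha_i>0$ and $u_1,\dots,u_k\in S^{n-1}$ distinct. A polytope is the convex hull of finitely many points, with positive $n$-dimensional volume. For $K\in\mathcal{K}^n_{(o)}$: $\rho_K(u)=\max\{t\ge 0: tu\in K\}$ is the radial function; for $\mathcal{H}^{n-1}$-almost every $u\in S^{n-1}$ there is a unique outer unit normal $\nu_K(\rho_K(u)u)$ of $K$ at the boundary point $\rho_K(u)u$. For a Borel set $\eta\subset S^{n-1}$, $\boldsymbol{\alpha}_K^*(\eta)$ is the set of $u\in S^{n-1}$ such that some $v\in\eta$ is an outer unit normal of $K$ at $\rho_K(u)u$. $G(n,m)$ is the Grassmannian of $m$-dimensional linear subspaces of $\mathbb{R}^n$, $\omega_j$ is the volume of the unit ball in $\mathbb{R}^j$, and $|L|$ is the $m$-dimensional volume of a set $L$ contained in an $m$-dimensional subspace. The $m$-dimensional dual Radon transform of $F:G(n,m)\to\mathbb{R}$ is $$\mathcal{R}_m^*F(u)=\frac{m\omega_m}{n\omega_n}\int_{G_u(n-1,m-1)}F(\operatorname{span}\{u,\zeta\})\,d\nu_{m-1}(\zeta),\quad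 u\in S^{n-1},$$ where $G_u(n-1,m-1)$ is the Grassmannian of $(m-1)$-dimensional subspaces of $u^\perp$ and $\nu_{m-1}$ is its Haar probability measure. $\mathcal{R}_m^*(|K\cap\cdot|^{n-1})$ is this transform applied to $F(\xi)=|K\cap\xi|^{n-1}$. For $K\in\mathcal{K}^n_{(o)}$ and $p\in\mathbb{R}$, the $L_p$ curvature measure of affine dual quermassintegrals is, for Borel $\eta\subset S^{n-1}$, $$\widetilde{C}_{p,m}^a(K,\eta)=\int_{\boldsymbol{\alpha}_K^*(\eta)}\bigl(u\cdot\nu_K(\rho_K(u)u)\bigr)^{-p}\rho_K(u)^{m-p}\,\mathcal{R}_m^*(|K\cap\cdot|^{n-1})(u)\,du,$$ where $du$ is spherical Lebesgue measure ($\mathcal{H}^{n-1}$ on $S^{n-1}$). *)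

theory Defs
  imports "HOL-Analysis.Analysis" "HOL-Probability.Probability_Measure"
begin

(* Spherical Lebesgue measure, i.e. H^(n-1) on the unit sphere, given by polar coordinates:
   A has mass n * vol {r u | 0 < r <= 1, u in A}, so the total mass is n * omega_n.
   It is completed because reverse radial Gauss images of Borel sets are in general
   only Lebesgue measurable. *)
definition sphere_lebesgue :: "'a::euclidean_space measure" where
  "sphere_lebesgue = completion (scale_measure (of_nat DIM('a))
     (distr (restrict_space lborel (cball 0 1 - {0})) (restrict_space borel (sphere 0 1)) sgn))"

(* dim xi-dimensional Lebesgue measure on a linear subspace xi, transported by orthonormal
   coordinates; it does not depend on the chosen basis. Compare the library's definition
   of lborel. *)
definition subspace_lborel :: "'a::euclidean_space set \<Rightarrow> 'a measure" where
  "subspace_lborel \<xi> =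
     (let B = (SOME B. B \<subseteq> \<xi> \<and> pairwise orthogonal B \<and> (\<forall>b\<in>B. norm b = 1) \<and> span B = \<xi>)
      in distr (\<Pi>\<^sub>M b\<in>B. (lborel :: real measure)) borel (\<lambda>c. \<Sum>b\<in>B. c b *\<^sub>R b))"

definition subspace_volume :: "'a::euclidean_space set \<Rightarrow> 'a set \<Rightarrow> real" where
  "subspace_volume \<xi> L = measure (subspace_lborel \<xi>) L"

definition grassmannian :: "'a::euclidean_space set \<Rightarrow> nat \<Rightarrow> 'a set set" where
  "grassmannian V k = {\<xi>. subspace \<xi> \<and> \<xi> \<subseteq> V \<and> dim \<xi> = k}"

(* Borel sigma-algebra of the usual topology of the Grassmannian, the one induced by
   sending a subspace to its orthogonal projection. *)
definition grassmannian_borel :: "'a::euclidean_space set \<Rightarrow> nat \<Rightarrow> 'a set measure" where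
  "grassmannian_borel V k =
     vimage_algebra (grassmannian V k) (\<lambda>\<xi>. Blinfun (closest_point \<xi>)) borel"

definition is_grassmannian_haar ::
  "'a::euclidean_space set \<Rightarrow> nat \<Rightarrow> 'a set measure \<Rightarrow> bool" where
  "is_grassmannian_haar V k \<nu> \<longleftrightarrow>
     sets \<nu> = sets (grassmannian_borel V k) \<and> prob_space \<nu> \<and>
     (\<forall>g. orthogonal_transformation g \<and> g ` V = V \<longrightarrow> distr \<nu> \<nu> (\<lambda>\<xi>. g ` \<xi>) = \<nu>)"

definition grassmannian_haar :: "'a::euclidean_space set \<Rightarrow> nat \<Rightarrow> 'a set measure" where
  "grassmannian_haar V k = (THE \<nu>. is_grassmannian_haar V k \<nu>)"

definition dual_radon :: "nat \<Rightarrow> ('a::euclidean_space set \<Rightarrow> real) \<Rightarrow> 'a \<Rightarrow> real" where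
  "dual_radon m F u =
     (real m * unit_ball_vol (real m)) / (real DIM('a) * unit_ball_vol (real DIM('a))) *
     (\<integral>\<zeta>. F (span (insert u \<zeta>)) \<partial>grassmannian_haar ({u}\<^sup>\<bottom>) (m - 1))"

definition radial :: "'a::euclidean_space set \<Rightarrow> 'a \<Rightarrow> real" where
  "radial K u = Sup {t. 0 \<le> t \<and> t *\<^sub>R u \<in> K}"

definition outer_unit_normals :: "'a::euclidean_space set \<Rightarrow> 'a \<Rightarrow> 'a set" where
  "outer_unit_normals K x = {v. norm v = 1 \<and> (\<forall>y\<in>K. y \<bullet> v \<le> x \<bullet> v)}"

(* Meaningful only at boundary points with exactly one outer unit normal. *)
definition outer_unit_normal :: "'a::euclidean_space set \<Rightarrow> 'a \<Rightarrow> 'a" where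
  "outer_unit_normal K x = (THE v. v \<in> outer_unit_normals K x)"

definition reverse_radial_gauss_image :: "'a::euclidean_space set \<Rightarrow> 'a set \<Rightarrow> 'a set" where
  "reverse_radial_gauss_image K \<eta> =
     {u \<in> sphere 0 1. \<exists>v\<in>\<eta>. v \<in> outer_unit_normals K (radial K u *\<^sub>R u)}"

(* Used for compact convex K with the origin in the interior; the integrand is then
   nonnegative, so the integral is taken in the extended nonnegative reals. *)
definition affine_dual_curvature ::
  "real \<Rightarrow> nat \<Rightarrow> 'a::euclidean_space set \<Rightarrow> 'a set \<Rightarrow> ennreal" where
  "affine_dual_curvature p m K \<eta> =
     (\<integral>\<^sup>+ u \<in> reverse_radial_gauss_image K \<eta>.
        ennreal ((u \<bullet> outer_unit_normal K (radial K u *\<^sub>R u)) powr (- p) *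
                 radial K u powr (real m - p) *
                 dual_radon m (\<lambda>\<xi>. subspace_volume \<xi> (K \<inter> \<xi>) ^ (DIM('a) - 1)) u)
      \<partial>sphere_lebesgue)"

definition discrete_sphere_measure :: "'a::euclidean_space measure \<Rightarrow> bool" where
  "discrete_sphere_measure \<mu> \<longleftrightarrow>
     sets \<mu> = sets (restrict_space borel (sphere 0 1)) \<and>
     (\<exists>U \<alpha>. finite U \<and> U \<subseteq> sphere 0 1 \<and> (\<forall>u\<in>U. 0 < \<alpha> u) \<and>
        (\<forall>A\<in>sets \<mu>. emeasure \<mu> A = (\<Sum>u\<in>U. ennreal (\<alpha> u) * indicator A u)))"

definition concentrated_on :: "'a measure \<Rightarrow> 'a set \<Rightarrow> bool" where
  "concentrated_on \<mu> A \<longleftrightarrow> emeasure \<mu> (space \<mu> - A) = 0"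

definition closed_hemisphere :: "'a::euclidean_space \<Rightarrow> 'a set" where
  "closed_hemisphere v = {u \<in> sphere 0 1. 0 \<le> u \<bullet> v}"

end

theory Submission
  imports Defs "HOL-Probability.Giry_Monad"
begin

text \<open>Write \<open>P\<close> for the polytope \<open>{x. \<forall>u\<in>U. x \<bullet> u \<le> h u}\<close>. On the radial projection of the facet with
  normal \<open>u\<close>, the integrand of the curvature measure is \<open>h u powr - p * \<rho> ^ m\<close> times the dual Radon
  transform, so the mass at \<open>u\<close> is \<open>h u powr - p\<close> times a constant multiple of the average over
  \<open>m\<close>-dimensional subspaces \<open>\<xi>\<close> of \<open>|P \<inter> \<xi>| ^ (n - 1) * |P \<inter> \<xi> \<inter> C|\<close>, where \<open>C\<close> is the cone over that
  facet. Up to the factor \<open>h u\<close> this is the derivative with respect to \<open>h u\<close> of the average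
  \<open>\<Phi> h\<close> of \<open>|P \<inter> \<xi>| ^ n\<close>. One maximises \<open>\<Phi>\<close> over all \<open>h \<ge> 0\<close> with \<open>\<Sum>u. \<alpha> u * h u powr p \<le> 1\<close>. A maximiser has no
  vanishing \<open>h u\<close>: pushing the facets through the origin outwards by \<open>t\<close> increases \<open>\<Phi>\<close> at least linearly
  in \<open>t\<close> but costs only \<open>t powr p\<close> in the constraint. One-sided derivatives bound the masses from above,
  and Euler's identity for the homogeneous function \<open>\<Phi>\<close> turns these bounds into equalities up to one
  constant, which a dilation removes since \<open>p \<noteq> m n\<close>.

  Subspaces are represented by their orthogonal projections. Haar measures on Grassmannians and on
  flags are identified by a uniqueness principle for measures invariant under a transitive family of
  isometries, which replaces Haar measure on the orthogonal group.\<close>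


section \<open>Measures determined by their symmetries\<close>

text \<open>Two features of the problem shape the proof. The half-spaces given by the numbers
  \<open>h u\<close> may be redundant, so a facet may be missing and \<open>Phi\<close> is not
  obviously differentiable. Hence a support number is only ever enlarged: explicit pieces of the
  enlarged body bound the gain from below, and Fatou's lemma then bounds each facet mass from above.
  Euler's identity is used in its geometric form: almost every section is filled by the pyramids
  with apex at the origin over its facets. The upper bounds add up to \<open>Phi h\<close>, the
  pyramids fill at least \<open>Phi h\<close>, and so every bound is attained; in particular every
  prescribed normal has a facet.

  The second feature is the dual Radon transform. Its Haar measure is a definite description inside
  the hyperplane orthogonal to \<open>u\<close>, a different one for each direction, whereas the
  variational argument needs a single measure on all subspaces. Random flags link the two: adjoining
  independent rotation invariant vectors gives an explicit model of either side, and exchanging the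
  order of direction and subspace becomes an identity between two invariant laws on flags.\<close>

instance blinfun :: (euclidean_space, euclidean_space) second_countable_topology
proof
  \<comment> \<open>Second countability makes the Borel sets of pairs (vector, operator) the product
    Borel sets, as the Fubini arguments on flags require. Closed balls are compact, so finite nets
    of mesh \<open>1 / Suc k\<close> in the balls of radius \<open>n\<close> form a countable dense
    set.\<close>
  have "\<exists>D :: ('a \<Rightarrow>\<^sub>L 'b) set. countable D \<and> (\<forall>x. \<forall>e>0. \<exists>d\<in>D. dist x d < e)"
  proof -
    have "\<exists>F :: ('a \<Rightarrow>\<^sub>L 'b) set. finite F \<and> cball 0 (real n) \<subseteq> (\<Union>x\<in>F. ball x (1 / real (Suc k)))" for n k
    proof -
      have "compact (cball (0 :: 'a \<Rightarrow>\<^sub>L 'b) (real n))" by simp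
      moreover have "0 < 1 / real (Suc k)" by simp
      ultimately show ?thesis unfolding compact_eq_totally_bounded by blast
    qed
    then obtain F where F: "\<And>n k. finite (F n k :: ('a \<Rightarrow>\<^sub>L 'b) set) \<and> cball 0 (real n) \<subseteq> (\<Union>x\<in>F n k. ball x (1 / real (Suc k)))"
      by metis
    have "\<exists>d\<in>(\<Union>n k. F n k). dist x d < e" if epos: "e > 0" for x and e :: real
    proof -
      obtain n where n: "norm x \<le> real n" using real_arch_simple by blast
      obtain k where k: "1 / real (Suc k) < e" using nat_approx_posE[OF epos] by blast
      have "x \<in> (\<Union>x\<in>F n k. ball x (1 / real (Suc k)))" using n conjunct2[OF F[of n k]] by (auto simp only: mem_cball dist_0_norm subset_iff)
      then obtain d where d: "d \<in> F n k" "dist d x < 1 / real (Suc k)" by auto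
      then have "dist x d < e" using k by (simp add: dist_commute)
      then show ?thesis using d(1) by blast
    qed
    moreover have "countable (\<Union>n k. F n k)" by (intro countable_UN countable_finite countableI_type conjunct1[OF F])
    ultimately show ?thesis by blast
  qed
  then obtain D :: "('a \<Rightarrow>\<^sub>L 'b) set" where D: "countable D" "\<And>x e. e > 0 \<Longrightarrow> \<exists>d\<in>D. dist x d < e" by blast
  define B where "B = (\<lambda>(d, k :: nat). ball d (1 / real (Suc k))) ` (D \<times> UNIV)"
  have "countable B" unfolding B_def using D(1) by auto
  moreover have "topological_basis B"
  proof (rule topological_basisI)
    show "open b" if "b \<in> B" for b using that by (auto simp: B_def)
    fix S :: "('a \<Rightarrow>\<^sub>L 'b) set" and x assume "open S" "x \<in> S"
    then obtain e where e: "e > 0" "ball x e \<subseteq> S" using openE by blast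
    obtain k where k: "1 / real (Suc k) < e / 2" using nat_approx_posE[OF half_gt_zero[OF e(1)]] by blast
    obtain d where d: "d \<in> D" "dist x d < 1 / real (Suc k)" using D(2)[of "1 / real (Suc k)" x] by auto
    have "ball d (1 / real (Suc k)) \<subseteq> ball x e"
    proof
      fix y assume "y \<in> ball d (1 / real (Suc k))"
      then have "dist d y < e / 2" using k by simp
      then show "y \<in> ball x e" using d(2) k dist_triangle[of x y d] by simp
    qed
    then show "\<exists>b\<in>B. x \<in> b \<and> b \<subseteq> S" using d e
      by (intro bexI[of _ "ball d (1 / real (Suc k))"]) (auto simp: B_def dist_commute)
  qed
  ultimately show "\<exists>B::('a \<Rightarrow>\<^sub>L 'b) set set. countable B \<and> open = generate_topology B"
    using topological_basis_imp_subbasis by blast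
qed

text \<open>Tonelli for the set of pairs at distance less than \<open>r\<close>: symmetry of the
  distance exchanges the roles of the two measures. The set of pairs is measurable for the product
  because the space is second countable.\<close>

lemma nn_integral_emeasure_ball:
  fixes M N :: "'b::{metric_space, second_countable_topology} measure"
  assumes sM: "sets M = sets borel" and sN: "sets N = sets borel"
    and fM: "finite_measure M" and fN: "finite_measure N" and U: "U \<in> sets borel"
  shows "(\<lambda>x. emeasure N (ball x r \<inter> U)) \<in> borel_measurable M"
    "(\<integral>\<^sup>+x. emeasure N (ball x r \<inter> U) \<partial>M) = (\<integral>\<^sup>+y. emeasure M (ball y r) * indicator U y \<partial>N)"
proof -
  interpret M: finite_measure M by fact
  interpret N: finite_measure N by fact
  interpret P: pair_sigma_finite M N by standard
  note [measurable_cong] = sM sN and [measurable] = U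
  let ?I = "\<lambda>x y. indicator {z. dist (fst z) (snd z) < r} (x, y) * (indicator U y :: ennreal)"
  have "{z :: 'b \<times> 'b. dist (fst z) (snd z) < r} \<in> sets (borel \<Otimes>\<^sub>M borel)"
    unfolding borel_prod by (intro borel_open open_Collect_less continuous_intros)
  moreover have "sets (M \<Otimes>\<^sub>M N) = sets (borel \<Otimes>\<^sub>M borel)" using sM sN by (rule sets_pair_measure_cong)
  ultimately have mb: "(\<lambda>(x,y). indicator {z. dist (fst z) (snd z) < r} (x,y) :: ennreal) \<in> borel_measurable (M \<Otimes>\<^sub>M N)"
    by (auto simp: case_prod_beta')
  have e: "emeasure N (ball x r \<inter> U) = (\<integral>\<^sup>+y. ?I x y \<partial>N)" for x
  proof -
    have "emeasure N (ball x r \<inter> U) = (\<integral>\<^sup>+y. indicator (ball x r \<inter> U) y \<partial>N)" by (simp add: sN)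
    also have "\<dots> = (\<integral>\<^sup>+y. ?I x y \<partial>N)"
      by (intro nn_integral_cong) (auto simp: indicator_def)
    finally show ?thesis .
  qed
  show "(\<lambda>x. emeasure N (ball x r \<inter> U)) \<in> borel_measurable M"
    unfolding e using mb by (intro N.borel_measurable_nn_integral) auto
  have "(\<integral>\<^sup>+x. emeasure N (ball x r \<inter> U) \<partial>M) = (\<integral>\<^sup>+y. \<integral>\<^sup>+x. ?I x y \<partial>M \<partial>N)"
    unfolding e using mb by (intro P.Fubini'[symmetric]) auto
  also have "\<dots> = (\<integral>\<^sup>+y. emeasure M (ball y r) * indicator U y \<partial>N)"
  proof (rule nn_integral_cong)
    fix y
    have "(\<integral>\<^sup>+x. ?I x y \<partial>M) = (\<integral>\<^sup>+x. indicator (ball y r) x * indicator U y \<partial>M)"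
      by (intro nn_integral_cong) (auto simp: indicator_def dist_commute)
    also have "\<dots> = emeasure M (ball y r) * indicator U y"
      by (subst nn_integral_multc) (auto intro!: borel_measurable_indicator simp: sM)
    finally show "(\<integral>\<^sup>+x. ?I x y \<partial>M) = emeasure M (ball y r) * indicator U y" .
  qed
  finally show "(\<integral>\<^sup>+x. emeasure N (ball x r \<inter> U) \<partial>M) = (\<integral>\<^sup>+y. emeasure M (ball y r) * indicator U y \<partial>N)" .
qed

text \<open>Fatou's lemma for the quotients
  \<open>emeasure N (ball x (e n) \<inter> U) / c (e n)\<close>: on the open set they are eventually
  1, while their integrals against \<open>M\<close> all equal \<open>emeasure N U\<close> by
  Fubini.\<close>

lemma measure_le_of_uniform_balls:
  fixes M N :: "'b::{metric_space, second_countable_topology} measure"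
  assumes [measurable_cong]: "sets M = sets borel" "sets N = sets borel"
    and fM: "finite_measure M" and fN: "finite_measure N"
    and c: "\<And>r. r > 0 \<Longrightarrow> 0 < c r" "\<And>r. r > 0 \<Longrightarrow> c r < \<infinity>"
    and M: "\<And>r. r > 0 \<Longrightarrow> AE x in N. emeasure M (ball x r) = c r"
    and N: "\<And>r. r > 0 \<Longrightarrow> AE x in M. emeasure N (ball x r) = c r"
    and U: "open U"
  shows "emeasure M U \<le> emeasure N U"
proof -
  interpret M: finite_measure M by fact
  interpret N: finite_measure N by fact
  have [measurable]: "U \<in> sets borel" using U by simp
  define e :: "nat \<Rightarrow> real" where "e n = 1 / real (Suc n)" for n
  have e: "e n > 0" for n by (simp add: e_def)
  note balls = nn_integral_emeasure_ball[OF assms(1,2) fM fN \<open>U \<in> sets borel\<close>]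
  note mN = balls(1) and int = balls(2)
  have "emeasure M U = (\<integral>\<^sup>+x. indicator U x \<partial>M)" by simp
  also have "\<dots> \<le> (\<integral>\<^sup>+x. liminf (\<lambda>n. emeasure N (ball x (e n) \<inter> U) / c (e n)) \<partial>M)"
  proof (rule nn_integral_mono_AE)
    have "AE x in M. \<forall>n. emeasure N (ball x (e n)) = c (e n)" using N[OF e] by (simp add: AE_all_countable)
    then show "AE x in M. indicator U x \<le> liminf (\<lambda>n. emeasure N (ball x (e n) \<inter> U) / c (e n))"
    proof (eventually_elim)
      case (elim x)
      show ?case
      proof (cases "x \<in> U")
        case True
        then obtain d where d: "d > 0" "ball x d \<subseteq> U" using U openE by blast
        obtain k where k: "1 / real (Suc k) < d" using nat_approx_posE[OF d(1)] by blast
        have "\<forall>\<^sub>F n in sequentially. 1 \<le> emeasure N (ball x (e n) \<inter> U) / c (e n)"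
          using eventually_ge_at_top[of k]
        proof eventually_elim
          case (elim n)
          have "e n \<le> 1 / real (Suc k)" using elim unfolding e_def by (simp add: frac_le)
          then have "ball x (e n) \<subseteq> U" using d(2) k by (auto simp: subset_iff)
          then have "ball x (e n) \<inter> U = ball x (e n)" by auto
          then show ?case using \<open>\<forall>n. emeasure N (ball x (e n)) = c (e n)\<close> c(1)[OF e[of n]] c(2)[OF e[of n]]
            by (simp add: ennreal_divide_self less_top[symmetric])
        qed
        then have "1 \<le> liminf (\<lambda>n. emeasure N (ball x (e n) \<inter> U) / c (e n))"
          by (rule Liminf_bounded)
        then show ?thesis using True by simp
      qed simp
    qed
  qed
  also have "\<dots> \<le> liminf (\<lambda>n. \<integral>\<^sup>+x. emeasure N (ball x (e n) \<inter> U) / c (e n) \<partial>M)"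
    by (rule nn_integral_liminf) (use mN in measurable)
  also have "\<dots> = liminf (\<lambda>n. emeasure N U)"
  proof -
    have "(\<integral>\<^sup>+x. emeasure N (ball x (e n) \<inter> U) / c (e n) \<partial>M) = emeasure N U" for n
    proof -
      have "(\<integral>\<^sup>+x. emeasure N (ball x (e n) \<inter> U) / c (e n) \<partial>M) = (\<integral>\<^sup>+y. emeasure M (ball y (e n)) * indicator U y \<partial>N) / c (e n)"
        using mN by (subst nn_integral_divide) (auto simp: int)
      also have "(\<integral>\<^sup>+y. emeasure M (ball y (e n)) * indicator U y \<partial>N) = (\<integral>\<^sup>+y. c (e n) * indicator U y \<partial>N)"
        using M[OF e[of n]] by (intro nn_integral_cong_AE) auto
      also have "\<dots> = c (e n) * emeasure N U" by (simp add: nn_integral_cmult)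
      finally show ?thesis using c[OF e[of n]]
        by (metis infinity_ennreal_def mult.commute mult_divide_eq_ennreal
    order_less_irrefl)
    qed
    then show ?thesis by simp
  qed
  finally show ?thesis by (simp add: Liminf_const)
qed

text \<open>Both measures give all balls of radius \<open>r\<close> centred in \<open>S\<close> one and the same mass, by Fubini;
  comparing them on small balls as in Christensen's theorem then shows that they agree.\<close>

lemma measure_eqI_isometry_invariant:
  fixes M N :: "'b::{metric_space, second_countable_topology} measure"
  assumes sM: "sets M = sets borel" and sN: "sets N = sets borel"
    and pM: "prob_space M" and pN: "prob_space N"
    and S: "AE x in M. x \<in> S" "AE x in N. x \<in> S"
    and G: "\<And>x y. x \<in> S \<Longrightarrow> y \<in> S \<Longrightarrow> \<exists>g. g \<in> borel_measurable borel \<and> (\<forall>a b. dist (g a) (g b) = dist a b) \<and>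
              distr M borel g = M \<and> distr N borel g = N \<and> g x = y"
  shows "M = N"
proof -
  interpret M: prob_space M by fact
  interpret N: prob_space N by fact
  note [measurable_cong] = sM sN
  have sp[simp]: "space M = UNIV" "space N = UNIV"
    using sets_eq_imp_space_eq[OF sM] sets_eq_imp_space_eq[OF sN] by auto
  have ball_inv: "emeasure L (ball (g x) r) = emeasure L (ball x r)"
    if "g \<in> borel_measurable borel" "\<forall>a b. dist (g a) (g b) = dist a b" "distr L borel g = L" "sets L = sets borel"
    for L :: "'b measure" and g x r
  proof -
    have "g \<in> measurable L borel" using that(1,4) by (simp cong: measurable_cong_sets)
    moreover have "space L = UNIV" using sets_eq_imp_space_eq[OF that(4)] by simp
    ultimately have "emeasure (distr L borel g) (ball (g x) r) = emeasure L (g -` ball (g x) r)"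
      by (subst emeasure_distr) auto
    moreover have "g -` ball (g x) r = ball x r" using that(2) by auto
    ultimately show ?thesis using that(3) by simp
  qed
  have "AE x in M. False" if "S = {}" using S(1) that by simp
  then have "S \<noteq> {}" using M.AE_False by auto
  then obtain x0 where x0: "x0 \<in> S" by blast
  define c where "c r = emeasure M (ball x0 r)" for r
  define d where "d r = emeasure N (ball x0 r)" for r
  have Mc: "emeasure M (ball x r) = c r" if x: "x \<in> S" for x r
  proof -
    obtain g where g: "g \<in> borel_measurable borel" "\<forall>a b. dist (g a) (g b) = dist a b" "distr M borel g = M" "g x0 = x"
      using G[OF x0 x] by blast
    show ?thesis using ball_inv[OF g(1-3) sM, of x0 r] g(4) by (simp add: c_def)
  qed
  have Nd: "emeasure N (ball x r) = d r" if x: "x \<in> S" for x r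
  proof -
    obtain g where g: "g \<in> borel_measurable borel" "\<forall>a b. dist (g a) (g b) = dist a b" "distr N borel g = N" "g x0 = x"
      using G[OF x0 x] by blast
    show ?thesis using ball_inv[OF g(1-3) sN, of x0 r] g(4) by (simp add: d_def)
  qed
  \<comment> \<open>Both integrals measure the pairs at distance less than \<open>r\<close>;
    transitivity makes either inner mass constant on \<open>S\<close>, and both measures have total
    mass 1.\<close>
  have cd: "c r = d r" for r
  proof -
    have "d r = (\<integral>\<^sup>+x. emeasure N (ball x r) \<partial>M)"
      using S(1) Nd by (subst nn_integral_cong_AE[where v="\<lambda>_. d r"]) (auto simp: M.emeasure_space_1[simplified])
    also have "\<dots> = (\<integral>\<^sup>+y. emeasure M (ball y r) \<partial>N)"
      using nn_integral_emeasure_ball(2)[OF sM sN M.finite_measure_axioms N.finite_measure_axioms, of UNIV r] by simp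
    also have "\<dots> = c r"
      using S(2) Mc by (subst nn_integral_cong_AE[where v="\<lambda>_. c r"]) (auto simp: N.emeasure_space_1[simplified])
    finally show ?thesis by simp
  qed
  \<comment> \<open>Otherwise every ball of radius \<open>r / 2\<close> around a point of a
    countable dense set would be null, since it misses \<open>S\<close> or lies in a ball of radius
    \<open>r\<close> centred in \<open>S\<close>; but these balls cover the space.\<close>
  have cpos: "c r > 0" if r: "r > 0" for r
  proof (rule ccontr)
    assume "\<not> c r > 0"
    then have c0: "c r = 0" by simp
    obtain D :: "'b set" where D: "countable D" "\<And>X. open X \<Longrightarrow> X \<noteq> {} \<Longrightarrow> \<exists>d\<in>D. d \<in> X"
      using countable_dense_setE by metis
    have "AE x in M. x \<notin> ball q (r/2)" if "q \<in> D" for q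
    proof (cases "S \<inter> ball q (r/2) = {}")
      case True
      then show ?thesis using S(1) by (auto elim!: eventually_mono)
    next
      case False
      then obtain s where s: "s \<in> S" "dist q s < r/2" by auto
      have "ball q (r/2) \<subseteq> ball s r"
      proof
        fix y assume "y \<in> ball q (r/2)"
        then show "y \<in> ball s r" using s(2) dist_triangle[of s y q] by (simp add: dist_commute)
      qed
      then have "emeasure M (ball q (r/2)) \<le> emeasure M (ball s r)" by (intro emeasure_mono) (auto simp: sM)
      then have "emeasure M (ball q (r/2)) = 0" using Mc[OF s(1)] c0 by simp
      then have "ball q (r/2) \<in> null_sets M" by (auto simp: null_sets_def sM)
      then show ?thesis by (rule AE_not_in)
    qed
    then have aeD: "AE x in M. \<forall>q\<in>D. x \<notin> ball q (r/2)" using D(1) by (simp only: AE_ball_countable) blast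
    have ex: "\<exists>q\<in>D. x \<in> ball q (r/2)" for x
      using D(2)[of "ball x (r/2)"] r by (auto simp: dist_commute)
    from aeD have "AE x in M. False" by (rule eventually_mono) (use ex in blast)
    then show False using M.AE_False by blast
  qed
  have cfin: "c r < \<infinity>" for r unfolding c_def by (simp add: M.emeasure_finite less_top[symmetric])
  have aeM: "AE x in N. emeasure M (ball x r) = c r" for r using S(2) by (rule eventually_mono) (rule Mc)
  have aeN: "AE x in M. emeasure N (ball x r) = c r" for r using S(1) by (rule eventually_mono) (simp add: Nd cd)
  have le: "emeasure M U = emeasure N U" if "open U" for U
  proof (rule antisym)
    show "emeasure M U \<le> emeasure N U"
      by (rule measure_le_of_uniform_balls[OF sM sN M.finite_measure_axioms N.finite_measure_axioms cpos cfin aeM aeN that])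
    show "emeasure N U \<le> emeasure M U"
      by (rule measure_le_of_uniform_balls[OF sN sM N.finite_measure_axioms M.finite_measure_axioms cpos cfin aeN aeM that])
  qed
  show "M = N"
  proof (rule measure_eqI_generator_eq)
    show "sets M = sigma_sets UNIV {U. open U}" "sets N = sigma_sets UNIV {U. open U}"
      using sM sN by (simp_all add: borel_def)
    show "Int_stable {U :: 'b set. open U}" by (auto simp: Int_stable_def)
    show "range (\<lambda>_::nat. UNIV :: 'b set) \<subseteq> {U. open U}" by simp
    show "emeasure M X = emeasure N X" if "X \<in> {U. open U}" for X using that le by simp
  qed (auto simp: M.emeasure_finite)
qed

section \<open>Orthogonal projections and flags\<close>

text \<open>The rank enters through the trace, which is linear in \<open>T\<close>: all conditions
  are then closed in the operator norm, which makes \<open>closed_flag\<close> immediate.\<close>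

definition is_proj :: "nat \<Rightarrow> ('a::euclidean_space \<Rightarrow>\<^sub>L 'a) \<Rightarrow> bool" where
  "is_proj k T \<longleftrightarrow> (\<forall>x. T (T x) = T x) \<and> (\<forall>x y. T x \<bullet> y = x \<bullet> T y) \<and> (\<Sum>b\<in>Basis. T b \<bullet> b) = real k"

lemma is_projD:
  assumes "is_proj k T"
  shows "T (T x) = T x" "T x \<bullet> y = x \<bullet> T y"
  using assms by (auto simp: is_proj_def)

lemma subspace_range_blinfun: "subspace (range (blinfun_apply T))"
  by (intro linear_subspace_image subspace_UNIV bounded_linear.linear[OF blinfun.bounded_linear_right])

lemma proj_range_iff:
  assumes "is_proj k T" shows "x \<in> range (blinfun_apply T) \<longleftrightarrow> T x = x"
  using is_projD(1)[OF assms] by (metis rangeE rangeI)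

lemma is_proj_trace: "is_proj k T \<Longrightarrow> (\<Sum>b\<in>Basis. T b \<bullet> b) = real k"
  unfolding is_proj_def by blast

text \<open>In an orthonormal basis \<open>B\<close> of the range, \<open>T x\<close> is the sum of
  the vectors \<open>(x \<bullet> b) *\<^sub>R b\<close>, so each \<open>b\<close> contributes its
  squared norm 1 to the trace.\<close>

lemma trace_eq_dim:
  fixes T :: "'a::euclidean_space \<Rightarrow>\<^sub>L 'a"
  assumes idem: "\<And>x. T (T x) = T x" and adj: "\<And>x y. T x \<bullet> y = x \<bullet> T y"
  shows "(\<Sum>b\<in>Basis. T b \<bullet> b) = real (dim (range (blinfun_apply T)))"
proof -
  obtain B where B: "B \<subseteq> range (blinfun_apply T)" "pairwise orthogonal B" "\<And>x. x \<in> B \<Longrightarrow> norm x = 1"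
      "independent B" "card B = dim (range (blinfun_apply T))" "span B = range (blinfun_apply T)"
    using orthonormal_basis_subspace[OF subspace_range_blinfun[of T]] by metis
  have fB: "finite B" using B(4) independent_imp_finite by blast
  have TB: "T b = b" if "b \<in> B" for b using B(1) that idem by auto
  have T: "T x = (\<Sum>b\<in>B. (x \<bullet> b) *\<^sub>R b)" for x
  proof -
    have "(\<Sum>b\<in>B. (T x \<bullet> b) *\<^sub>R b) = T x"
      using B fB by (intro orthonormal_basis_expand) auto
    moreover have "T x \<bullet> b = x \<bullet> b" if "b \<in> B" for b using adj TB[OF that] by simp
    ultimately show ?thesis by simp
  qed
  have "(\<Sum>i\<in>Basis. T i \<bullet> i) = (\<Sum>i\<in>Basis. \<Sum>b\<in>B. (i \<bullet> b) * (b \<bullet> i))"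
    unfolding T inner_sum_left by simp
  also have "\<dots> = (\<Sum>b\<in>B. \<Sum>i\<in>Basis. (b \<bullet> i) * (b \<bullet> i))"
    by (subst sum.swap) (simp add: inner_commute)
  also have "\<dots> = (\<Sum>b\<in>B. 1)"
  proof (rule sum.cong[OF refl])
    fix b assume "b \<in> B"
    then have "b \<bullet> b = 1" using B(3) by (simp add: dot_square_norm)
    then show "(\<Sum>i\<in>Basis. (b \<bullet> i) * (b \<bullet> i)) = 1" by (subst (asm) euclidean_inner)
  qed
  finally show ?thesis using B(5) by simp
qed

lemma is_proj_iff_dim:
  "is_proj k T \<longleftrightarrow> (\<forall>x. T (T x) = T x) \<and> (\<forall>x y. T x \<bullet> y = x \<bullet> T y) \<and> dim (range (blinfun_apply T)) = k"
  unfolding is_proj_def using trace_eq_dim[of T] by (metis of_nat_eq_iff)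

text \<open>The orthogonal projection onto the line through \<open>w\<close>, and 0 for
  \<open>w = 0\<close>.\<close>

definition rank1 :: "'a::euclidean_space \<Rightarrow> 'a \<Rightarrow>\<^sub>L 'a" where
  "rank1 w = (1 / (w \<bullet> w)) *\<^sub>R (blinfun_scaleR_left w o\<^sub>L blinfun_inner_left w)"

text \<open>Orthogonal projection onto the span of the range of \<open>T\<close> and \<open>x\<close>; if \<open>x\<close> already lies in
  the range of \<open>T\<close>, the convention \<open>1 / 0 = 0\<close> gives back \<open>T\<close>.\<close>

definition proj_add :: "('a::euclidean_space \<Rightarrow>\<^sub>L 'a) \<Rightarrow> 'a \<Rightarrow> 'a \<Rightarrow>\<^sub>L 'a" where
  "proj_add T x = T + rank1 (x - T x)"

lemma rank1_apply: "rank1 w x = ((x \<bullet> w) / (w \<bullet> w)) *\<^sub>R w"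
  by (simp add: rank1_def scaleR_blinfun.rep_eq)

lemma proj_add_apply: "proj_add T x y = T y + rank1 (x - T x) y"
  by (simp add: proj_add_def plus_blinfun.rep_eq)

lemma trace_rank1: "w \<noteq> 0 \<Longrightarrow> (\<Sum>b\<in>Basis. rank1 w b \<bullet> b) = 1"
proof -
  assume "w \<noteq> 0"
  have "(\<Sum>b\<in>Basis. rank1 w b \<bullet> b) = (\<Sum>b\<in>Basis. (w \<bullet> b) * (w \<bullet> b)) / (w \<bullet> w)"
    by (simp add: rank1_apply sum_divide_distrib inner_commute)
  also have "\<dots> = 1" using \<open>w \<noteq> 0\<close> by (subst euclidean_inner[of w w, symmetric]) simp
  finally show ?thesis .
qed

lemma is_proj_rank1: "w \<noteq> 0 \<Longrightarrow> is_proj 1 (rank1 w)"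
  unfolding is_proj_def using trace_rank1[of w]
  by (auto simp: rank1_apply inner_commute)

text \<open>\<open>x - T x\<close> is orthogonal to the range of \<open>T\<close>, so the two
  projections annihilate each other and their traces add.\<close>

lemma is_proj_proj_add:
  assumes T: "is_proj k T" and x: "T x \<noteq> x"
  shows "is_proj (Suc k) (proj_add T x)"
proof -
  note T1 = is_projD[OF T]
  define w where "w = x - T x"
  have w: "T w = 0" "w \<noteq> 0" using x by (auto simp: w_def blinfun.diff_right T1)
  have wT: "T y \<bullet> w = 0" for y using T1(2) w by simp
  note r = is_projD[OF is_proj_rank1[OF w(2)]]
  have Tr: "T (rank1 w y) = 0" for y by (simp add: rank1_apply blinfun.scaleR_right w)
  have rT: "rank1 w (T y) = 0" for y by (simp add: rank1_apply wT)
  have A: "proj_add T x y = T y + rank1 w y" for y by (simp add: proj_add_apply w_def)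
  have "proj_add T x (proj_add T x y) = proj_add T x y" for y
    unfolding A by (simp add: blinfun.add_right Tr rT T1 r)
  moreover have "proj_add T x y \<bullet> z = y \<bullet> proj_add T x z" for y z
    unfolding A by (simp add: inner_add_left inner_add_right T1 r)
  moreover have "(\<Sum>b\<in>Basis. proj_add T x b \<bullet> b) = real (Suc k)"
    using trace_rank1[OF w(2)] is_proj_trace[OF T] by (simp add: A inner_add_left sum.distrib)
  ultimately show ?thesis unfolding is_proj_def by blast
qed

section \<open>The action of orthogonal maps on projections\<close>

definition conj_by :: "('a::euclidean_space \<Rightarrow> 'a) \<Rightarrow> ('a \<Rightarrow>\<^sub>L 'a) \<Rightarrow> 'a \<Rightarrow>\<^sub>L 'a" where
  "conj_by g T = Blinfun g o\<^sub>L T o\<^sub>L Blinfun (inv g)"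

lemma orthogonal_transformation_bounded_linear:
  "orthogonal_transformation g \<Longrightarrow> bounded_linear g" for g :: "'a::euclidean_space \<Rightarrow> 'a"
  by (simp add: linear_conv_bounded_linear[symmetric] orthogonal_transformation_linear)

context
  fixes g :: "'a::euclidean_space \<Rightarrow> 'a"
  assumes g: "orthogonal_transformation g"
begin

lemma conj_by_apply: "conj_by g T x = g (T (inv g x))"
  using g orthogonal_transformation_inv[OF g]
  by (simp add: conj_by_def bounded_linear_Blinfun_apply orthogonal_transformation_bounded_linear)

lemma inv_orth [simp]: "inv g (g x) = x" "g (inv g x) = x"
  using orthogonal_transformation_bij[OF g] by (simp_all add: bij_is_inj bij_is_surj surj_f_inv_f)

lemma orth_inner_inv: "g x \<bullet> y = x \<bullet> inv g y"
  by (metis g inv_orth(2) orthogonal_transformation_def)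

lemma orth_linear: "g (x + y) = g x + g y" "g (x - y) = g x - g y" "g (c *\<^sub>R x) = c *\<^sub>R g x" "g 0 = 0"
  using orthogonal_transformation_linear[OF g] by (auto simp: linear_add linear_diff linear_scale linear_0)

lemma inj_orth: "inj g" using g by (rule orthogonal_transformation_inj)

lemma is_proj_conj_by: "is_proj k T \<Longrightarrow> is_proj k (conj_by g T)"
proof -
  assume T: "is_proj k T"
  have r: "range (blinfun_apply (conj_by g T)) = g ` range (blinfun_apply T)"
  proof safe
    fix x show "conj_by g T x \<in> g ` range (blinfun_apply T)" by (simp add: conj_by_apply)
    show "g (T x) \<in> range (blinfun_apply (conj_by g T))"
      using rangeI[of "blinfun_apply (conj_by g T)" "g x"] by (simp add: conj_by_apply)
  qed
  have "inv g y \<bullet> x = y \<bullet> g x" for x y using orth_inner_inv[of x y] by (simp add: inner_commute)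
  moreover have "dim (g ` range (blinfun_apply T)) = dim (range (blinfun_apply T))"
    using orthogonal_transformation_linear[OF g] inj_orth by (intro dim_image_eq) (auto intro: inj_on_subset)
  ultimately show ?thesis using T unfolding is_proj_iff_dim r
    by (auto simp: conj_by_apply orth_inner_inv)
qed

lemma orth_norm: "norm (g x) = norm x" using g by (rule orthogonal_transformation_norm)

lemma orth_norm_inv: "norm (inv g x) = norm x"
  by (metis inv_orth(2) orth_norm)

lemma orth_sgn: "g (sgn x) = sgn (g x)"
  by (simp add: sgn_div_norm orth_linear orth_norm)

lemma norm_conj_by_le: "norm (conj_by g T) \<le> norm T"
  by (rule norm_blinfun_bound) (auto simp: conj_by_apply orth_norm intro: order_trans[OF norm_blinfun] simp: orth_norm_inv)

lemma conj_by_diff: "conj_by g (S - T) = conj_by g S - conj_by g T"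
  by (rule blinfun_eqI) (simp add: conj_by_apply minus_blinfun.rep_eq orth_linear)

lemma conj_by_add: "conj_by g (S + T) = conj_by g S + conj_by g T"
  by (rule blinfun_eqI) (simp add: conj_by_apply plus_blinfun.rep_eq orth_linear)

lemma conj_by_rank1: "conj_by g (rank1 w) = rank1 (g w)"
proof (rule blinfun_eqI)
  fix x
  have "inv g x \<bullet> w = x \<bullet> g w" using orth_inner_inv[of w x] by (simp add: inner_commute)
  moreover have "g w \<bullet> g w = w \<bullet> w" using g by (simp add: orthogonal_transformation_def)
  ultimately show "conj_by g (rank1 w) x = rank1 (g w) x"
    by (simp add: conj_by_apply rank1_apply orth_linear)
qed

lemma conj_by_proj_add: "conj_by g (proj_add T x) = proj_add (conj_by g T) (g x)"
  by (simp add: proj_add_def conj_by_add conj_by_rank1 conj_by_apply orth_linear)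

end

lemma norm_conj_by:
  assumes g: "orthogonal_transformation g"
  shows "norm (conj_by g T) = norm T"
proof (rule antisym[OF norm_conj_by_le[OF g]])
  have "conj_by (inv g) (conj_by g T) = T"
    by (rule blinfun_eqI) (simp add: conj_by_apply g orthogonal_transformation_inv inv_inv_eq orthogonal_transformation_bij inv_orth)
  then show "norm T \<le> norm (conj_by g T)"
    using norm_conj_by_le[OF orthogonal_transformation_inv[OF g], of "conj_by g T"] by simp
qed

text \<open>Conjugation preserves the operator norm, so orthogonal maps act on projections by
  isometries, as \<open>measure_eqI_isometry_invariant\<close> demands.\<close>

lemma dist_conj_by: "orthogonal_transformation g \<Longrightarrow> dist (conj_by g S) (conj_by g T) = dist S T"
  by (simp add: dist_norm conj_by_diff[symmetric] norm_conj_by)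

lemma continuous_on_conj_by: "continuous_on A (conj_by g)"
  unfolding conj_by_def by (intro continuous_intros)

lemma borel_measurable_conj_by [measurable]: "conj_by g \<in> borel_measurable borel"
  by (intro borel_measurable_continuous_onI continuous_on_conj_by)

lemma borel_measurable_blinfun_apply2 [measurable (raw)]:
  fixes f :: "'m \<Rightarrow> ('a::euclidean_space \<Rightarrow>\<^sub>L 'b::euclidean_space)"
  assumes "f \<in> borel_measurable M" "h \<in> borel_measurable M"
  shows "(\<lambda>x. f x (h x)) \<in> borel_measurable M"
  using assms by (rule borel_measurable_continuous_Pair) (intro continuous_intros)

lemma borel_measurable_rank1 [measurable]: "rank1 \<in> borel_measurable borel"
proof -
  have "(\<lambda>w :: 'a. blinfun_scaleR_left w o\<^sub>L blinfun_inner_left w) \<in> borel_measurable borel"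
    by (intro borel_measurable_continuous_onI continuous_intros)
  then show ?thesis unfolding rank1_def[abs_def] by measurable
qed

lemma borel_measurable_proj_add [measurable (raw)]:
  assumes "f \<in> borel_measurable M" "h \<in> borel_measurable M"
  shows "(\<lambda>x. proj_add (f x) (h x)) \<in> borel_measurable M"
  unfolding proj_add_def using assms by measurable

lemma is_proj_diff_rank1:
  assumes T: "is_proj k T" and u: "T u = u" "norm u = 1"
  shows "is_proj (k - 1) (T - rank1 u)" "k \<ge> 1" "rank1 u (T x) = rank1 u x" "T (rank1 u x) = rank1 u x"
proof -
  note T1 = is_projD[OF T]
  have u0: "u \<noteq> 0" using u by auto
  note r = is_projD[OF is_proj_rank1[OF u0]]
  have Tr: "T (rank1 u y) = rank1 u y" for y by (simp add: rank1_apply blinfun.scaleR_right u)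
  have rT: "rank1 u (T y) = rank1 u y" for y by (simp add: rank1_apply T1 u)
  have A: "(T - rank1 u) y = T y - rank1 u y" for y by (simp add: minus_blinfun.rep_eq)
  have "dim (range (blinfun_apply T)) \<noteq> 0"
    using u u0 by (metis dim_eq_0 rangeI singletonD subsetD)
  then show k: "k \<ge> 1" using T unfolding is_proj_iff_dim by simp
  show "rank1 u (T x) = rank1 u x" "T (rank1 u x) = rank1 u x" using rT Tr by auto
  have "(T - rank1 u) ((T - rank1 u) y) = (T - rank1 u) y" for y
    unfolding A by (simp add: blinfun.diff_right Tr rT T1 r)
  moreover have "(T - rank1 u) y \<bullet> z = y \<bullet> (T - rank1 u) z" for y z
    unfolding A by (simp add: inner_diff_left inner_diff_right T1 r)
  moreover have "(\<Sum>b\<in>Basis. (T - rank1 u) b \<bullet> b) = real (k - 1)"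
    using trace_rank1[OF u0] is_proj_trace[OF T] k by (simp add: A inner_diff_left sum_subtractf)
  ultimately show "is_proj (k - 1) (T - rank1 u)" unfolding is_proj_def by blast
qed

lemma is_proj_compl:
  fixes T :: "'a::euclidean_space \<Rightarrow>\<^sub>L 'a"
  assumes T: "is_proj k T"
  shows "is_proj (DIM('a) - k) (id_blinfun - T)" "k \<le> DIM('a)"
proof -
  note T1 = is_projD[OF T]
  show k: "k \<le> DIM('a)" using T unfolding is_proj_iff_dim by (metis dim_subset_UNIV)
  have A: "(id_blinfun - T) y = y - T y" for y by (simp add: minus_blinfun.rep_eq)
  have "(id_blinfun - T) ((id_blinfun - T) y) = (id_blinfun - T) y" for y
    unfolding A by (simp add: blinfun.diff_right T1)
  moreover have "(id_blinfun - T) y \<bullet> z = y \<bullet> (id_blinfun - T) z" for y z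
    unfolding A by (simp add: inner_diff_left inner_diff_right T1)
  moreover have "(\<Sum>b\<in>Basis. (id_blinfun - T) b \<bullet> b) = real (DIM('a) - k)"
    using is_proj_trace[OF T] k by (simp add: A inner_diff_left sum_subtractf)
  ultimately show "is_proj (DIM('a) - k) (id_blinfun - T)" unfolding is_proj_def by blast
qed

text \<open>The line of \<open>u\<close>, its orthogonal complement in the range of
  \<open>T\<close>, and the kernel of \<open>T\<close> split the space orthogonally;
  \<open>S\<close> and \<open>v\<close> give a splitting with the same dimensions. Linear isometries
  between corresponding pieces glue to \<open>g\<close>.\<close>

lemma flag_transitive:
  fixes T S :: "'a::euclidean_space \<Rightarrow>\<^sub>L 'a"
  assumes T: "is_proj k T" and u: "T u = u" "norm u = 1"
    and S: "is_proj k S" and v: "S v = v" "norm v = 1"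
  shows "\<exists>g. orthogonal_transformation g \<and> g u = v \<and> conj_by g T = S"
proof -
  define T2 where "T2 = T - rank1 u"
  define S2 where "S2 = S - rank1 v"
  define T3 where "T3 = id_blinfun - T"
  define S3 where "S3 = id_blinfun - S"
  have P: "is_proj (k-1) T2" "is_proj (k-1) S2" "is_proj (DIM('a) - k) T3" "is_proj (DIM('a) - k) S3"
    unfolding T2_def S2_def T3_def S3_def
    using is_proj_diff_rank1(1)[OF T u] is_proj_diff_rank1(1)[OF S v] is_proj_compl(1)[OF T] is_proj_compl(1)[OF S] by auto
  have "dim (range (blinfun_apply T2)) \<le> dim (range (blinfun_apply S2))"
    using P by (simp add: is_proj_iff_dim)
  then obtain f2 where f2: "linear f2" "f2 \<in> range (blinfun_apply T2) \<rightarrow> range (blinfun_apply S2)"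
      "\<And>x. x \<in> range (blinfun_apply T2) \<Longrightarrow> norm (f2 x) = norm x"
    using isometry_subset_subspace[OF subspace_range_blinfun subspace_range_blinfun] by metis
  have "dim (range (blinfun_apply T3)) \<le> dim (range (blinfun_apply S3))"
    using P by (simp add: is_proj_iff_dim)
  then obtain f3 where f3: "linear f3" "f3 \<in> range (blinfun_apply T3) \<rightarrow> range (blinfun_apply S3)"
      "\<And>x. x \<in> range (blinfun_apply T3) \<Longrightarrow> norm (f3 x) = norm x"
    using isometry_subset_subspace[OF subspace_range_blinfun subspace_range_blinfun] by metis
  have T2a: "T2 x = T x - (x \<bullet> u) *\<^sub>R u" for x
    using u by (simp add: T2_def minus_blinfun.rep_eq rank1_apply dot_square_norm)
  have S2a: "S2 x = S x - (x \<bullet> v) *\<^sub>R v" for x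
    using v by (simp add: S2_def minus_blinfun.rep_eq rank1_apply dot_square_norm)
  have T3a: "T3 x = x - T x" and S3a: "S3 x = x - S x" for x
    by (simp_all add: T3_def S3_def minus_blinfun.rep_eq)
  have uu: "u \<bullet> u = 1" "v \<bullet> v = 1" using u v by (simp_all add: dot_square_norm)
  have Tu: "T x \<bullet> u = x \<bullet> u" and Sv: "S x \<bullet> v = x \<bullet> v" for x
    using is_projD(2)[OF T] u is_projD(2)[OF S] v by auto
  have F2: "S2 (f2 (T2 x)) = f2 (T2 x)" for x
    using f2(2) proj_range_iff[OF P(2)] by blast
  have F3: "S3 (f3 (T3 x)) = f3 (T3 x)" for x
    using f3(2) proj_range_iff[OF P(4)] by blast
  have F2v: "f2 (T2 x) \<bullet> v = 0" for x
  proof -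
    have "S2 y \<bullet> v = 0" for y using uu by (simp add: S2a inner_diff_left Sv)
    then show ?thesis using F2 by metis
  qed
  have SF2: "S (f2 (T2 x)) = f2 (T2 x)" for x using F2[of x] by (simp add: S2a F2v)
  have SF3: "S (f3 (T3 x)) = 0" for x using F3[of x] by (simp add: S3a)
  have F3o: "f3 (T3 x) \<bullet> S y = 0" for x y using is_projD(2)[OF S, of "f3 (T3 x)" y] SF3[of x] by simp
  define g where "g x = (x \<bullet> u) *\<^sub>R v + f2 (T2 x) + f3 (T3 x)" for x
  have lin: "linear g"
    unfolding g_def by (intro linear_compose_add linear_compose[OF _ f2(1), unfolded o_def]
        linear_compose[OF _ f3(1), unfolded o_def] bounded_linear.linear[OF blinfun.bounded_linear_right])
      (auto simp: linear_iff inner_add_left scaleR_add_left)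
  have nrm: "norm (g x) = norm x" for x
  proof -
    have "(norm (g x))\<^sup>2 = g x \<bullet> g x" by (simp add: dot_square_norm)
    also have "\<dots> = (x \<bullet> u)\<^sup>2 + f2 (T2 x) \<bullet> f2 (T2 x) + f3 (T3 x) \<bullet> f3 (T3 x)"
    proof -
      have a: "f2 (T2 x) \<bullet> v = 0" by (rule F2v)
      have b: "f3 (T3 x) \<bullet> v = 0" using F3o[of x v] v by simp
      have c: "f3 (T3 x) \<bullet> f2 (T2 x) = 0" using F3o[of x "f2 (T2 x)"] SF2 by simp
      show ?thesis unfolding g_def inner_add_left inner_add_right
        using a b c by (simp add: inner_commute uu power2_eq_square)
    qed
    also have "f2 (T2 x) \<bullet> f2 (T2 x) = T2 x \<bullet> T2 x" using f2(3)[of "T2 x"] by (simp add: dot_square_norm)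
    also have "f3 (T3 x) \<bullet> f3 (T3 x) = T3 x \<bullet> T3 x" using f3(3)[of "T3 x"] by (simp add: dot_square_norm)
    also have "(x \<bullet> u)\<^sup>2 + T2 x \<bullet> T2 x + T3 x \<bullet> T3 x = x \<bullet> x"
    proof -
      have e: "x \<bullet> T x = T x \<bullet> T x" "T x \<bullet> x = T x \<bullet> T x"
        using is_projD[OF T] by (metis, metis)
      have e': "u \<bullet> T x = x \<bullet> u" "u \<bullet> x = x \<bullet> u" using Tu[of x] by (simp_all add: inner_commute)
      show ?thesis
        by (simp add: T2a T3a inner_diff_left inner_diff_right e e' uu Tu power2_eq_square)
    qed
    finally show ?thesis by (simp add: dot_square_norm)
  qed
  have orth: "orthogonal_transformation g" using lin nrm by (simp add: orthogonal_transformation)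
  have gu: "g u = v"
    by (simp add: g_def uu T2a T3a u linear_0[OF f2(1)] linear_0[OF f3(1)])
  have gT: "g (T x) = S (g x)" for x
  proof -
    have "T2 (T x) = T2 x" "T3 (T x) = 0" by (simp_all add: T2a T3a is_projD[OF T] u)
    then have "g (T x) = (x \<bullet> u) *\<^sub>R v + f2 (T2 x)"
      by (simp add: g_def Tu linear_0[OF f3(1)])
    moreover have "S (g x) = (x \<bullet> u) *\<^sub>R v + f2 (T2 x)"
      by (simp add: g_def blinfun.add_right blinfun.scaleR_right v SF2 SF3)
    ultimately show ?thesis by simp
  qed
  have "conj_by g T = S"
    by (rule blinfun_eqI) (simp add: conj_by_apply[OF orth] gT inv_orth[OF orth])
  then show ?thesis using orth gu by blast
qed

text \<open>The link to \<open>grassmannian_borel\<close>, whose coordinate of a subspace is its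
  nearest-point map; the proof is Pythagoras.\<close>

lemma closest_point_range_proj:
  assumes T: "is_proj k T"
  shows "closest_point (range (blinfun_apply T)) = blinfun_apply T"
proof
  fix x
  have "T x = closest_point (range (blinfun_apply T)) x"
  proof (rule closest_point_unique)
    show "convex (range (blinfun_apply T))" "closed (range (blinfun_apply T))"
      using subspace_range_blinfun[of T] by (auto simp: subspace_imp_convex closed_subspace)
    show "\<forall>z\<in>range (blinfun_apply T). dist x (T x) \<le> dist x z"
    proof safe
      fix y
      have "(x - T x) \<bullet> (T x - T y) = 0"
        using is_projD[OF T] by (simp add: inner_diff_left inner_diff_right)
      then have "(norm (x - T y))\<^sup>2 = (norm (x - T x))\<^sup>2 + (norm (T x - T y))\<^sup>2"
        using norm_add_Pythagorean[of "x - T x" "T x - T y"] by (simp add: orthogonal_def)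
      then have "(norm (x - T x))\<^sup>2 \<le> (norm (x - T y))\<^sup>2" by simp
      then show "dist x (T x) \<le> dist x (T y)" by (simp add: dist_norm)
    qed
  qed auto
  then show "closest_point (range (blinfun_apply T)) x = T x" by simp
qed

definition proj_onto :: "'a::euclidean_space set \<Rightarrow> 'a \<Rightarrow>\<^sub>L 'a" where
  "proj_onto \<xi> = Blinfun (closest_point \<xi>)"

lemma proj_onto_range:
  assumes "is_proj k T" shows "proj_onto (range (blinfun_apply T)) = T"
  using closest_point_range_proj[OF assms] by (simp add: proj_onto_def blinfun_apply_inverse)

lemma proj_onto_subspace:
  assumes "subspace \<xi>"
  shows "is_proj (dim \<xi>) (proj_onto \<xi>)" "range (blinfun_apply (proj_onto \<xi>)) = \<xi>"
proof -
  obtain B where B: "B \<subseteq> \<xi>" "pairwise orthogonal B" "\<And>x. x \<in> B \<Longrightarrow> norm x = 1"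
      "independent B" "card B = dim \<xi>" "span B = \<xi>"
    using orthonormal_basis_subspace[OF assms] by metis
  have fB: "finite B" using B(4) independent_imp_finite by blast
  define T where "T = Blinfun (\<lambda>x. \<Sum>b\<in>B. (x \<bullet> b) *\<^sub>R b)"
  have Ta: "T x = (\<Sum>b\<in>B. (x \<bullet> b) *\<^sub>R b)" for x
    unfolding T_def by (subst bounded_linear_Blinfun_apply) (auto intro!: bounded_linear_intros)
  have T\<xi>: "T x = x" if "x \<in> \<xi>" for x
    unfolding Ta using B fB that by (intro orthonormal_basis_expand) auto
  have T\<xi>': "T x \<in> \<xi>" for x unfolding Ta B(6)[symmetric] by (intro span_sum span_scale span_base)
  have r: "range (blinfun_apply T) = \<xi>" using T\<xi> T\<xi>' by (metis image_subsetI rangeI subsetI subset_antisym)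
  have "is_proj (dim \<xi>) T"
    unfolding is_proj_iff_dim r
  proof (intro conjI allI)
    show "T (T x) = T x" for x using T\<xi> T\<xi>' by blast
    show "T x \<bullet> y = x \<bullet> T y" for x y
      by (simp add: Ta inner_sum_left inner_sum_right inner_commute[of y] mult.commute)
  qed simp
  then show "is_proj (dim \<xi>) (proj_onto \<xi>)" "range (blinfun_apply (proj_onto \<xi>)) = \<xi>"
    using proj_onto_range[of _ T] r by auto
qed

section \<open>Volumes of sections\<close>

text \<open>The uniqueness argument for Haar measure: the double integral of
  \<open>indicator A x * indicator B (x + y)\<close> is evaluated in two ways. Reflection invariance
  of \<open>N\<close> enters because the second evaluation meets \<open>x - y\<close>. The
  cross-multiplied form stays meaningful when masses are 0 or infinite.\<close>

lemma translation_invariant_measures_proportional: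
  fixes M N :: "'a::euclidean_space measure"
  assumes sM: "sets M = sets borel" and sN: "sets N = sets borel"
    and sfM: "sigma_finite_measure M" and sfN: "sigma_finite_measure N"
    and aM: "AE x in M. x \<in> \<xi>" and aN: "AE x in N. x \<in> \<xi>"
    and tM: "\<And>v. v \<in> \<xi> \<Longrightarrow> distr M borel (\<lambda>x. x + v) = M"
    and tN: "\<And>v. v \<in> \<xi> \<Longrightarrow> distr N borel (\<lambda>x. x + v) = N"
    and rN: "distr N borel uminus = N"
    and neg: "\<And>v. v \<in> \<xi> \<Longrightarrow> - v \<in> \<xi>"
    and A: "A \<in> sets borel" and B: "B \<in> sets borel"
  shows "emeasure M A * emeasure N B = emeasure M B * emeasure N A"
proof -
  interpret M: sigma_finite_measure M by fact
  interpret N: sigma_finite_measure N by fact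
  interpret P: pair_sigma_finite M N by standard
  note [measurable_cong] = sM sN
  note [measurable] = A B
  have tM': "emeasure M {x. x + v \<in> C} = emeasure M C" if "v \<in> \<xi>" "C \<in> sets borel" for v C
  proof -
    have "emeasure (distr M borel (\<lambda>x. x + v)) C = emeasure M {x. x + v \<in> C}"
      using that(2) sets_eq_imp_space_eq[OF sM] by (subst emeasure_distr) (auto simp: vimage_def)
    then show ?thesis using tM[OF that(1)] by simp
  qed
  have tN': "emeasure N {x. x + v \<in> C} = emeasure N C" if "v \<in> \<xi>" "C \<in> sets borel" for v C
  proof -
    have "emeasure (distr N borel (\<lambda>x. x + v)) C = emeasure N {x. x + v \<in> C}"
      using that(2) sets_eq_imp_space_eq[OF sN] by (subst emeasure_distr) (auto simp: vimage_def)
    then show ?thesis using tN[OF that(1)] by simp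
  qed
  have rN': "emeasure N {x. - x \<in> C} = emeasure N C" if "C \<in> sets borel" for C
  proof -
    have "emeasure (distr N borel uminus) C = emeasure N {x. - x \<in> C}"
      using that sets_eq_imp_space_eq[OF sN] by (subst emeasure_distr) (auto simp: vimage_def)
    then show ?thesis using rN by simp
  qed
  have e: "(\<integral>\<^sup>+x. indicator A (f x) * indicator B (h x) \<partial>L) = emeasure L {x. f x \<in> A \<and> h x \<in> B}"
    if [measurable]: "f \<in> borel_measurable borel" "h \<in> borel_measurable borel" and sL[measurable_cong]: "sets L = sets borel" for f h and L :: "'a measure"
  proof -
    have "{x. f x \<in> A \<and> h x \<in> B} \<in> sets L" unfolding sL by measurable
    then have "emeasure L {x. f x \<in> A \<and> h x \<in> B} = (\<integral>\<^sup>+x. indicator {x. f x \<in> A \<and> h x \<in> B} x \<partial>L)" by simp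
    also have "\<dots> = (\<integral>\<^sup>+x. indicator A (f x) * indicator B (h x) \<partial>L)"
      by (intro nn_integral_cong) (auto simp: indicator_def)
    finally show ?thesis by simp
  qed
  have "emeasure M A * emeasure N B = (\<integral>\<^sup>+x. indicator A x * emeasure N B \<partial>M)"
    by (subst nn_integral_multc) (auto simp: sM)
  also have "\<dots> = (\<integral>\<^sup>+x. \<integral>\<^sup>+y. indicator A x * indicator B (x + y) \<partial>N \<partial>M)"
  proof (rule nn_integral_cong_AE, use aM in eventually_elim)
    fix x assume x: "x \<in> \<xi>"
    have "(\<integral>\<^sup>+y. indicator A x * indicator B (x + y) \<partial>N) = indicator A x * (\<integral>\<^sup>+y. indicator {y. y + x \<in> B} y \<partial>N)"
      by (subst nn_integral_cmult[symmetric]) (auto intro!: nn_integral_cong simp: indicator_def add.commute)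
    also have "(\<integral>\<^sup>+y. indicator {y. y + x \<in> B} y \<partial>N) = emeasure N {y. y + x \<in> B}"
    proof (rule nn_integral_indicator)
      show "{y. y + x \<in> B} \<in> sets N" unfolding sN by measurable
    qed
    finally show "indicator A x * emeasure N B = (\<integral>\<^sup>+y. indicator A x * indicator B (x + y) \<partial>N)"
      using tN'[OF x B] by simp
  qed
  also have "\<dots> = (\<integral>\<^sup>+y. \<integral>\<^sup>+x. indicator A x * indicator B (x + y) \<partial>M \<partial>N)"
    by (rule P.Fubini'[symmetric]) measurable
  \<comment> \<open>Shift \<open>x\<close> by \<open>y\<close> for fixed \<open>y\<close>: almost
    every \<open>y\<close> lies in \<open>\<xi>\<close>, so \<open>M\<close> is invariant under this
    shift.\<close>
  also have "\<dots> = (\<integral>\<^sup>+y. \<integral>\<^sup>+x. indicator A (x - y) * indicator B x \<partial>M \<partial>N)"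
  proof (rule nn_integral_cong_AE, use aN in eventually_elim)
    fix y assume y: "y \<in> \<xi>"
    have C: "{x. x - y \<in> A \<and> x \<in> B} \<in> sets borel" by measurable
    have "(\<integral>\<^sup>+x. indicator A x * indicator B (x + y) \<partial>M) = emeasure M {x. x \<in> A \<and> x + y \<in> B}"
      by (rule e[of "\<lambda>x. x" "\<lambda>x. x + y"]) (auto simp: sM)
    also have "\<dots> = emeasure M {x. x - y \<in> A \<and> x \<in> B}" using tM'[OF y C] by simp
    also have "\<dots> = (\<integral>\<^sup>+x. indicator A (x - y) * indicator B x \<partial>M)"
      by (rule e[of "\<lambda>x. x - y" "\<lambda>x. x", symmetric]) (auto simp: sM)
    finally show "(\<integral>\<^sup>+x. indicator A x * indicator B (x + y) \<partial>M) = (\<integral>\<^sup>+x. indicator A (x - y) * indicator B x \<partial>M)" .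
  qed
  also have "\<dots> = (\<integral>\<^sup>+x. \<integral>\<^sup>+y. indicator A (x - y) * indicator B x \<partial>N \<partial>M)"
    by (rule P.Fubini') measurable
  also have "\<dots> = (\<integral>\<^sup>+x. emeasure N A * indicator B x \<partial>M)"
  proof (rule nn_integral_cong_AE, use aM in eventually_elim)
    fix x assume x: "x \<in> \<xi>"
    have C: "{y. y + x \<in> A} \<in> sets borel" by measurable
    have "(\<integral>\<^sup>+y. indicator A (x - y) * indicator B x \<partial>N) = (\<integral>\<^sup>+y. indicator {y. x - y \<in> A} y \<partial>N) * indicator B x"
      by (subst nn_integral_multc[symmetric]) (auto intro!: nn_integral_cong simp: indicator_def)
    also have "(\<integral>\<^sup>+y. indicator {y. x - y \<in> A} y \<partial>N) = emeasure N {y. x - y \<in> A}"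
    proof (rule nn_integral_indicator)
      show "{y. x - y \<in> A} \<in> sets N" unfolding sN by measurable
    qed
    also have "\<dots> = emeasure N {y. y + x \<in> A}" using rN'[OF C] by (simp add: add.commute)
    also have "\<dots> = emeasure N A" by (rule tN'[OF x A])
    finally show "(\<integral>\<^sup>+y. indicator A (x - y) * indicator B x \<partial>N) = emeasure N A * indicator B x" .
  qed
  also have "\<dots> = emeasure M B * emeasure N A"
    by (subst nn_integral_cmult) (auto simp: sM mult.commute)
  finally show ?thesis .
qed

lemma sigma_finite_if_finite_cballs:
  fixes M :: "'a::euclidean_space measure"
  assumes "sets M = sets borel" "\<And>r. r > 0 \<Longrightarrow> emeasure M (cball 0 r) < top"
  shows "sigma_finite_measure M"
proof
  have "\<Union>(range (\<lambda>n. cball (0::'a) (real (Suc n)))) = UNIV"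
  proof safe
    fix x :: 'a
    obtain n where "norm x \<le> real n" using real_arch_simple by blast
    then show "x \<in> \<Union>(range (\<lambda>n. cball (0::'a) (real (Suc n))))" by (auto intro!: exI[of _ n])
  qed simp
  then show "\<exists>A. countable A \<and> A \<subseteq> sets M \<and> \<Union>A = space M \<and> (\<forall>a\<in>A. emeasure M a \<noteq> \<infinity>)"
    using assms sets_eq_imp_space_eq[OF assms(1)]
    by (intro exI[of _ "range (\<lambda>n. cball (0::'a) (real (Suc n)))"]) (auto simp: less_top)
qed

lemma distr_lborel_translation: "distr lborel borel (\<lambda>x. x + v) = (lborel :: 'a::euclidean_space measure)"
proof -
  have "(\<lambda>x. x + v) = (+) v" by (simp add: fun_eq_iff add.commute)
  then show ?thesis by (simp add: lborel_distr_plus)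
qed

lemma distr_lborel_uminus: "distr lborel borel uminus = (lborel :: 'a::euclidean_space measure)"
  using lborel_affine[of "-1" "0::'a"] by (simp add: density_1)

text \<open>The image measure is again translation invariant, because \<open>g x + v\<close> is
  \<open>g (x + inv g v)\<close>, and it gives the unit ball its usual mass, so proportionality
  forces equality.\<close>

lemma lborel_orthogonal:
  fixes g :: "'a::euclidean_space \<Rightarrow> 'a"
  assumes g: "orthogonal_transformation g"
  shows "distr lborel borel g = lborel"
proof -
  have gm[measurable]: "g \<in> borel_measurable borel"
    using orthogonal_transformation_bounded_linear[OF g]
    by (intro borel_measurable_continuous_onI linear_continuous_on)
  define M where "M = distr lborel borel g"
  have sM: "sets M = sets borel" by (simp add: M_def)
  have Mball: "emeasure M (cball 0 r) = emeasure lborel (cball (0::'a) r)" for r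
    unfolding M_def by (subst emeasure_distr) (auto simp: vimage_def orth_norm[OF g] cball_def)
  have eq: "emeasure M A * emeasure lborel (cball (0::'a) 1) = emeasure M (cball 0 1) * emeasure lborel A"
    if "A \<in> sets borel" for A
  proof (rule translation_invariant_measures_proportional[where \<xi>=UNIV])
    show "sigma_finite_measure M"
      by (rule sigma_finite_if_finite_cballs) (use emeasure_lborel_cball_finite[of "0::'a"] in \<open>auto simp: sM Mball\<close>)
    show "sigma_finite_measure (lborel :: 'a measure)" by (rule sigma_finite_lborel)
    show "distr M borel (\<lambda>x. x + v) = M" for v
    proof -
      have "distr M borel (\<lambda>x. x + v) = distr lborel borel (\<lambda>x. g x + v)"
        unfolding M_def by (subst distr_distr) (auto simp: o_def)
      also have "(\<lambda>x. g x + v) = (\<lambda>x. g (x + inv g v))" by (simp add: orth_linear[OF g] inv_orth[OF g])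
      also have "distr lborel borel (\<lambda>x. g (x + inv g v)) = distr (distr lborel borel (\<lambda>x. x + inv g v)) borel g"
        by (subst distr_distr) (auto simp: o_def)
      finally show ?thesis by (simp add: distr_lborel_translation M_def)
    qed
  qed (auto simp: sM distr_lborel_translation distr_lborel_uminus that)
  have "unit_ball_vol (real DIM('a)) > 0" by simp
  then have b: "emeasure lborel (cball (0::'a) 1) \<noteq> 0" "emeasure lborel (cball (0::'a) 1) \<noteq> top"
    by (simp_all only: emeasure_cball[OF zero_le_one] power_one mult_1_right ennreal_eq_0_iff not_le ennreal_neq_top) simp
  show ?thesis
  proof (rule measure_eqI)
    fix A assume "A \<in> sets (distr lborel borel g)"
    then have "emeasure M A * emeasure lborel (cball (0::'a) 1) = emeasure lborel A * emeasure lborel (cball (0::'a) 1)"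
      using eq[of A] Mball[of 1] by (simp add: mult.commute)
    then show "emeasure (distr lborel borel g) A = emeasure lborel A"
      using b unfolding M_def[symmetric] by (metis ennreal_mult_cancel_left mult.commute)
  qed simp
qed

text \<open>The part over \<open>L\<close> of the tube of radius 1 around the range of \<open>T\<close>. Its Lebesgue measure is
  proportional to the volume of the section of \<open>L\<close> by this subspace, and as a function of \<open>T\<close> it
  is measurable without any choice of coordinates.\<close>

definition slab :: "('a::euclidean_space \<Rightarrow>\<^sub>L 'a) \<Rightarrow> 'a set \<Rightarrow> 'a set" where
  "slab T L = {x. T x \<in> L \<and> norm (x - T x) \<le> 1}"

text \<open>Integrating out the unit ball of the orthogonal complement leaves a translation
  invariant measure on the range of \<open>T\<close>.\<close>

definition slab_measure :: "('a::euclidean_space \<Rightarrow>\<^sub>L 'a) \<Rightarrow> 'a measure" where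
  "slab_measure T = distr (density lborel (indicator {x. norm (x - T x) \<le> 1})) borel (blinfun_apply T)"

lemma measurable_slab [measurable]:
  assumes "L \<in> sets borel" shows "slab T L \<in> sets borel"
  unfolding slab_def using assms by measurable

lemma sets_slab_measure [simp, measurable_cong]: "sets (slab_measure T) = sets borel"
  by (simp add: slab_measure_def)

lemma emeasure_slab_measure:
  assumes [measurable]: "L \<in> sets borel"
  shows "emeasure (slab_measure T) L = emeasure lborel (slab T L)"
proof -
  have "emeasure (slab_measure T) L = (\<integral>\<^sup>+x. indicator {x. norm (x - T x) \<le> 1} x * indicator (T -` L) x \<partial>lborel)"
  proof -
    have [measurable]: "T -` L \<in> sets borel"
      using measurable_sets[of "blinfun_apply T" borel borel L] by simp
    show ?thesis unfolding slab_measure_def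
      by (subst emeasure_distr, measurable, subst emeasure_density) (auto simp: vimage_def)
  qed
  also have "\<dots> = (\<integral>\<^sup>+x. indicator (slab T L) x \<partial>lborel)"
    by (intro nn_integral_cong) (auto simp: indicator_def slab_def)
  finally show ?thesis by simp
qed

lemma slab_cball_subset: "slab T (cball 0 r) \<subseteq> cball 0 (r + 1)"
proof
  fix x assume "x \<in> slab T (cball 0 r)"
  then have "norm (T x) \<le> r" "norm (x - T x) \<le> 1" by (auto simp: slab_def)
  then show "x \<in> cball 0 (r + 1)" using norm_triangle_ineq[of "T x" "x - T x"] by simp
qed

lemma emeasure_slab_cball_finite:
  fixes T :: "'a::euclidean_space \<Rightarrow>\<^sub>L 'a"
  shows "emeasure lborel (slab T (cball 0 r)) < top"
proof -
  have "emeasure lborel (slab T (cball 0 r)) \<le> emeasure lborel (cball (0::'a) (r + 1))"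
    by (intro emeasure_mono slab_cball_subset) simp
  also have "\<dots> < top" using emeasure_lborel_cball_finite[of "0::'a" "r+1"] by simp
  finally show ?thesis .
qed

lemma translate_lborel: "C \<in> sets borel \<Longrightarrow> emeasure lborel {x. x + v \<in> C} = emeasure lborel (C :: 'a::euclidean_space set)"
  using arg_cong[OF distr_lborel_translation[of v], of "\<lambda>M. emeasure M C"]
  by (subst (asm) emeasure_distr) (auto simp: vimage_def)

lemma slab_measure_invariant:
  assumes T: "is_proj k T"
  shows "sigma_finite_measure (slab_measure T)" "AE x in slab_measure T. x \<in> range (blinfun_apply T)"
    "\<And>v. v \<in> range (blinfun_apply T) \<Longrightarrow> distr (slab_measure T) borel (\<lambda>x. x + v) = slab_measure T"
    "distr (slab_measure T) borel uminus = slab_measure T"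
proof -
  show "sigma_finite_measure (slab_measure T)"
    by (rule sigma_finite_if_finite_cballs) (auto simp: emeasure_slab_measure emeasure_slab_cball_finite)
  have "closed (range (blinfun_apply T))" using closed_subspace[OF subspace_range_blinfun] by blast
  then have [measurable]: "range (blinfun_apply T) \<in> sets borel" by simp
  show "AE x in slab_measure T. x \<in> range (blinfun_apply T)"
    unfolding slab_measure_def by (subst AE_distr_iff) auto
  show "distr (slab_measure T) borel (\<lambda>x. x + v) = slab_measure T" if v: "v \<in> range (blinfun_apply T)" for v
  proof (rule measure_eqI)
    fix A assume "A \<in> sets (distr (slab_measure T) borel (\<lambda>x. x + v))"
    then have A[measurable]: "A \<in> sets borel" by simp
    have Tv: "T v = v" using v proj_range_iff[OF T] by blast
    have "emeasure (distr (slab_measure T) borel (\<lambda>x. x + v)) A = emeasure (slab_measure T) {x. x + v \<in> A}"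
      by (subst emeasure_distr) (auto simp: vimage_def sets_eq_imp_space_eq[OF sets_slab_measure])
    also have "\<dots> = emeasure lborel (slab T {x. x + v \<in> A})" by (rule emeasure_slab_measure) measurable
    also have "slab T {x. x + v \<in> A} = {x. x + v \<in> slab T A}"
      by (auto simp: slab_def blinfun.add_right Tv)
    also have "emeasure lborel \<dots> = emeasure lborel (slab T A)" by (rule translate_lborel) measurable
    finally show "emeasure (distr (slab_measure T) borel (\<lambda>x. x + v)) A = emeasure (slab_measure T) A"
      by (simp add: emeasure_slab_measure)
  qed simp
  show "distr (slab_measure T) borel uminus = slab_measure T"
  proof (rule measure_eqI)
    fix A assume "A \<in> sets (distr (slab_measure T) borel uminus)"
    then have A[measurable]: "A \<in> sets borel" by simp
    have "emeasure (distr (slab_measure T) borel uminus) A = emeasure (slab_measure T) {x. - x \<in> A}"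
      by (subst emeasure_distr) (auto simp: vimage_def sets_eq_imp_space_eq[OF sets_slab_measure])
    also have "\<dots> = emeasure lborel (slab T {x. - x \<in> A})" by (rule emeasure_slab_measure) measurable
    also have "slab T {x. - x \<in> A} = {x. - x \<in> slab T A}"
      by (auto simp: slab_def blinfun.minus_right norm_minus_commute)
    also have "emeasure lborel \<dots> = emeasure (distr lborel borel uminus) (slab T A)"
      by (subst emeasure_distr) (auto simp: vimage_def)
    finally show "emeasure (distr (slab_measure T) borel uminus) A = emeasure (slab_measure T) A"
      by (simp add: emeasure_slab_measure distr_lborel_uminus)
  qed simp
qed

section \<open>Section volume compared with tube volume\<close>

lemma subspace_lborel_orthonormal:
  fixes \<xi> :: "'a::euclidean_space set"
  assumes "subspace \<xi>"
  obtains B where "finite B" "card B = dim \<xi>" "span B = \<xi>" "pairwise orthogonal B" "\<And>b. b \<in> B \<Longrightarrow> norm b = 1"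
    "subspace_lborel \<xi> = distr (\<Pi>\<^sub>M b\<in>B. (lborel :: real measure)) borel (\<lambda>c. \<Sum>b\<in>B. c b *\<^sub>R b)"
proof -
  define B where "B = (SOME B. B \<subseteq> \<xi> \<and> pairwise orthogonal B \<and> (\<forall>b\<in>B. norm b = 1) \<and> span B = \<xi>)"
  have "\<exists>B. B \<subseteq> \<xi> \<and> pairwise orthogonal B \<and> (\<forall>b\<in>B. norm b = 1) \<and> span B = \<xi>"
    using orthonormal_basis_subspace[OF assms] by metis
  then have "B \<subseteq> \<xi> \<and> pairwise orthogonal B \<and> (\<forall>b\<in>B. norm b = 1) \<and> span B = \<xi>"
    unfolding B_def by (rule someI_ex)
  then have B: "B \<subseteq> \<xi>" "pairwise orthogonal B" "\<And>b. b \<in> B \<Longrightarrow> norm b = 1" "span B = \<xi>" by auto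
  have "0 \<notin> B" using B(3) by force
  then have "independent B" using pairwise_orthogonal_independent[OF B(2)] by blast
  then have "finite B" "card B = dim \<xi>"
    using B(4) independent_imp_finite dim_span_eq_card_independent[of B] by (blast, simp)
  moreover have "subspace_lborel \<xi> = distr (\<Pi>\<^sub>M b\<in>B. (lborel :: real measure)) borel (\<lambda>c. \<Sum>b\<in>B. c b *\<^sub>R b)"
    unfolding subspace_lborel_def Let_def B_def[symmetric] ..
  ultimately show ?thesis using that B by blast
qed

lemma PiM_lborel_translation:
  assumes "finite B"
  shows "distr (\<Pi>\<^sub>M b\<in>B. (lborel :: real measure)) (\<Pi>\<^sub>M b\<in>B. lborel) (\<lambda>c. \<lambda>b\<in>B. c b + a b) = (\<Pi>\<^sub>M b\<in>B. lborel)"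
proof -
  interpret product_sigma_finite "\<lambda>_. lborel :: real measure" by standard
  show ?thesis
  proof (rule PiM_eqI[OF assms])
    fix A :: "'a \<Rightarrow> real set" assume A: "\<And>i. i \<in> B \<Longrightarrow> A i \<in> sets lborel"
    have "(\<lambda>c. \<lambda>b\<in>B. c b + a b) -` (Pi\<^sub>E B A) \<inter> space (\<Pi>\<^sub>M b\<in>B. (lborel :: real measure)) = (\<Pi>\<^sub>E b\<in>B. {x. x + a b \<in> A b})"
      by (auto simp: space_PiM PiE_iff)
    moreover have AA: "{x. x + a b \<in> A b} \<in> sets lborel" if "b \<in> B" for b
      using A[OF that] by simp measurable
    ultimately have "emeasure (distr (\<Pi>\<^sub>M b\<in>B. (lborel :: real measure)) (\<Pi>\<^sub>M b\<in>B. lborel) (\<lambda>c. \<lambda>b\<in>B. c b + a b)) (Pi\<^sub>E B A)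
        = (\<Prod>b\<in>B. emeasure lborel {x. x + a b \<in> A b})"
      using A assms by (subst emeasure_distr) (auto intro!: sets_PiM_I_finite emeasure_PiM simp del: sets_lborel)
    also have "\<dots> = (\<Prod>b\<in>B. emeasure lborel (A b))"
      using A by (intro prod.cong refl translate_lborel) auto
    finally show "emeasure (distr (\<Pi>\<^sub>M b\<in>B. (lborel :: real measure)) (\<Pi>\<^sub>M b\<in>B. lborel) (\<lambda>c. \<lambda>b\<in>B. c b + a b)) (Pi\<^sub>E B A)
        = (\<Prod>b\<in>B. emeasure lborel (A b))" .
  qed simp
qed

text \<open>Translations determine the measure up to a factor and balls determine the factor. The
  mass of a ball is the same for every orthonormal basis, so the arbitrary choice in
  \<open>subspace_lborel\<close> leaves no trace afterwards.\<close>

lemma subspace_lborel_invariant: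
  fixes \<xi> :: "'a::euclidean_space set"
  assumes \<xi>: "subspace \<xi>"
  shows "sets (subspace_lborel \<xi>) = sets borel" "AE x in subspace_lborel \<xi>. x \<in> \<xi>"
    "\<And>v. v \<in> \<xi> \<Longrightarrow> distr (subspace_lborel \<xi>) borel (\<lambda>x. x + v) = subspace_lborel \<xi>"
    "\<And>r. r > 0 \<Longrightarrow> emeasure (subspace_lborel \<xi>) (cball 0 r) = ennreal (unit_ball_vol (real (dim \<xi>)) * r ^ dim \<xi>)"
proof -
  obtain B where B: "finite B" "card B = dim \<xi>" "span B = \<xi>" "pairwise orthogonal B" "\<And>b. b \<in> B \<Longrightarrow> norm b = 1"
    and L: "subspace_lborel \<xi> = distr (\<Pi>\<^sub>M b\<in>B. (lborel :: real measure)) borel (\<lambda>c. \<Sum>b\<in>B. c b *\<^sub>R b)"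
    by (rule subspace_lborel_orthonormal[OF \<xi>]) (rule that)
  have m[measurable]: "(\<lambda>c. \<Sum>b\<in>B. c b *\<^sub>R b) \<in> (\<Pi>\<^sub>M b\<in>B. (lborel :: real measure)) \<rightarrow>\<^sub>M borel"
    by (intro borel_measurable_sum borel_measurable_scaleR borel_measurable_const)
       (auto intro!: measurable_component_singleton[where M="\<lambda>_. lborel", simplified])
  show "sets (subspace_lborel \<xi>) = sets borel" by (simp add: L)
  have [measurable]: "\<xi> \<in> sets borel" using closed_subspace[OF \<xi>] by simp
  have "(\<Sum>b\<in>B. c b *\<^sub>R b) \<in> \<xi>" for c
    unfolding B(3)[symmetric] by (intro span_sum span_scale span_base)
  then show "AE x in subspace_lborel \<xi>. x \<in> \<xi>" unfolding L
    by (subst AE_distr_iff) auto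
  show "emeasure (subspace_lborel \<xi>) (cball 0 r) = ennreal (unit_ball_vol (real (dim \<xi>)) * r ^ dim \<xi>)" if r: "r > 0" for r
  proof -
    have n: "norm (\<Sum>b\<in>B. c b *\<^sub>R b) = sqrt (\<Sum>b\<in>B. (c b)\<^sup>2)" for c
    proof -
      have "(norm (\<Sum>b\<in>B. c b *\<^sub>R b))\<^sup>2 = (\<Sum>b\<in>B. (norm (c b *\<^sub>R b))\<^sup>2)"
        using B(4) by (intro norm_sum_Pythagorean B(1)) (auto simp: pairwise_def orthogonal_def)
      also have "\<dots> = (\<Sum>b\<in>B. (c b)\<^sup>2)" using B(5) by (intro sum.cong) auto
      finally show ?thesis by (metis norm_ge_zero real_sqrt_unique)
    qed
    have "emeasure (subspace_lborel \<xi>) (cball 0 r) =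
      emeasure (\<Pi>\<^sub>M b\<in>B. (lborel :: real measure)) ({f. sqrt (\<Sum>b\<in>B. (f b)\<^sup>2) \<le> r} \<inter> space (\<Pi>\<^sub>M b\<in>B. (lborel :: real measure)))"
      unfolding L by (subst emeasure_distr) (auto simp: vimage_def n intro!: arg_cong2[where f=emeasure])
    also have "\<dots> = ennreal (unit_ball_vol (real (card B)) * r ^ card B)" by (rule emeasure_cball_aux[OF B(1) r])
    finally show ?thesis by (simp add: B(2))
  qed
  show "distr (subspace_lborel \<xi>) borel (\<lambda>x. x + v) = subspace_lborel \<xi>" if v: "v \<in> \<xi>" for v
  proof -
    have ve: "(\<Sum>b\<in>B. (v \<bullet> b) *\<^sub>R b) = v" using B v by (intro orthonormal_basis_expand) auto
    have m2: "(\<lambda>c. \<lambda>b\<in>B. c b + v \<bullet> b) \<in> (\<Pi>\<^sub>M b\<in>B. (lborel :: real measure)) \<rightarrow>\<^sub>M (\<Pi>\<^sub>M b\<in>B. (lborel :: real measure))"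
      by (intro measurable_restrict) (auto intro!: borel_measurable_add measurable_component_singleton[where M="\<lambda>_. lborel", simplified])
    have "distr (subspace_lborel \<xi>) borel (\<lambda>x. x + v) = distr (\<Pi>\<^sub>M b\<in>B. (lborel :: real measure)) borel (\<lambda>c. (\<Sum>b\<in>B. c b *\<^sub>R b) + v)"
      unfolding L by (subst distr_distr) (auto simp: o_def)
    also have "(\<lambda>c. (\<Sum>b\<in>B. c b *\<^sub>R b) + v) = (\<lambda>c. \<Sum>b\<in>B. c b *\<^sub>R b) \<circ> (\<lambda>c. \<lambda>b\<in>B. c b + v \<bullet> b)"
      using ve by (auto simp: fun_eq_iff scaleR_add_left sum.distrib)
    also have "distr (\<Pi>\<^sub>M b\<in>B. (lborel :: real measure)) borel \<dots> =
        distr (distr (\<Pi>\<^sub>M b\<in>B. (lborel :: real measure)) (\<Pi>\<^sub>M b\<in>B. lborel) (\<lambda>c. \<lambda>b\<in>B. c b + v \<bullet> b)) borel (\<lambda>c. \<Sum>b\<in>B. c b *\<^sub>R b)"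
      by (rule distr_distr[OF m m2, symmetric])
    finally show ?thesis using PiM_lborel_translation[OF B(1), of "\<lambda>b. v \<bullet> b"] by (simp add: L)
  qed
qed

lemma slab_conj:
  assumes g: "orthogonal_transformation g"
  shows "emeasure lborel (slab (conj_by g T) (cball 0 r)) = emeasure lborel (slab T (cball 0 r))"
proof -
  have [measurable]: "g \<in> borel_measurable borel"
    using orthogonal_transformation_bounded_linear[OF g]
    by (intro borel_measurable_continuous_onI linear_continuous_on)
  have [measurable]: "slab (conj_by g T) (cball 0 r) \<in> sets borel" by measurable
  have "emeasure lborel (slab (conj_by g T) (cball 0 r)) = emeasure (distr lborel borel g) (slab (conj_by g T) (cball 0 r))"
    by (simp add: lborel_orthogonal[OF g])
  also have "\<dots> = emeasure lborel (g -` slab (conj_by g T) (cball 0 r))"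
    by (subst emeasure_distr) auto
  also have "g -` slab (conj_by g T) (cball 0 r) = slab T (cball 0 r)"
  proof -
    have "norm (g x - g (T x)) = norm (x - T x)" for x using orth_norm[OF g, of "x - T x"] by (simp add: orth_linear[OF g])
    then show ?thesis by (auto simp: slab_def conj_by_apply[OF g] inv_orth[OF g] orth_norm[OF g])
  qed
  finally show ?thesis .
qed

lemma slab_cball_pos: "is_proj k T \<Longrightarrow> emeasure lborel (slab T (cball 0 1)) > 0"
proof -
  assume T: "is_proj k T"
  have "ball 0 1 \<subseteq> slab T (cball 0 1)"
  proof
    fix x :: 'a assume x: "x \<in> ball 0 1"
    have "(x - T x) \<bullet> T x = 0" using is_projD[OF T] by (simp add: inner_diff_left)
    then have "(norm x)\<^sup>2 = (norm (x - T x))\<^sup>2 + (norm (T x))\<^sup>2"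
      using norm_add_Pythagorean[of "x - T x" "T x"] by (simp add: orthogonal_def)
    then have "(norm (x - T x))\<^sup>2 \<le> (norm x)\<^sup>2" "(norm (T x))\<^sup>2 \<le> (norm x)\<^sup>2" by auto
    then have "norm (x - T x) \<le> norm x" "norm (T x) \<le> norm x" by auto
    then show "x \<in> slab T (cball 0 1)" using x by (auto simp: slab_def)
  qed
  then have "emeasure lborel (ball (0::'a) 1) \<le> emeasure lborel (slab T (cball 0 1))"
    by (intro emeasure_mono) auto
  moreover have "0 < emeasure lborel (ball (0::'a) 1)" by (simp add: emeasure_ball)
  ultimately show ?thesis by (rule less_le_trans[rotated])
qed

text \<open>Both measures are invariant under translations in the range of \<open>T\<close>, hence
  proportional; the unit ball gives the factor.\<close>

lemma subspace_lborel_slab: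
  assumes T: "is_proj k T" and A: "A \<in> sets borel"
  shows "emeasure (subspace_lborel (range (blinfun_apply T))) A * emeasure lborel (slab T (cball 0 1)) =
     ennreal (unit_ball_vol (real k)) * emeasure lborel (slab T A)"
proof -
  let ?\<xi> = "range (blinfun_apply T)"
  note S = subspace_lborel_invariant[OF subspace_range_blinfun[of T]]
  note I = slab_measure_invariant[OF T]
  have d: "dim ?\<xi> = k" using T by (simp add: is_proj_iff_dim)
  have sf: "sigma_finite_measure (subspace_lborel ?\<xi>)"
    by (rule sigma_finite_if_finite_cballs) (simp_all add: S(1,4))
  have "emeasure (subspace_lborel ?\<xi>) A * emeasure (slab_measure T) (cball 0 1) =
     emeasure (subspace_lborel ?\<xi>) (cball 0 1) * emeasure (slab_measure T) A"
    by (rule translation_invariant_measures_proportional[OF S(1) _ sf I(1) S(2) I(2) S(3) I(3) I(4) _ A])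
       (auto intro: subspace_neg[OF subspace_range_blinfun])
  then show ?thesis using A by (simp add: emeasure_slab_measure S(4) d)
qed

text \<open>Only the section is dilated while the thickness of the tube stays 1, hence the exponent
  \<open>k\<close> instead of the dimension of the space. The dilated measure is again translation
  invariant, so it suffices to compare balls, whose section volume is known.\<close>

lemma emeasure_slab_scale:
  assumes T: "is_proj k T" and A: "A \<in> sets borel" and r: "r > 0"
  shows "emeasure lborel (slab T {x. x /\<^sub>R r \<in> A}) = ennreal (r ^ k) * emeasure lborel (slab T A)"
proof -
  note [measurable] = A
  note I = slab_measure_invariant[OF T]
  define N where "N = distr (slab_measure T) borel (\<lambda>x. x /\<^sub>R r)"
  have sN: "sets N = sets borel" by (simp add: N_def)
  have N: "emeasure N C = emeasure lborel (slab T {x. x /\<^sub>R r \<in> C})" if [measurable]: "C \<in> sets borel" for C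
  proof -
    have "emeasure N C = emeasure (slab_measure T) {x. x /\<^sub>R r \<in> C}"
      unfolding N_def by (subst emeasure_distr) (auto simp: vimage_def sets_eq_imp_space_eq[OF sets_slab_measure])
    then show ?thesis by (subst (asm) emeasure_slab_measure) auto
  qed
  have ball: "{x. x /\<^sub>R r \<in> cball 0 s} = cball (0::'a) (r * s)" for s
    using r by (auto simp: field_simps)
  have sf: "sigma_finite_measure N"
    by (rule sigma_finite_if_finite_cballs) (simp_all only: sN N ball emeasure_slab_cball_finite borel_closed closed_cball)
  have closed: "range (blinfun_apply T) \<in> sets borel" using closed_subspace[OF subspace_range_blinfun[of T]] by simp
  have aN: "AE x in N. x \<in> range (blinfun_apply T)"
    unfolding N_def using I(2) closed subspace_range_blinfun[of T]
    by (subst AE_distr_iff) (auto elim!: eventually_mono intro!: subspace_scale)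
  have tN: "distr N borel (\<lambda>x. x + v) = N" if v: "v \<in> range (blinfun_apply T)" for v
  proof -
    have "distr N borel (\<lambda>x. x + v) = distr (slab_measure T) borel (\<lambda>x. x /\<^sub>R r + v)"
      unfolding N_def by (subst distr_distr) (auto simp: o_def)
    also have "(\<lambda>x. x /\<^sub>R r + v) = (\<lambda>x. (x + r *\<^sub>R v) /\<^sub>R r)" using r by (simp add: scaleR_add_right)
    also have "distr (slab_measure T) borel \<dots> = distr (distr (slab_measure T) borel (\<lambda>x. x + r *\<^sub>R v)) borel (\<lambda>x. x /\<^sub>R r)"
      by (subst distr_distr) (auto simp: o_def)
    finally show ?thesis using I(3)[of "r *\<^sub>R v"] subspace_scale[OF subspace_range_blinfun v] by (simp add: N_def)
  qed
  have p: "emeasure N A * emeasure (slab_measure T) (cball 0 1) = emeasure N (cball 0 1) * emeasure (slab_measure T) A"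
    by (rule translation_invariant_measures_proportional[OF sN _ sf I(1) aN I(2) tN I(3) I(4) _ A])
       (auto intro: subspace_neg[OF subspace_range_blinfun])
  have d: "dim (range (blinfun_apply T)) = k" using T by (simp add: is_proj_iff_dim)
  have w: "unit_ball_vol (real k) > 0" by simp
  have "ennreal (unit_ball_vol (real k)) * emeasure lborel (slab T (cball 0 r)) =
     ennreal (unit_ball_vol (real k) * r ^ k) * emeasure lborel (slab T (cball 0 1))"
    using subspace_lborel_slab[OF T, of "cball 0 r"] subspace_lborel_invariant(4)[OF subspace_range_blinfun[of T] r] by (simp add: d)
  then have "ennreal (unit_ball_vol (real k)) * emeasure lborel (slab T (cball 0 r)) =
     ennreal (unit_ball_vol (real k)) * (ennreal (r ^ k) * emeasure lborel (slab T (cball 0 1)))"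
    using r by (simp add: ennreal_mult mult.assoc)
  then have b: "emeasure lborel (slab T (cball 0 r)) = ennreal (r ^ k) * emeasure lborel (slab T (cball 0 1))"
    using w by (simp add: ennreal_mult_cancel_left)
  have s: "emeasure lborel (slab T (cball 0 1)) \<noteq> 0" "emeasure lborel (slab T (cball 0 1)) \<noteq> top"
    using slab_cball_pos[OF T] emeasure_slab_cball_finite[of T 1] by auto
  have "emeasure lborel (slab T {x. x /\<^sub>R r \<in> A}) * emeasure lborel (slab T (cball 0 1)) =
     (ennreal (r ^ k) * emeasure lborel (slab T A)) * emeasure lborel (slab T (cball 0 1))"
    using p b ball[of 1] by (simp add: N emeasure_slab_measure mult_ac)
  then show ?thesis using s by (metis ennreal_mult_cancel_left mult.commute)
qed

section \<open>Random flags\<close>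

lemma AE_lborel_hyperplane:
  fixes a :: "'a::euclidean_space"
  assumes "a \<noteq> 0" shows "AE x in lborel. x \<bullet> a \<noteq> b"
proof -
  have "{x. x \<bullet> a = b} = {x. a \<bullet> x = b}" by (simp add: inner_commute)
  then have "{x. x \<bullet> a = b} \<in> null_sets lebesgue"
    using negligible_hyperplane[of a b] assms by (simp add: negligible_iff_null_sets)
  moreover have "{x. x \<bullet> a = b} \<in> sets borel" by measurable
  ultimately have "{x. x \<bullet> a = b} \<in> null_sets lborel" by (simp add: null_sets_def)
  from AE_not_in[OF this] show ?thesis by simp
qed

text \<open>Rotation invariant, with \<open>sgn\<close> giving a uniform direction, and absolutely
  continuous, so that Lebesgue null sets can be discarded directly.\<close>

definition unif_ball :: "'a::euclidean_space measure" where
  "unif_ball = uniform_measure lborel (cball 0 1)"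

lemma emeasure_unit_cball:
  "emeasure lborel (cball (0::'a::euclidean_space) 1) = ennreal (unit_ball_vol (real DIM('a)))"
  using emeasure_cball[of 1 "0::'a"] by simp

lemma emeasure_unit_cball_nz:
  "emeasure lborel (cball (0::'a::euclidean_space) 1) \<noteq> 0" "emeasure lborel (cball (0::'a::euclidean_space) 1) \<noteq> top"
proof -
  have "unit_ball_vol (real DIM('a)) > 0" by simp
  then show "emeasure lborel (cball (0::'a::euclidean_space) 1) \<noteq> 0" "emeasure lborel (cball (0::'a::euclidean_space) 1) \<noteq> top"
    unfolding emeasure_unit_cball by (simp_all only: ennreal_eq_0_iff not_le ennreal_neq_top) simp
qed

lemma sets_unif_ball [simp, measurable_cong]: "sets unif_ball = sets borel"
  by (simp add: unif_ball_def)

lemma space_unif_ball [simp]: "space unif_ball = UNIV"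
  by (simp add: unif_ball_def)

lemma prob_space_unif_ball: "prob_space unif_ball"
  unfolding unif_ball_def using emeasure_unit_cball_nz by (intro prob_space_uniform_measure) auto

lemma nn_integral_unif_ball:
  fixes f :: "'a::euclidean_space \<Rightarrow> ennreal"
  assumes "f \<in> borel_measurable borel"
  shows "(\<integral>\<^sup>+x. f x \<partial>unif_ball) = (\<integral>\<^sup>+x. f x * indicator (cball 0 1) x \<partial>lborel) / emeasure lborel (cball (0::'a) 1)"
  unfolding unif_ball_def using assms by (intro nn_integral_uniform_measure) auto

lemma AE_unif_ball: "AE x in lborel. P x \<Longrightarrow> AE x in unif_ball. P x"
  unfolding unif_ball_def by (rule AE_uniform_measureI) auto

lemma measurable_orthogonal:
  fixes g :: "'a::euclidean_space \<Rightarrow> 'a"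
  assumes "orthogonal_transformation g" shows "g \<in> borel_measurable borel"
  using orthogonal_transformation_bounded_linear[OF assms]
  by (intro borel_measurable_continuous_onI linear_continuous_on)

lemma unif_ball_orthogonal:
  fixes g :: "'a::euclidean_space \<Rightarrow> 'a"
  assumes g: "orthogonal_transformation g" shows "distr unif_ball borel g = unif_ball"
proof (rule measure_eqI)
  note [measurable] = measurable_orthogonal[OF g]
  fix A assume "A \<in> sets (distr unif_ball borel g)"
  then have A[measurable]: "A \<in> sets borel" by simp
  have "emeasure (distr unif_ball borel g) A = emeasure unif_ball (g -` A)"
    by (subst emeasure_distr) auto
  also have "g -` A \<in> sets borel" using measurable_sets[OF measurable_orthogonal[OF g] A] by simp
  then have "emeasure unif_ball (g -` A) = emeasure lborel (cball 0 1 \<inter> (g -` A)) / emeasure lborel (cball (0::'a) 1)"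
    unfolding unif_ball_def by (intro emeasure_uniform_measure) auto
  also have "cball 0 1 \<inter> g -` A = g -` (cball 0 1 \<inter> A)" by (auto simp: orth_norm[OF g])
  also have "emeasure lborel \<dots> = emeasure (distr lborel borel g) (cball 0 1 \<inter> A)"
    by (subst emeasure_distr) auto
  also have "\<dots> = emeasure lborel (cball 0 1 \<inter> A)" by (simp add: lborel_orthogonal[OF g])
  also have "\<dots> / emeasure lborel (cball (0::'a) 1) = emeasure unif_ball A"
    unfolding unif_ball_def by (intro emeasure_uniform_measure[symmetric]) auto
  finally show "emeasure (distr unif_ball borel g) A = emeasure unif_ball A" .
qed simp

section \<open>Flags: a unit vector in a subspace, the subspace given by its projection\<close>

type_synonym 'a flag = "'a \<times> ('a \<Rightarrow>\<^sub>L 'a)"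

definition flag :: "nat \<Rightarrow> 'a::euclidean_space flag \<Rightarrow> bool" where
  "flag k z \<longleftrightarrow> norm (fst z) = 1 \<and> is_proj k (snd z) \<and> snd z (fst z) = fst z"

definition flag_act :: "('a::euclidean_space \<Rightarrow> 'a) \<Rightarrow> 'a flag \<Rightarrow> 'a flag" where
  "flag_act g z = (g (fst z), conj_by g (snd z))"

definition flag_step :: "'a::euclidean_space flag \<times> 'a \<Rightarrow> 'a flag" where
  "flag_step zx = (fst (fst zx), proj_add (snd (fst zx)) (snd zx))"

text \<open>Adjoining \<open>k\<close> independent random vectors to the subspace of a random flag.\<close>

primrec flag_chain :: "'a::euclidean_space flag measure \<Rightarrow> nat \<Rightarrow> 'a flag measure" where
  "flag_chain M 0 = M"
| "flag_chain M (Suc k) = distr (flag_chain M k \<Otimes>\<^sub>M unif_ball) borel flag_step"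

lemma measurable_fst_borel [measurable (raw)]:
  fixes f :: "'m \<Rightarrow> 'a::second_countable_topology \<times> 'b::second_countable_topology"
  assumes "f \<in> borel_measurable M" shows "(\<lambda>x. fst (f x)) \<in> borel_measurable M"
  using measurable_compose[OF assms, of fst borel] by (simp add: borel_prod[symmetric])

lemma measurable_snd_borel [measurable (raw)]:
  fixes f :: "'m \<Rightarrow> 'a::second_countable_topology \<times> 'b::second_countable_topology"
  assumes "f \<in> borel_measurable M" shows "(\<lambda>x. snd (f x)) \<in> borel_measurable M"
  using measurable_compose[OF assms, of snd borel] by (simp add: borel_prod[symmetric])

lemma closed_flag: "closed {z. flag k (z :: 'a::euclidean_space flag)}"
  unfolding flag_def is_proj_def
  by (intro closed_Collect_conj closed_Collect_all closed_Collect_eq continuous_intros)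

lemma measurable_flag [measurable]: "Measurable.pred borel (flag k)"
  using borel_closed[OF closed_flag[of k]] by (simp add: pred_def)

lemma measurable_flag_act [measurable]:
  assumes "orthogonal_transformation g" shows "flag_act g \<in> borel_measurable borel"
proof -
  note [measurable] = measurable_orthogonal[OF assms]
  show ?thesis unfolding flag_act_def[abs_def] by measurable
qed

lemma measurable_flag_step [measurable]: "flag_step \<in> borel_measurable borel"
  unfolding flag_step_def[abs_def] by measurable

lemma measurable_flag_step' [measurable]: "flag_step \<in> (borel \<Otimes>\<^sub>M borel) \<rightarrow>\<^sub>M borel"
  using measurable_flag_step by (simp add: borel_prod)

lemma flag_act_step:
  "orthogonal_transformation g \<Longrightarrow> flag_act g (flag_step (z, x)) = flag_step (flag_act g z, g x)"
  by (simp add: flag_act_def flag_step_def conj_by_proj_add)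

lemma dist_flag_act: "orthogonal_transformation g \<Longrightarrow> dist (flag_act g z) (flag_act g z') = dist z z'"
proof -
  assume g: "orthogonal_transformation g"
  have "dist (g x) (g y) = dist x y" for x y
    using orth_norm[OF g, of "x - y"] by (simp add: dist_norm orth_linear[OF g])
  then show ?thesis by (simp add: dist_prod_def flag_act_def dist_conj_by[OF g])
qed

lemma flag_flag_act: "orthogonal_transformation g \<Longrightarrow> flag k z \<Longrightarrow> flag k (flag_act g z)"
  by (simp add: flag_def flag_act_def is_proj_conj_by orth_norm conj_by_apply inv_orth)

lemma flag_act_transitive:
  assumes "flag k z" "flag k z'"
  shows "\<exists>g. orthogonal_transformation g \<and> flag_act g z = z'"
proof -
  obtain g where "orthogonal_transformation g" "g (fst z) = fst z'" "conj_by g (snd z) = snd z'"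
    using assms flag_transitive[of k "snd z" "fst z" "snd z'" "fst z'"] unfolding flag_def by blast
  then show ?thesis by (intro exI[of _ g]) (auto simp: flag_act_def)
qed

lemma AE_proj_ne:
  fixes T :: "'a::euclidean_space \<Rightarrow>\<^sub>L 'a"
  assumes T: "is_proj k T" and k: "k < DIM('a)"
  shows "AE x in unif_ball. T x \<noteq> x"
proof -
  have "negligible (range (blinfun_apply T))"
    using T k by (intro negligible_lowdim) (simp add: is_proj_iff_dim)
  then have "range (blinfun_apply T) \<in> null_sets lborel"
    using closed_subspace[OF subspace_range_blinfun[of T]]
    by (simp add: negligible_iff_null_sets null_sets_def)
  then have "AE x in lborel. x \<notin> range (blinfun_apply T)" by (rule AE_not_in)
  then show ?thesis by (intro AE_unif_ball) (simp add: proj_range_iff[OF T])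
qed

section \<open>Chains of random flags\<close>

locale flag_law =
  fixes M :: "'a::euclidean_space flag measure"
  assumes sets_M: "sets M = sets borel" and prob_M: "prob_space M"
begin

lemma sets_chain: "sets (flag_chain M k) = sets borel"
  by (cases k) (auto simp: sets_M)

lemma space_chain: "space (flag_chain M k) = UNIV"
  using sets_eq_imp_space_eq[OF sets_chain] by simp

lemma measurable_chain: "measurable (flag_chain M k) N = measurable borel N"
  using sets_chain by (rule measurable_cong_sets) simp

lemma sets_chain_pair: "sets (flag_chain M k \<Otimes>\<^sub>M unif_ball) = sets (borel \<Otimes>\<^sub>M borel)"
  by (intro sets_pair_measure_cong sets_chain sets_unif_ball)

lemma measurable_chain_pair: "measurable (flag_chain M k \<Otimes>\<^sub>M unif_ball) N = measurable (borel \<Otimes>\<^sub>M borel) N"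
  using sets_chain_pair by (rule measurable_cong_sets) simp

lemma prob_chain: "prob_space (flag_chain M k)"
proof (induction k)
  case (Suc k)
  interpret A: prob_space "flag_chain M k" by fact
  interpret B: prob_space "unif_ball :: 'a measure" by (rule prob_space_unif_ball)
  interpret P: pair_prob_space "flag_chain M k" "unif_ball :: 'a measure" ..
  show ?case by (simp, intro P.prob_space_distr) (simp add: measurable_chain_pair)
qed (simp add: prob_M)

text \<open>\<open>flag_step\<close> commutes with the simultaneous action on the flag and on the
  new vector, and the law of the new vector is rotation invariant.\<close>

lemma chain_invariant:
  assumes g: "orthogonal_transformation g" and "distr M borel (flag_act g) = M"
  shows "distr (flag_chain M k) borel (flag_act g) = flag_chain M k"
proof (induction k)
  case (Suc k)
  note [measurable] = measurable_orthogonal[OF g] measurable_flag_act[OF g]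
  let ?C = "flag_chain M k" and ?U = "unif_ball :: 'a measure"
  have "distr (flag_chain M (Suc k)) borel (flag_act g) = distr (?C \<Otimes>\<^sub>M ?U) borel (flag_act g \<circ> flag_step)"
    by (simp, subst distr_distr) (simp_all add: measurable_chain_pair)
  also have "flag_act g \<circ> flag_step = flag_step \<circ> (\<lambda>(z, x). (flag_act g z, g x))"
    using flag_act_step[OF g] by (auto simp: fun_eq_iff)
  also have "distr (?C \<Otimes>\<^sub>M ?U) borel \<dots> =
    distr (distr (?C \<Otimes>\<^sub>M ?U) (borel \<Otimes>\<^sub>M borel) (\<lambda>(z, x). (flag_act g z, g x))) borel flag_step"
    by (subst distr_distr) (simp_all add: measurable_chain_pair)
  also have "distr (?C \<Otimes>\<^sub>M ?U) (borel \<Otimes>\<^sub>M borel) (\<lambda>(z, x). (flag_act g z, g x)) =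
     distr ?C borel (flag_act g) \<Otimes>\<^sub>M distr ?U borel g"
  proof (rule pair_measure_distr[symmetric])
    show "sigma_finite_measure (distr ?U borel g)"
      unfolding unif_ball_orthogonal[OF g]
      using prob_space_unif_ball prob_space_imp_sigma_finite by blast
  qed (simp_all add: measurable_chain)
  also have "\<dots> = ?C \<Otimes>\<^sub>M ?U" by (simp add: Suc unif_ball_orthogonal[OF g])
  finally show ?case by simp
qed (use assms in simp)

lemma AE_chain_Suc:
  assumes Q: "{z. Q z} \<in> sets borel"
    and ae: "AE z in flag_chain M k. AE x in unif_ball. Q (flag_step (z, x))"
  shows "AE z in flag_chain M (Suc k). Q z"
proof -
  interpret A: prob_space "flag_chain M k" by (rule prob_chain)
  interpret B: prob_space "unif_ball :: 'a measure" by (rule prob_space_unif_ball)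
  interpret P: pair_prob_space "flag_chain M k" "unif_ball :: 'a measure" ..
  have "AE zx in flag_chain M k \<Otimes>\<^sub>M unif_ball. Q (flag_step zx)"
  proof (rule P.AE_pair_measure[OF _ ae])
    have "{zx. Q (flag_step zx)} \<in> sets (borel \<Otimes>\<^sub>M borel)"
      using measurable_sets[OF measurable_flag_step' Q] by (simp add: vimage_def space_pair_measure)
    then show "{zx \<in> space (flag_chain M k \<Otimes>\<^sub>M unif_ball). Q (flag_step zx)} \<in> sets (flag_chain M k \<Otimes>\<^sub>M unif_ball)"
      unfolding sets_chain_pair by (simp add: space_pair_measure space_chain)
  qed
  then show ?thesis unfolding flag_chain.simps
    by (subst AE_distr_iff) (use Q in \<open>simp_all add: measurable_chain_pair\<close>)
qed

text \<open>A fresh random vector almost surely lies outside the current subspace as long as that is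
  proper, so each step raises the dimension by exactly one.\<close>

lemma AE_chain_flag:
  assumes "AE z in M. flag j z" "j + k \<le> DIM('a)"
  shows "AE z in flag_chain M k. flag (j + k) z"
  using assms(2)
proof (induction k)
  case (Suc k)
  show ?case
  proof (rule AE_chain_Suc)
    show "{z :: 'a flag. flag (j + Suc k) z} \<in> sets borel" by (rule borel_closed[OF closed_flag])
    have "AE z in flag_chain M k. flag (j + k) z" using Suc by simp
    then show "AE z in flag_chain M k. AE x in unif_ball. flag (j + Suc k) (flag_step (z, x))"
    proof eventually_elim
      case (elim z)
      have "AE x in unif_ball. snd z x \<noteq> x"
        using elim Suc.prems by (intro AE_proj_ne[of "j + k"]) (auto simp: flag_def)
      then show ?case
      proof eventually_elim
        case (elim x)
        then have "is_proj (Suc (j + k)) (proj_add (snd z) x)"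
          using \<open>flag (j + k) z\<close> by (intro is_proj_proj_add) (auto simp: flag_def)
        moreover have "proj_add (snd z) x (fst z) = fst z"
        proof -
          have "fst z \<bullet> (x - snd z x) = 0"
            using \<open>flag (j + k) z\<close> is_projD(2)[of "j + k" "snd z" "fst z" x] by (simp add: flag_def inner_diff_right)
          then show ?thesis using \<open>flag (j + k) z\<close> by (simp add: proj_add_apply rank1_apply flag_def)
        qed
        ultimately show ?case using \<open>flag (j + k) z\<close> by (simp add: flag_def flag_step_def)
      qed
    qed
  qed
qed (use assms in \<open>simp only: flag_chain.simps add_0_right\<close>)

lemma AE_chain_fst:
  assumes "AE z in M. fst z = u"
  shows "AE z in flag_chain M k. fst z = u"
proof (induction k)
  case (Suc k)
  show ?case
  proof (rule AE_chain_Suc)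
    show "{z :: 'a flag. fst z = u} \<in> sets borel" by measurable
    show "AE z in flag_chain M k. AE x in unif_ball. fst (flag_step (z, x)) = u"
      using Suc by eventually_elim (simp add: flag_step_def)
  qed
qed (use assms in \<open>simp only: flag_chain.simps\<close>)

end

lemma flag_law_return: "flag_law (return borel z)"
proof (rule flag_law.intro)
  show "prob_space (return borel z)" by (rule prob_space_return) simp
qed simp

text \<open>The chain is a Markov kernel in its starting flag. With \<open>nn_integral_chain\<close>
  this lets a random start be integrated out last, which produces the iterated integral in
  \<open>flag_haar_props\<close>.\<close>

lemma measurable_flag_chain_return:
  assumes "H \<in> borel_measurable borel"
  shows "(\<lambda>z :: 'a::euclidean_space flag. \<integral>\<^sup>+y. H y \<partial>flag_chain (return borel z) k) \<in> borel_measurable borel"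
  using assms
proof (induction k arbitrary: H)
  case 0
  then have "(\<lambda>z. \<integral>\<^sup>+y. H y \<partial>return borel z) = H" by (simp add: fun_eq_iff nn_integral_return)
  then show ?case using 0 by simp
next
  case (Suc k)
  note [measurable] = Suc.prems
  interpret B: prob_space "unif_ball :: 'a measure" by (rule prob_space_unif_ball)
  have K: "(\<lambda>z. \<integral>\<^sup>+x. H (flag_step (z, x)) \<partial>unif_ball) \<in> borel_measurable borel"
    by (rule B.borel_measurable_nn_integral) measurable
  have "(\<integral>\<^sup>+y. H y \<partial>flag_chain (return borel z) (Suc k)) =
     (\<integral>\<^sup>+y. \<integral>\<^sup>+x. H (flag_step (y, x)) \<partial>unif_ball \<partial>flag_chain (return borel z) k)" for z
  proof -
    interpret flag_law "return borel z" by (rule flag_law_return)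
    show ?thesis
      by (simp, subst nn_integral_distr)
         (simp_all add: measurable_chain_pair B.nn_integral_fst[symmetric])
  qed
  then show ?case using Suc.IH[OF K] by simp
qed

lemma (in flag_law) nn_integral_chain_Suc:
  assumes [measurable]: "H \<in> borel_measurable borel"
  shows "(\<integral>\<^sup>+y. H y \<partial>flag_chain M (Suc k)) = (\<integral>\<^sup>+y. \<integral>\<^sup>+x. H (flag_step (y, x)) \<partial>unif_ball \<partial>flag_chain M k)"
proof -
  interpret B: prob_space "unif_ball :: 'a measure" by (rule prob_space_unif_ball)
  show ?thesis
    by (simp, subst nn_integral_distr)
       (simp_all add: measurable_chain_pair B.nn_integral_fst[symmetric])
qed

lemma (in flag_law) nn_integral_chain:
  assumes "H \<in> borel_measurable borel"
  shows "(\<integral>\<^sup>+y. H y \<partial>flag_chain M k) = (\<integral>\<^sup>+z. \<integral>\<^sup>+y. H y \<partial>flag_chain (return borel z) k \<partial>M)"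
  using assms
proof (induction k arbitrary: H)
  case 0
  then show ?case by (simp add: nn_integral_return)
next
  case (Suc k)
  note [measurable] = Suc.prems
  interpret B: prob_space "unif_ball :: 'a measure" by (rule prob_space_unif_ball)
  have K: "(\<lambda>z. \<integral>\<^sup>+x. H (flag_step (z, x)) \<partial>unif_ball) \<in> borel_measurable borel"
    by (rule B.borel_measurable_nn_integral) measurable
  show ?case
    unfolding nn_integral_chain_Suc[OF Suc.prems] flag_law.nn_integral_chain_Suc[OF flag_law_return Suc.prems]
    by (rule Suc.IH[OF K])
qed

lemma flag_measures_eqI:
  fixes M N :: "'a::euclidean_space flag measure"
  assumes "sets M = sets borel" "sets N = sets borel" "prob_space M" "prob_space N"
    and "AE z in M. flag k z" "AE z in N. flag k z"
    and "\<And>g. orthogonal_transformation g \<Longrightarrow> distr M borel (flag_act g) = M"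
    and "\<And>g. orthogonal_transformation g \<Longrightarrow> distr N borel (flag_act g) = N"
  shows "M = N"
proof (rule measure_eqI_isometry_invariant[where S="{z. flag k z}"])
  fix z z' :: "'a flag" assume "z \<in> {z. flag k z}" "z' \<in> {z. flag k z}"
  then obtain g where "orthogonal_transformation g" "flag_act g z = z'"
    using flag_act_transitive by blast
  then show "\<exists>h. h \<in> borel_measurable borel \<and> (\<forall>a b. dist (h a) (h b) = dist a b) \<and>
      distr M borel h = M \<and> distr N borel h = N \<and> h z = z'"
    using assms(7,8) by (intro exI[of _ "flag_act g"]) (simp add: measurable_flag_act dist_flag_act)
qed (use assms in auto)

text \<open>An orthogonal map carrying one flag with first vector \<open>u\<close> to another one
  fixes \<open>u\<close> automatically, so the stabiliser of \<open>u\<close> already acts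
  transitively on these flags.\<close>

lemma flag_measures_fixed_eqI:
  fixes M N :: "'a::euclidean_space flag measure"
  assumes "sets M = sets borel" "sets N = sets borel" "prob_space M" "prob_space N"
    and "AE z in M. flag k z \<and> fst z = u" "AE z in N. flag k z \<and> fst z = u"
    and "\<And>g. orthogonal_transformation g \<Longrightarrow> g u = u \<Longrightarrow> distr M borel (flag_act g) = M"
    and "\<And>g. orthogonal_transformation g \<Longrightarrow> g u = u \<Longrightarrow> distr N borel (flag_act g) = N"
  shows "M = N"
proof (rule measure_eqI_isometry_invariant[where S="{z. flag k z \<and> fst z = u}"])
  fix z z' :: "'a flag" assume z: "z \<in> {z. flag k z \<and> fst z = u}" "z' \<in> {z. flag k z \<and> fst z = u}"
  then obtain g where g: "orthogonal_transformation g" "flag_act g z = z'"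
    using flag_act_transitive by blast
  then have "g u = u" using z by (auto simp: flag_act_def)
  then show "\<exists>h. h \<in> borel_measurable borel \<and> (\<forall>a b. dist (h a) (h b) = dist a b) \<and>
      distr M borel h = M \<and> distr N borel h = N \<and> h z = z'"
    using g assms(7,8) by (intro exI[of _ "flag_act g"]) (simp add: measurable_flag_act dist_flag_act)
qed (use assms in auto)

section \<open>Haar measure on the Grassmannian of a hyperplane\<close>

text \<open>The uniform law of subspaces containing \<open>u\<close>. The line of \<open>u\<close>
  is there from the start, so the subspaces have dimension \<open>k + 1\<close>.\<close>

definition flags_at :: "'a::euclidean_space \<Rightarrow> nat \<Rightarrow> 'a flag measure" where
  "flags_at u k = flag_chain (return borel (u, rank1 u)) k"

lemma rank1_unit: "norm u = 1 \<Longrightarrow> rank1 u x = (x \<bullet> u) *\<^sub>R u"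
  by (simp add: rank1_apply dot_square_norm)

lemma flag_rank1: "norm u = 1 \<Longrightarrow> flag 1 (u, rank1 u)"
  using is_proj_rank1[of u] by (auto simp: flag_def rank1_apply)

lemma flags_at_props:
  fixes u :: "'a::euclidean_space"
  assumes u: "norm u = 1" and k: "Suc k \<le> DIM('a)"
  shows "sets (flags_at u k) = sets borel" "prob_space (flags_at u k)"
    "AE z in flags_at u k. flag (Suc k) z \<and> fst z = u"
    "\<And>g. orthogonal_transformation g \<Longrightarrow> g u = u \<Longrightarrow> distr (flags_at u k) borel (flag_act g) = flags_at u k"
proof -
  interpret flag_law "return borel (u, rank1 u)" by (rule flag_law_return)
  show "sets (flags_at u k) = sets borel" unfolding flags_at_def by (rule sets_chain)
  show "prob_space (flags_at u k)" unfolding flags_at_def by (rule prob_chain)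
  have "AE z in return borel (u, rank1 u). flag 1 z"
    by (subst AE_return) (simp_all add: flag_rank1[OF u, unfolded One_nat_def])
  then have a: "AE z in flags_at u k. flag (Suc k) z" unfolding flags_at_def
    using AE_chain_flag[of 1 k] k by simp
  have "AE z in return borel (u, rank1 u). fst z = u"
    by (subst AE_return) simp_all
  then have b: "AE z in flags_at u k. fst z = u" unfolding flags_at_def by (rule AE_chain_fst)
  show "AE z in flags_at u k. flag (Suc k) z \<and> fst z = u" using a b by eventually_elim simp
  show "distr (flags_at u k) borel (flag_act g) = flags_at u k" if g: "orthogonal_transformation g" "g u = u" for g
  proof -
    have "distr (return borel (u, rank1 u)) borel (flag_act g) = return borel (flag_act g (u, rank1 u))"
      by (rule distr_return) (simp_all add: measurable_flag_act g)
    also have "flag_act g (u, rank1 u) = (u, rank1 u)" using g by (simp add: flag_act_def conj_by_rank1)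
    finally show ?thesis unfolding flags_at_def by (rule chain_invariant[OF g(1)])
  qed
qed

text \<open>Projections onto orthogonal subspaces add up; this turns the subspaces
  \<open>span (insert u \<zeta>)\<close> of \<open>dual_radon\<close> into flags over
  \<open>u\<close>.\<close>

lemma flag_add_rank1:
  assumes u: "norm u = 1" and \<zeta>: "\<zeta> \<in> grassmannian ({u}\<^sup>\<bottom>) k"
  shows "flag (Suc k) (u, rank1 u + proj_onto \<zeta>)" "range (blinfun_apply (rank1 u + proj_onto \<zeta>)) = span (insert u \<zeta>)"
proof -
  have s: "subspace \<zeta>" "dim \<zeta> = k" and o: "\<And>x. x \<in> \<zeta> \<Longrightarrow> u \<bullet> x = 0"
    using \<zeta> by (auto simp: grassmannian_def orthogonal_comp_def orthogonal_def)
  have u0: "u \<noteq> 0" "u \<bullet> u = 1" using u by (auto simp: dot_square_norm)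
  have P: "is_proj k (proj_onto \<zeta>)" "range (blinfun_apply (proj_onto \<zeta>)) = \<zeta>"
    using proj_onto_subspace[OF s(1)] s(2) by auto
  note P1 = is_projD[OF P(1)]
  have Pu0: "u \<bullet> proj_onto \<zeta> x = 0" for x using o P(2) by blast
  then have "proj_onto \<zeta> u \<bullet> proj_onto \<zeta> u = 0" using P1 by metis
  then have Pu: "proj_onto \<zeta> u = 0" by simp
  have Pu1: "proj_onto \<zeta> x \<bullet> u = 0" for x using Pu0 by (simp add: inner_commute)
  define T where "T = rank1 u + proj_onto \<zeta>"
  have Ta: "T x = (x \<bullet> u) *\<^sub>R u + proj_onto \<zeta> x" for x by (simp add: T_def plus_blinfun.rep_eq rank1_unit u)
  have tr: "(\<Sum>b\<in>Basis. T b \<bullet> b) = real (Suc k)"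
  proof -
    have "(\<Sum>b\<in>Basis. T b \<bullet> b) = (\<Sum>b\<in>Basis. rank1 u b \<bullet> b) + (\<Sum>b\<in>Basis. proj_onto \<zeta> b \<bullet> b)"
      by (simp add: T_def plus_blinfun.rep_eq inner_add_left sum.distrib)
    then show ?thesis using trace_rank1[OF u0(1)] is_proj_trace[OF P(1)] by simp
  qed
  have idem: "T (T x) = T x" for x
    by (simp add: Ta inner_add_left u0 Pu1 blinfun.add_right blinfun.scaleR_right Pu P1)
  have adj: "T x \<bullet> y = x \<bullet> T y" for x y
    by (simp add: Ta inner_add_left inner_add_right P1 inner_commute[of u y])
  have "is_proj (Suc k) T" unfolding is_proj_def using idem adj tr by blast
  moreover have Tu: "T u = u" by (simp add: Ta u0 Pu)
  ultimately show "flag (Suc k) (u, rank1 u + proj_onto \<zeta>)" using u by (simp add: flag_def T_def[symmetric])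
  have "T x = x" if "x \<in> \<zeta>" for x
  proof -
    have "proj_onto \<zeta> x = x" using that proj_range_iff[OF P(1)] P(2) by blast
    then show ?thesis using o[OF that] by (simp add: Ta inner_commute)
  qed
  then have "insert u \<zeta> \<subseteq> range (blinfun_apply T)" using Tu by (metis insert_subset rangeI subsetI)
  then have "span (insert u \<zeta>) \<subseteq> range (blinfun_apply T)" by (rule span_minimal[OF _ subspace_range_blinfun])
  moreover have "range (blinfun_apply T) \<subseteq> span (insert u \<zeta>)"
  proof safe
    fix x
    have "proj_onto \<zeta> x \<in> span (insert u \<zeta>)" by (rule span_base) (use P(2) in auto)
    then show "T x \<in> span (insert u \<zeta>)" unfolding Ta by (intro span_add span_scale) (auto intro: span_base)
  qed
  ultimately show "range (blinfun_apply (rank1 u + proj_onto \<zeta>)) = span (insert u \<zeta>)"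
    unfolding T_def by blast
qed

lemma conj_by_proj_onto:
  assumes g: "orthogonal_transformation g" and \<zeta>: "subspace \<zeta>"
  shows "conj_by g (proj_onto \<zeta>) = proj_onto (g ` \<zeta>)"
proof -
  note P = proj_onto_subspace[OF \<zeta>]
  have "range (blinfun_apply (conj_by g (proj_onto \<zeta>))) = g ` \<zeta>"
  proof safe
    fix x show "conj_by g (proj_onto \<zeta>) x \<in> g ` \<zeta>" using P(2) by (auto simp: conj_by_apply[OF g])
  next
    fix x assume "x \<in> \<zeta>"
    then have "proj_onto \<zeta> x = x" using P proj_range_iff[OF P(1)] by blast
    then show "g x \<in> range (blinfun_apply (conj_by g (proj_onto \<zeta>)))"
      using rangeI[of "blinfun_apply (conj_by g (proj_onto \<zeta>))" "g x"] by (simp add: conj_by_apply[OF g] inv_orth[OF g])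
  qed
  then show ?thesis using proj_onto_range[OF is_proj_conj_by[OF g P(1)]] by simp
qed

section \<open>Borel structure of the Grassmannian and the orthogonal action on it\<close>

lemma space_grassmannian_borel: "space (grassmannian_borel V k) = grassmannian V k"
  by (simp add: grassmannian_borel_def)

lemma measurable_proj_onto: "proj_onto \<in> grassmannian_borel V k \<rightarrow>\<^sub>M borel"
  unfolding grassmannian_borel_def proj_onto_def[abs_def, symmetric]
  by (rule measurable_vimage_algebra1) simp

lemma measurable_grassmannianI:
  assumes "\<And>x. x \<in> space N \<Longrightarrow> f x \<in> grassmannian V k" "(\<lambda>x. proj_onto (f x)) \<in> N \<rightarrow>\<^sub>M borel"
  shows "f \<in> N \<rightarrow>\<^sub>M grassmannian_borel V k"
  unfolding grassmannian_borel_def proj_onto_def[abs_def, symmetric]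
  by (rule measurable_vimage_algebra2) (use assms in auto)

lemma sets_grassmannian_borel:
  "sets (grassmannian_borel V k) = {proj_onto -` A \<inter> grassmannian V k | A. A \<in> sets borel}"
  unfolding grassmannian_borel_def proj_onto_def[abs_def, symmetric]
  by (rule sets_vimage_algebra2) simp

lemma image_orthogonal_comp:
  fixes u :: "'a::euclidean_space"
  assumes g: "orthogonal_transformation g" and u: "g u = u"
  shows "g ` ({u}\<^sup>\<bottom>) = {u}\<^sup>\<bottom>"
proof -
  have e: "u \<bullet> g x = u \<bullet> x" for x using g u by (metis orthogonal_transformation_def)
  show ?thesis
  proof safe
    fix x assume "x \<in> {u}\<^sup>\<bottom>" then show "g x \<in> {u}\<^sup>\<bottom>" by (simp add: orthogonal_comp_def orthogonal_def e)
  next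
    fix x assume x: "x \<in> {u}\<^sup>\<bottom>"
    have "inv g x \<in> {u}\<^sup>\<bottom>" using x e[of "inv g x"] by (simp add: orthogonal_comp_def orthogonal_def inv_orth[OF g])
    then show "x \<in> g ` ({u}\<^sup>\<bottom>)" by (metis image_eqI inv_orth(2)[OF g])
  qed
qed

lemma grassmannian_image:
  assumes g: "orthogonal_transformation g" "g ` V = V" and \<zeta>: "\<zeta> \<in> grassmannian V k"
  shows "g ` \<zeta> \<in> grassmannian V k"
proof -
  have "subspace (g ` \<zeta>)" using \<zeta> orthogonal_transformation_linear[OF g(1)]
    by (auto simp: grassmannian_def intro: linear_subspace_image)
  moreover have "dim (g ` \<zeta>) = dim \<zeta>"
    using orthogonal_transformation_linear[OF g(1)] inj_orth[OF g(1)]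
    by (intro dim_image_eq) (auto intro: inj_on_subset)
  ultimately show ?thesis using \<zeta> g(2) by (auto simp: grassmannian_def)
qed

lemma measurable_grassmannian_image:
  assumes g: "orthogonal_transformation g" "g ` V = V"
  shows "(\<lambda>\<zeta>. g ` \<zeta>) \<in> grassmannian_borel V k \<rightarrow>\<^sub>M grassmannian_borel V k"
proof (rule measurable_grassmannianI)
  show "g ` \<zeta> \<in> grassmannian V k" if "\<zeta> \<in> space (grassmannian_borel V k)" for \<zeta>
    using grassmannian_image[OF g] that by (simp add: space_grassmannian_borel)
  have "(\<lambda>\<zeta>. conj_by g (proj_onto \<zeta>)) \<in> grassmannian_borel V k \<rightarrow>\<^sub>M borel"
    using measurable_compose[OF measurable_proj_onto borel_measurable_conj_by] .
  then show "(\<lambda>\<zeta>. proj_onto (g ` \<zeta>)) \<in> grassmannian_borel V k \<rightarrow>\<^sub>M borel"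
    by (rule measurable_cong[THEN iffD1, rotated])
       (auto simp: space_grassmannian_borel grassmannian_def conj_by_proj_onto[OF g(1)])
qed

text \<open>Passing from \<open>\<zeta>\<close> to its flag over \<open>u\<close> is equivariant for
  orthogonal maps fixing \<open>u\<close>, so any Haar measure becomes an invariant law on flags
  over \<open>u\<close>, of which there is only one. This makes the definite description in
  \<open>grassmannian_haar\<close> computable.\<close>

lemma haar_image_flags_at:
  fixes u :: "'a::euclidean_space"
  assumes u: "norm u = 1" and k: "Suc k \<le> DIM('a)" and \<nu>: "is_grassmannian_haar ({u}\<^sup>\<bottom>) k \<nu>"
  shows "(\<lambda>\<zeta>. (u, rank1 u + proj_onto \<zeta>)) \<in> \<nu> \<rightarrow>\<^sub>M borel"
    "distr \<nu> borel (\<lambda>\<zeta>. (u, rank1 u + proj_onto \<zeta>)) = flags_at u k"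
proof -
  let ?G = "grassmannian_borel ({u}\<^sup>\<bottom>) k" and ?j = "\<lambda>\<zeta>. (u, rank1 u + proj_onto \<zeta>)"
  have s: "sets \<nu> = sets ?G" and p: "prob_space \<nu>"
    and inv: "\<And>g. orthogonal_transformation g \<Longrightarrow> g ` ({u}\<^sup>\<bottom>) = {u}\<^sup>\<bottom> \<Longrightarrow> distr \<nu> \<nu> (\<lambda>\<xi>. g ` \<xi>) = \<nu>"
    using \<nu> by (auto simp: is_grassmannian_haar_def)
  interpret prob_space \<nu> by fact
  have sp: "space \<nu> = grassmannian ({u}\<^sup>\<bottom>) k" using sets_eq_imp_space_eq[OF s] by (simp add: space_grassmannian_borel)
  have mp: "proj_onto \<in> \<nu> \<rightarrow>\<^sub>M borel" using measurable_proj_onto s by (simp cong: measurable_cong_sets)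
  have "(\<lambda>\<zeta>. rank1 u + proj_onto \<zeta>) \<in> \<nu> \<rightarrow>\<^sub>M borel" using mp by measurable
  then show j: "?j \<in> \<nu> \<rightarrow>\<^sub>M borel"
    unfolding borel_prod[symmetric] by (intro measurable_Pair measurable_const) auto
  note F = flags_at_props[OF u k]
  show "distr \<nu> borel ?j = flags_at u k"
  proof (rule flag_measures_fixed_eqI[where k="Suc k" and u=u])
    show "prob_space (distr \<nu> borel ?j)" by (rule prob_space_distr[OF j])
    show "AE z in distr \<nu> borel ?j. flag (Suc k) z \<and> fst z = u"
    proof (subst AE_distr_iff[OF j])
      have "{z :: 'a flag. flag (Suc k) z \<and> fst z = u} \<in> sets borel" by measurable
      then show "{z \<in> space borel. flag (Suc k) z \<and> fst (z :: 'a flag) = u} \<in> sets borel" by simp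
      show "AE \<zeta> in \<nu>. flag (Suc k) (?j \<zeta>) \<and> fst (?j \<zeta>) = u"
        by (rule AE_I2) (use flag_add_rank1(1)[OF u] sp in auto)
    qed
    fix g :: "'a \<Rightarrow> 'a" assume g: "orthogonal_transformation g" "g u = u"
    have gV: "g ` ({u}\<^sup>\<bottom>) = {u}\<^sup>\<bottom>" by (rule image_orthogonal_comp[OF g])
    have mg: "(\<lambda>\<zeta>. g ` \<zeta>) \<in> \<nu> \<rightarrow>\<^sub>M \<nu>" using measurable_grassmannian_image[OF g(1) gV] s by (simp cong: measurable_cong_sets)
    have "distr (distr \<nu> borel ?j) borel (flag_act g) = distr \<nu> borel (\<lambda>\<zeta>. flag_act g (?j \<zeta>))"
      by (subst distr_distr[OF measurable_flag_act[OF g(1)] j]) (simp add: o_def)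
    also have "\<dots> = distr \<nu> borel (\<lambda>\<zeta>. ?j (g ` \<zeta>))"
      by (rule distr_cong) (auto simp: sp flag_act_def g conj_by_add[OF g(1)] conj_by_rank1[OF g(1)]
           conj_by_proj_onto[OF g(1)] grassmannian_def)
    also have "\<dots> = distr (distr \<nu> \<nu> (\<lambda>\<zeta>. g ` \<zeta>)) borel ?j"
      by (subst distr_distr[OF j mg]) (simp add: o_def)
    finally show "distr (distr \<nu> borel ?j) borel (flag_act g) = distr \<nu> borel ?j" using inv[OF g(1) gV] by simp
  qed (use F in auto)
qed

text \<open>Subtracting \<open>rank1 u\<close> recovers \<open>proj_onto \<zeta>\<close> from the
  flag, and Borel sets of the Grassmannian are preimages under \<open>proj_onto\<close>, so nothing
  is lost in passing to flags.\<close>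

lemma haar_unique:
  fixes u :: "'a::euclidean_space"
  assumes u: "norm u = 1" and k: "Suc k \<le> DIM('a)" and \<nu>: "is_grassmannian_haar ({u}\<^sup>\<bottom>) k \<nu>"
    and \<nu>': "is_grassmannian_haar ({u}\<^sup>\<bottom>) k \<nu>'"
  shows "\<nu> = \<nu>'"
proof (rule measure_eqI)
  show s: "sets \<nu> = sets \<nu>'" using \<nu> \<nu>' by (simp add: is_grassmannian_haar_def)
  fix A assume "A \<in> sets \<nu>"
  then obtain B where B[measurable]: "B \<in> sets borel" and A: "A = proj_onto -` B \<inter> grassmannian ({u}\<^sup>\<bottom>) k"
    using \<nu> by (auto simp: is_grassmannian_haar_def sets_grassmannian_borel)
  have C: "{z :: 'a flag. snd z - rank1 u \<in> B} \<in> sets borel" by measurable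
  have e: "emeasure L A = emeasure (flags_at u k) {z. snd z - rank1 u \<in> B}" if L: "is_grassmannian_haar ({u}\<^sup>\<bottom>) k L" for L
  proof -
    have "space L = grassmannian ({u}\<^sup>\<bottom>) k"
      using L sets_eq_imp_space_eq[of L "grassmannian_borel ({u}\<^sup>\<bottom>) k"] by (simp add: is_grassmannian_haar_def space_grassmannian_borel)
    then show ?thesis
      unfolding haar_image_flags_at(2)[OF u k L, symmetric]
      by (subst emeasure_distr[OF haar_image_flags_at(1)[OF u k L] C]) (auto simp: A intro!: arg_cong2[where f=emeasure])
  qed
  show "emeasure \<nu> A = emeasure \<nu>' A" using e[OF \<nu>] e[OF \<nu>'] by simp
qed

text \<open>\<open>is_grassmannian_haar\<close> tests every orthogonal map preserving the
  hyperplane, while \<open>flags_at_props\<close> treats maps fixing \<open>u\<close>; the gap is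
  just a sign.\<close>

lemma orthogonal_fixing_comp:
  fixes u :: "'a::euclidean_space"
  assumes u: "norm u = 1" and g: "orthogonal_transformation g" "g ` ({u}\<^sup>\<bottom>) = {u}\<^sup>\<bottom>"
  shows "g u = u \<or> g u = - u"
proof -
  define w where "w = g u"
  define x where "x = w - (w \<bullet> u) *\<^sub>R u"
  have uu: "u \<bullet> u = 1" using u by (simp add: dot_square_norm)
  have xu: "x \<bullet> u = 0" by (simp add: x_def inner_diff_left uu)
  then have "x \<in> {u}\<^sup>\<bottom>" by (simp add: orthogonal_comp_def orthogonal_def inner_commute)
  then obtain y where y: "y \<in> {u}\<^sup>\<bottom>" "x = g y" using g(2) by (metis imageE)
  have "w \<bullet> x = u \<bullet> y" using g(1) y by (simp add: w_def orthogonal_transformation_def)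
  then have "w \<bullet> x = 0" using y(1) by (simp add: orthogonal_comp_def orthogonal_def)
  moreover have "x \<bullet> x = w \<bullet> x - (w \<bullet> u) * (u \<bullet> x)" by (subst (1) x_def) (simp add: inner_diff_left)
  ultimately have "x \<bullet> x = 0" using xu by (simp add: inner_commute)
  then have w: "w = (w \<bullet> u) *\<^sub>R u" by (simp add: x_def)
  have "norm w = 1" using orth_norm[OF g(1)] u by (simp add: w_def)
  then have "\<bar>w \<bullet> u\<bar> = 1" using arg_cong[OF w, of norm] u by simp
  then have "w \<bullet> u = 1 \<or> w \<bullet> u = - 1" by linarith
  then show ?thesis using w by (metis scaleR_one scaleR_minus_left w_def)
qed

lemma haar_exists:
  fixes u :: "'a::euclidean_space"
  assumes u: "norm u = 1" and k: "Suc k \<le> DIM('a)"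
  shows "\<exists>\<nu>. is_grassmannian_haar ({u}\<^sup>\<bottom>) k \<nu>"
proof -
  let ?V = "{u}\<^sup>\<bottom>"
  let ?G = "grassmannian_borel ?V k" and ?C = "flags_at u k"
  note F = flags_at_props[OF u k]
  interpret C: prob_space ?C by (rule F(2))
  define f where "f z = range (blinfun_apply (snd z - rank1 u))" for z :: "'a flag"
  have uu: "u \<bullet> u = 1" using u by (simp add: dot_square_norm)
  have fG: "f z \<in> grassmannian ?V k" and pf: "proj_onto (f z) = snd z - rank1 u"
    if z: "flag (Suc k) z \<and> fst z = u" for z
  proof -
    have z': "is_proj (Suc k) (snd z)" "snd z u = u" using z by (auto simp: flag_def)
    have P: "is_proj k (snd z - rank1 u)" using is_proj_diff_rank1(1)[OF z' u] by simp
    then show "proj_onto (f z) = snd z - rank1 u" unfolding f_def by (rule proj_onto_range)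
    have "u \<bullet> (snd z - rank1 u) x = 0" for x
      using is_projD(2)[OF z'(1), of u x] z'(2)
      by (simp add: minus_blinfun.rep_eq rank1_unit[OF u] inner_diff_right uu inner_commute[of x u])
    then show "f z \<in> grassmannian ?V k"
      using P unfolding f_def by (auto simp: grassmannian_def is_proj_iff_dim subspace_range_blinfun orthogonal_comp_def orthogonal_def)
  qed
  have "\<exists>z. flag (Suc k) z \<and> fst z = u"
  proof (rule ccontr)
    assume "\<not> ?thesis"
    then have "\<not> (flag (Suc k) z \<and> fst z = u)" for z by blast
    with F(3) have "AE z in ?C. False" by simp
    then show False using C.AE_False by simp
  qed
  then obtain z0 where z0: "flag (Suc k) z0 \<and> fst z0 = u" by blast
  \<comment> \<open>Only flags over \<open>u\<close>, which have full measure, are sure to be sent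
    into the Grassmannian by \<open>f\<close>; the constant value \<open>f z0\<close> elsewhere
    makes the map total.\<close>
  define h where "h z = (if flag (Suc k) z \<and> fst z = u then f z else f z0)" for z :: "'a flag"
  have hG: "h z \<in> grassmannian ?V k" for z using fG z0 by (auto simp: h_def)
  have ph: "(\<lambda>z. proj_onto (h z)) = (\<lambda>z. if flag (Suc k) z \<and> fst z = u then snd z - rank1 u else snd z0 - rank1 u)"
    by (auto simp: h_def fun_eq_iff pf z0)
  have "h \<in> borel \<rightarrow>\<^sub>M ?G"
    by (rule measurable_grassmannianI[OF hG]) (unfold ph, measurable)
  then have mh: "h \<in> ?C \<rightarrow>\<^sub>M ?G" using F(1) by (simp cong: measurable_cong_sets)
  define \<nu> where "\<nu> = distr ?C ?G h"
  have s: "sets \<nu> = sets ?G" by (simp add: \<nu>_def)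
  have "distr \<nu> \<nu> (\<lambda>\<xi>. g ` \<xi>) = \<nu>" if g0: "orthogonal_transformation g" "g ` ?V = ?V" for g
  proof -
    \<comment> \<open>If \<open>g\<close> sends \<open>u\<close> to \<open>- u\<close>, then
      \<open>- g\<close> fixes \<open>u\<close> and acts on subspaces in the same way.\<close>
    define g' where "g' = (if g u = u then g else (\<lambda>x. - g x))"
    have g': "orthogonal_transformation g'" "g' u = u"
      using g0 orthogonal_fixing_comp[OF u g0] by (auto simp: g'_def orthogonal_transformation_neg)
    have im: "g ` \<zeta> = g' ` \<zeta>" if "subspace \<zeta>" for \<zeta>
    proof -
      have "(\<lambda>x. - g x) ` \<zeta> = g ` \<zeta>"
      proof safe
        fix x assume "x \<in> \<zeta>"
        then have "- x \<in> \<zeta>" using that subspace_neg by blast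
        moreover have "g (- x) = - g x" using orthogonal_transformation_linear[OF g0(1)] linear_neg by blast
        ultimately show "- g x \<in> g ` \<zeta>" "g x \<in> (\<lambda>x. - g x) ` \<zeta>" by (metis image_eqI) (metis (mono_tags) \<open>- x \<in> \<zeta>\<close> \<open>g (- x) = - g x\<close> image_eqI minus_minus)
      qed
      then show ?thesis by (auto simp: g'_def)
    qed
    have mg: "(\<lambda>\<zeta>. g ` \<zeta>) \<in> ?G \<rightarrow>\<^sub>M ?G" by (rule measurable_grassmannian_image[OF g0])
    have "distr \<nu> \<nu> (\<lambda>\<xi>. g ` \<xi>) = distr \<nu> ?G (\<lambda>\<xi>. g ` \<xi>)" by (rule distr_cong) (auto simp: s)
    also have "\<dots> = distr ?C ?G (\<lambda>z. g ` h z)"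
      unfolding \<nu>_def by (subst distr_distr[OF mg mh]) (simp add: o_def)
    also have "\<dots> = distr ?C ?G (\<lambda>z. h (flag_act g' z))"
    proof (rule distr_cong_AE)
      show "AE z in ?C. g ` h z = h (flag_act g' z)"
        using F(3)
      proof eventually_elim
        case (elim z)
        have z2: "flag (Suc k) (flag_act g' z) \<and> fst (flag_act g' z) = u"
        proof (rule conjI)
          show "flag (Suc k) (flag_act g' z)" using elim by (intro flag_flag_act[OF g'(1)]) simp
          show "fst (flag_act g' z) = u" using elim g'(2) by (simp add: flag_act_def)
        qed
        have sub: "subspace (h z)" using hG[of z] by (simp add: grassmannian_def)
        have "proj_onto (g ` h z) = conj_by g' (snd z - rank1 u)"
        proof -
          have "proj_onto (h z) = snd z - rank1 u" using elim by (simp add: h_def pf)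
          then show ?thesis using conj_by_proj_onto[OF g'(1) sub] im[OF sub] by simp
        qed
        also have "\<dots> = proj_onto (h (flag_act g' z))"
          using z2 by (simp add: h_def pf conj_by_diff[OF g'(1)] conj_by_rank1[OF g'(1)] g'(2)) (simp add: flag_act_def)
        finally have e: "proj_onto (g ` h z) = proj_onto (h (flag_act g' z))" .
        have "subspace (g ` h z)" "subspace (h (flag_act g' z))"
          using grassmannian_image[OF g0 hG[of z]] hG[of "flag_act g' z"] by (simp_all add: grassmannian_def)
        then show ?case using proj_onto_subspace(2) e by metis
      qed
      show "(\<lambda>z. g ` h z) \<in> ?C \<rightarrow>\<^sub>M ?G" by (rule measurable_compose[OF mh mg])
      have "flag_act g' \<in> ?C \<rightarrow>\<^sub>M ?C" using measurable_flag_act[OF g'(1)] F(1) by (simp cong: measurable_cong_sets)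
      then show "(\<lambda>z. h (flag_act g' z)) \<in> ?C \<rightarrow>\<^sub>M ?G" by (rule measurable_compose[OF _ mh])
    qed auto
    also have "\<dots> = distr (distr ?C borel (flag_act g')) ?G h"
    proof -
      have "flag_act g' \<in> ?C \<rightarrow>\<^sub>M borel" using measurable_flag_act[OF g'(1)] F(1) by (simp cong: measurable_cong_sets)
      then show ?thesis using \<open>h \<in> borel \<rightarrow>\<^sub>M ?G\<close> by (subst distr_distr) (simp_all add: o_def)
    qed
    also have "\<dots> = \<nu>" unfolding F(4)[OF g'] \<nu>_def ..
    finally show ?thesis .
  qed
  moreover have "prob_space \<nu>" unfolding \<nu>_def by (rule C.prob_space_distr[OF mh])
  ultimately have "is_grassmannian_haar ?V k \<nu>" using s by (simp add: is_grassmannian_haar_def)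
  then show ?thesis by blast
qed

lemma is_haar_grassmannian_haar:
  fixes u :: "'a::euclidean_space"
  assumes u: "norm u = 1" and k: "Suc k \<le> DIM('a)"
  shows "is_grassmannian_haar ({u}\<^sup>\<bottom>) k (grassmannian_haar ({u}\<^sup>\<bottom>) k)"
  unfolding grassmannian_haar_def
  by (rule theI', rule ex_ex1I[OF haar_exists[OF u k]]) (rule haar_unique[OF u k])

text \<open>Replaces the Haar measure by the explicit chain. \<open>Fm\<close> represents
  \<open>F\<close> as a function of projections, where measurability can be checked.\<close>

lemma dual_radon_flags_at:
  fixes u :: "'a::euclidean_space"
  assumes u: "norm u = 1" and m: "1 \<le> m" "m \<le> DIM('a)"
    and Fm: "Fm \<in> borel_measurable borel" and F: "\<And>T. is_proj m T \<Longrightarrow> F (range (blinfun_apply T)) = Fm T"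
  shows "dual_radon m F u = (real m * unit_ball_vol (real m)) / (real DIM('a) * unit_ball_vol (real DIM('a))) *
     (\<integral>z. Fm (snd z) \<partial>flags_at u (m - 1))"
proof -
  have k: "Suc (m - 1) \<le> DIM('a)" using m by simp
  let ?\<nu> = "grassmannian_haar ({u}\<^sup>\<bottom>) (m - 1)"
  note H = is_haar_grassmannian_haar[OF u k]
  have sp: "space ?\<nu> = grassmannian ({u}\<^sup>\<bottom>) (m - 1)"
    using H sets_eq_imp_space_eq[of ?\<nu> "grassmannian_borel ({u}\<^sup>\<bottom>) (m - 1)"] by (simp add: is_grassmannian_haar_def space_grassmannian_borel)
  have "(\<integral>\<zeta>. F (span (insert u \<zeta>)) \<partial>?\<nu>) = (\<integral>\<zeta>. Fm (snd (u, rank1 u + proj_onto \<zeta>)) \<partial>?\<nu>)"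
  proof (rule Bochner_Integration.integral_cong[OF refl])
    fix \<zeta> assume "\<zeta> \<in> space ?\<nu>"
    then have z: "\<zeta> \<in> grassmannian ({u}\<^sup>\<bottom>) (m - 1)" by (simp only: sp)
    have "is_proj m (rank1 u + proj_onto \<zeta>)" using flag_add_rank1(1)[OF u z] m by (simp add: flag_def)
    from F[OF this] show "F (span (insert u \<zeta>)) = Fm (snd (u, rank1 u + proj_onto \<zeta>))"
      by (simp add: flag_add_rank1(2)[OF u z])
  qed
  also have "\<dots> = (\<integral>z. Fm (snd z) \<partial>distr ?\<nu> borel (\<lambda>\<zeta>. (u, rank1 u + proj_onto \<zeta>)))"
    by (rule integral_distr[symmetric, OF haar_image_flags_at(1)[OF u k H]]) (use Fm in measurable)
  finally show ?thesis unfolding dual_radon_def haar_image_flags_at(2)[OF u k H] by simp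
qed

section \<open>Disintegration of the flag measure\<close>

text \<open>The starting flag already has dimension 1, hence \<open>m - 1\<close> further
  vectors.\<close>

definition flag_haar :: "nat \<Rightarrow> 'a::euclidean_space flag measure" where
  "flag_haar m = flag_chain (distr unif_ball borel (\<lambda>x. (sgn x, rank1 (sgn x)))) (m - 1)"

text \<open>By rotation invariance every projection of rank \<open>m\<close> gives the same value,
  so an arbitrary one may be chosen.\<close>

definition slab_const :: "'a::euclidean_space itself \<Rightarrow> nat \<Rightarrow> ennreal" where
  "slab_const _ m = emeasure lborel (slab (SOME T :: 'a \<Rightarrow>\<^sub>L 'a. is_proj m T) (cball 0 1))"

lemma slab_const:
  fixes T :: "'a::euclidean_space \<Rightarrow>\<^sub>L 'a"
  assumes T: "is_proj m T" and m: "1 \<le> m"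
  shows "emeasure lborel (slab T (cball 0 1)) = slab_const TYPE('a) m"
proof -
  define S where "S = (SOME T :: 'a \<Rightarrow>\<^sub>L 'a. is_proj m T)"
  have S: "is_proj m S" unfolding S_def by (rule someI[of _ T]) (rule T)
  \<comment> \<open>As \<open>m \<ge> 1\<close>, the range contains a unit vector, so that
    \<open>flag_transitive\<close> applies.\<close>
  have u: "\<exists>u. norm u = 1 \<and> T u = u" if T: "is_proj m T" for T :: "'a \<Rightarrow>\<^sub>L 'a"
  proof -
    have "dim (range (blinfun_apply T)) \<noteq> 0" using T m by (simp add: is_proj_iff_dim)
    then obtain w where w: "w \<in> range (blinfun_apply T)" "w \<noteq> 0" unfolding dim_eq_0 by blast
    then have "T w = w" using proj_range_iff[OF T] by blast
    then have "T (sgn w) = sgn w" by (simp add: sgn_div_norm blinfun.scaleR_right)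
    then show ?thesis using w by (intro exI[of _ "sgn w"]) (simp add: norm_sgn)
  qed
  obtain u v where "norm u = 1" "T u = u" "norm v = 1" "S v = v" using u[OF T] u[OF S] by blast
  then obtain g where "orthogonal_transformation g" "conj_by g T = S" using flag_transitive[OF T _ _ S] by blast
  then show ?thesis using slab_conj[of g T 1] unfolding slab_const_def S_def[symmetric] by simp
qed

lemma flag_haar_props:
  assumes m: "1 \<le> m" "m \<le> DIM('a::euclidean_space)"
  shows "sets (flag_haar m :: 'a flag measure) = sets borel" "prob_space (flag_haar m :: 'a flag measure)"
    "AE z in (flag_haar m :: 'a flag measure). flag m z"
    "\<And>g. orthogonal_transformation g \<Longrightarrow> distr (flag_haar m :: 'a flag measure) borel (flag_act g) = flag_haar m"
    "\<And>H. H \<in> borel_measurable borel \<Longrightarrow>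
       (\<integral>\<^sup>+z. H z \<partial>(flag_haar m :: 'a flag measure)) = (\<integral>\<^sup>+x. (\<integral>\<^sup>+z. H z \<partial>flags_at (sgn x) (m - 1)) \<partial>unif_ball)"
proof -
  let ?s = "\<lambda>x :: 'a. (sgn x, rank1 (sgn x))"
  have ms: "?s \<in> borel \<rightarrow>\<^sub>M borel" unfolding borel_prod[symmetric] by measurable
  then have ms': "?s \<in> unif_ball \<rightarrow>\<^sub>M borel" by simp
  interpret B: prob_space "unif_ball :: 'a measure" by (rule prob_space_unif_ball)
  interpret flag_law "distr unif_ball borel ?s"
    by (rule flag_law.intro) (simp, rule B.prob_space_distr[OF ms'])
  show "sets (flag_haar m :: 'a flag measure) = sets borel" unfolding flag_haar_def by (rule sets_chain)
  show "prob_space (flag_haar m :: 'a flag measure)" unfolding flag_haar_def by (rule prob_chain)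
  have "AE x in lborel. x \<noteq> (0::'a)" by (rule AE_lborel_singleton)
  then have "AE x in unif_ball. x \<noteq> (0::'a)" by (rule AE_unif_ball)
  then have "AE x in unif_ball. flag 1 (?s x)"
    by eventually_elim (rule flag_rank1, simp add: norm_sgn)
  then have "AE z in distr unif_ball borel ?s. flag 1 z"
    by (subst AE_distr_iff[OF ms']) (simp_all add: measurable_flag[unfolded pred_def, simplified])
  then have "AE z in flag_chain (distr unif_ball borel ?s) (m - 1). flag (1 + (m - 1)) z"
    by (rule AE_chain_flag) (use m in simp)
  then show "AE z in (flag_haar m :: 'a flag measure). flag m z" unfolding flag_haar_def using m by simp
  show "distr (flag_haar m :: 'a flag measure) borel (flag_act g) = flag_haar m" if g: "orthogonal_transformation g" for g :: "'a \<Rightarrow> 'a"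
  proof -
    note mg = measurable_orthogonal[OF g]
    have "distr (distr unif_ball borel ?s) borel (flag_act g) = distr unif_ball borel (\<lambda>x. ?s (g x))"
      by (subst distr_distr[OF measurable_flag_act[OF g] ms'])
         (simp add: o_def flag_act_def conj_by_rank1[OF g] orth_sgn[OF g])
    also have "\<dots> = distr (distr unif_ball borel g) borel ?s"
      by (subst distr_distr) (use mg ms in \<open>simp_all add: o_def\<close>)
    finally show ?thesis unfolding flag_haar_def
      by (intro chain_invariant[OF g]) (simp add: unif_ball_orthogonal[OF g])
  qed
  show "(\<integral>\<^sup>+z. H z \<partial>(flag_haar m :: 'a flag measure)) = (\<integral>\<^sup>+x. (\<integral>\<^sup>+z. H z \<partial>flags_at (sgn x) (m - 1)) \<partial>unif_ball)"
    if H: "H \<in> borel_measurable borel" for H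
    unfolding flag_haar_def nn_integral_chain[OF H]
    by (subst nn_integral_distr[OF ms']) (simp_all add: measurable_flag_chain_return[OF H] flags_at_def)
qed

lemma AE_proj_nonzero:
  fixes T :: "'a::euclidean_space \<Rightarrow>\<^sub>L 'a"
  assumes "is_proj m T" "T u = u" "norm u = 1"
  shows "AE x in lborel. T x \<noteq> 0"
proof -
  have "AE x in lborel. x \<bullet> u \<noteq> 0" by (rule AE_lborel_hyperplane) (use assms in auto)
  then show ?thesis
  proof eventually_elim
    case (elim x)
    then show ?case using is_projD(2)[OF assms(1), of x u] assms(2) by auto
  qed
qed

text \<open>Choosing first a uniform direction and then a uniform subspace containing it, or first a
  uniform subspace and then a uniform direction in it, gives the same law on flags.\<close>

lemma flag_haar_disintegration:
  fixes H :: "'a::euclidean_space flag \<Rightarrow> ennreal"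
  assumes m: "1 \<le> m" "m \<le> DIM('a)" and H: "H \<in> borel_measurable borel"
  shows "(\<integral>\<^sup>+z. (\<integral>\<^sup>+x. H (sgn (blinfun_apply (snd z) x), snd z) * indicator (slab (snd z) (cball 0 1)) x \<partial>lborel) \<partial>flag_haar m) =
    slab_const TYPE('a) m * (\<integral>\<^sup>+z. H z \<partial>flag_haar m)"
proof -
  let ?F = "flag_haar m :: 'a flag measure"
  define c where "c = slab_const TYPE('a) m"
  note F = flag_haar_props[OF m]
  interpret F: prob_space ?F by (rule F(2))
  note [measurable_cong] = F(1)
  \<comment> \<open>The law with the subspace chosen first: keep the subspace of a random flag and
    take as vector the direction of \<open>T x\<close> for \<open>x\<close> uniform in its unit
    tube. Division by \<open>c\<close> makes it a probability measure.\<close>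
  define N where "N = distr (density (?F \<Otimes>\<^sub>M lborel) (\<lambda>(z, x). indicator (slab (snd z) (cball 0 1)) x / c)) borel
    (\<lambda>(z, x). (sgn (blinfun_apply (snd z) x), snd z))"
  have "(\<lambda>(z :: 'a flag, x). indicator (slab (snd z) (cball 0 1)) x :: ennreal) =
     indicator {zx :: 'a flag \<times> 'a. norm (blinfun_apply (snd (fst zx)) (snd zx)) \<le> 1 \<and> norm (snd zx - blinfun_apply (snd (fst zx)) (snd zx)) \<le> 1}"
    by (auto simp: fun_eq_iff indicator_def slab_def)
  also have "\<dots> \<in> borel_measurable (borel \<Otimes>\<^sub>M borel)"
    unfolding borel_prod by measurable
  finally have mi: "(\<lambda>(z :: 'a flag, x). indicator (slab (snd z) (cball 0 1)) x :: ennreal) \<in> borel_measurable (borel \<Otimes>\<^sub>M borel)" .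
  have cg: "measurable (?F \<Otimes>\<^sub>M lborel) = (measurable (borel \<Otimes>\<^sub>M borel) :: 'b measure \<Rightarrow> _)"
    by (intro ext measurable_cong_sets sets_pair_measure_cong F(1)) auto
  have mi': "(\<lambda>(z :: 'a flag, x). indicator (slab (snd z) (cball 0 1)) x / c :: ennreal) \<in> borel_measurable (borel \<Otimes>\<^sub>M borel)"
    using borel_measurable_divide_ennreal[OF mi borel_measurable_const[of c]] by (simp add: case_prod_beta')
  have mt: "(\<lambda>(z :: 'a flag, x). (sgn (blinfun_apply (snd z) x), snd z)) \<in> borel \<Otimes>\<^sub>M borel \<rightarrow>\<^sub>M borel"
  proof -
    have "(\<lambda>zx :: 'a flag \<times> 'a. (sgn (blinfun_apply (snd (fst zx)) (snd zx)), snd (fst zx))) \<in> borel \<rightarrow>\<^sub>M borel \<Otimes>\<^sub>M borel"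
      by measurable
    then show ?thesis by (simp add: borel_prod case_prod_beta')
  qed
  have int: "(\<integral>\<^sup>+z. K z \<partial>N) = (\<integral>\<^sup>+z. (\<integral>\<^sup>+x. K (sgn (blinfun_apply (snd z) x), snd z) * indicator (slab (snd z) (cball 0 1)) x \<partial>lborel) \<partial>?F) / c"
    and mint: "(\<lambda>z :: 'a flag. \<integral>\<^sup>+x. K (sgn (blinfun_apply (snd z) x), snd z) * indicator (slab (snd z) (cball 0 1)) x \<partial>lborel) \<in> borel_measurable borel"
    if K: "K \<in> borel_measurable borel" for K :: "'a flag \<Rightarrow> ennreal"
  proof -
    have mK: "(\<lambda>(z :: 'a flag, x). K (sgn (blinfun_apply (snd z) x), snd z)) \<in> borel_measurable (borel \<Otimes>\<^sub>M borel)"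
      using measurable_compose[OF mt K] by (simp add: case_prod_beta')
    have mKi: "(\<lambda>(z :: 'a flag, x). K (sgn (blinfun_apply (snd z) x), snd z) * indicator (slab (snd z) (cball 0 1)) x) \<in> borel_measurable (borel \<Otimes>\<^sub>M lborel)"
      using borel_measurable_times_ennreal[OF mK mi] by (simp add: case_prod_beta' cong: measurable_cong_sets)
    show mint: "(\<lambda>z :: 'a flag. \<integral>\<^sup>+x. K (sgn (blinfun_apply (snd z) x), snd z) * indicator (slab (snd z) (cball 0 1)) x \<partial>lborel) \<in> borel_measurable borel"
      using lborel.borel_measurable_nn_integral[OF mKi] by simp
    have "(\<integral>\<^sup>+z. K z \<partial>N) = (\<integral>\<^sup>+zx. (indicator (slab (snd (fst zx)) (cball 0 1)) (snd zx) / c) * K (sgn (blinfun_apply (snd (fst zx)) (snd zx)), snd (fst zx)) \<partial>(?F \<Otimes>\<^sub>M lborel))"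
      unfolding N_def
      by (subst nn_integral_distr, simp add: cg mt, simp add: K)
         (subst nn_integral_density, simp add: cg mi', use mK in \<open>simp add: cg case_prod_beta'\<close>, simp add: case_prod_beta')
    also have "\<dots> = (\<integral>\<^sup>+zx. (case zx of (z, x) \<Rightarrow> K (sgn (blinfun_apply (snd z) x), snd z) * indicator (slab (snd z) (cball 0 1)) x) / c \<partial>(?F \<Otimes>\<^sub>M lborel))"
      by (intro nn_integral_cong) (auto simp: divide_ennreal_def mult_ac)
    also have "\<dots> = (\<integral>\<^sup>+zx. (case zx of (z, x) \<Rightarrow> K (sgn (blinfun_apply (snd z) x), snd z) * indicator (slab (snd z) (cball 0 1)) x) \<partial>(?F \<Otimes>\<^sub>M lborel)) / c"
      by (rule nn_integral_divide) (use mKi in \<open>simp add: cg cong: measurable_cong_sets\<close>)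
    also have "(\<integral>\<^sup>+zx. (case zx of (z, x) \<Rightarrow> K (sgn (blinfun_apply (snd z) x), snd z) * indicator (slab (snd z) (cball 0 1)) x) \<partial>(?F \<Otimes>\<^sub>M lborel)) =
       (\<integral>\<^sup>+z. (\<integral>\<^sup>+x. K (sgn (blinfun_apply (snd z) x), snd z) * indicator (slab (snd z) (cball 0 1)) x \<partial>lborel) \<partial>?F)"
      by (subst lborel.nn_integral_fst[symmetric]) (use mKi in \<open>simp_all add: cg cong: measurable_cong_sets\<close>)
    finally show "(\<integral>\<^sup>+z. K z \<partial>N) = (\<integral>\<^sup>+z. (\<integral>\<^sup>+x. K (sgn (blinfun_apply (snd z) x), snd z) * indicator (slab (snd z) (cball 0 1)) x \<partial>lborel) \<partial>?F) / c" .
  qed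
  have cAE: "AE z in ?F. emeasure lborel (slab (snd z) (cball 0 1)) = c"
    using F(3) by eventually_elim (simp add: c_def slab_const[OF _ m(1)] flag_def)
  have "\<exists>z :: 'a flag. flag m z"
  proof (rule ccontr)
    assume "\<not> ?thesis"
    then have "\<not> flag m z" for z :: "'a flag" by blast
    with F(3) have "AE z in ?F. False" by simp
    then show False using F.AE_False by simp
  qed
  then obtain z0 :: "'a flag" where "flag m z0" by blast
  then have c: "c \<noteq> 0" "c \<noteq> top"
    using slab_const[of m "snd z0"] slab_cball_pos[of m "snd z0"] emeasure_slab_cball_finite[of "snd z0" 1] m
    by (auto simp: c_def flag_def)
  have sN: "sets N = sets borel" by (simp add: N_def)
  have spN: "space N = UNIV" by (simp add: N_def)
  have eN: "emeasure N A = (\<integral>\<^sup>+z. (\<integral>\<^sup>+x. indicator A (sgn (blinfun_apply (snd z) x), snd z) * indicator (slab (snd z) (cball 0 1)) x \<partial>lborel) \<partial>?F) / c"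
    if "A \<in> sets borel" for A
    using int[of "indicator A"] that sN by simp
  have pN: "prob_space N"
  proof
    have "emeasure N (space N) = (\<integral>\<^sup>+z. (\<integral>\<^sup>+x. indicator (slab (snd z) (cball 0 1)) x \<partial>lborel) \<partial>?F) / c"
      unfolding spN by (subst eN) simp_all
    also have "(\<integral>\<^sup>+z. (\<integral>\<^sup>+x. indicator (slab (snd z) (cball 0 1)) x \<partial>lborel) \<partial>?F) = (\<integral>\<^sup>+z. c \<partial>?F)"
      using cAE by (intro nn_integral_cong_AE) (auto elim!: eventually_mono)
    also have "\<dots> = c" by (simp add: F.emeasure_space_1)
    finally show "emeasure N (space N) = 1" using c by (simp add: ennreal_divide_self less_top)
  qed
  have "N = ?F"
  proof (rule flag_measures_eqI[where k=m])
    show "AE z in N. flag m z"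
    proof (rule AE_I')
      show "{z \<in> space N. \<not> flag m z} \<subseteq> {z. \<not> flag m z}" by auto
      have A: "{z :: 'a flag. \<not> flag m z} \<in> sets borel" by measurable
      have "(\<integral>\<^sup>+z. (\<integral>\<^sup>+x. indicator {z. \<not> flag m z} (sgn (blinfun_apply (snd z) x), snd z) * indicator (slab (snd z) (cball 0 1)) x \<partial>lborel) \<partial>?F) = (\<integral>\<^sup>+z. 0 \<partial>?F)"
      proof (rule nn_integral_cong_AE, use F(3) in eventually_elim)
        fix z :: "'a flag" assume z: "flag m z"
        then have "AE x in lborel. blinfun_apply (snd z) x \<noteq> 0" by (intro AE_proj_nonzero[of m _ "fst z"]) (auto simp: flag_def)
        then have "AE x in lborel. indicator {z. \<not> flag m z} (sgn (blinfun_apply (snd z) x), snd z) * indicator (slab (snd z) (cball 0 1)) x = (0::ennreal)"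
        proof eventually_elim
          case (elim x)
          have "blinfun_apply (snd z) (blinfun_apply (snd z) x) = blinfun_apply (snd z) x" using z by (simp add: flag_def is_projD(1)[of m])
          then have "flag m (sgn (blinfun_apply (snd z) x), snd z)" using z elim by (simp add: flag_def norm_sgn) (simp add: sgn_div_norm blinfun.scaleR_right)
          then show ?case by simp
        qed
        then show "(\<integral>\<^sup>+x. indicator {z. \<not> flag m z} (sgn (blinfun_apply (snd z) x), snd z) * indicator (slab (snd z) (cball 0 1)) x \<partial>lborel) = 0"
          by (subst nn_integral_cong_AE[where v="\<lambda>_. 0"]) auto
      qed
      then have "emeasure N {z. \<not> flag m z} = 0" using eN[OF A] by simp
      then show "{z. \<not> flag m z} \<in> null_sets N" using A sN by (simp add: null_sets_def)
    qed
    fix g :: "'a \<Rightarrow> 'a" assume g: "orthogonal_transformation g"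
    note mg = measurable_orthogonal[OF g]
    have mga: "flag_act g \<in> borel_measurable N" using measurable_flag_act[OF g] sN by (simp cong: measurable_cong_sets)
    show "distr N borel (flag_act g) = N"
    proof (rule measure_eqI)
      show "sets (distr N borel (flag_act g)) = sets N" by (simp add: sN)
      fix A assume "A \<in> sets (distr N borel (flag_act g))"
      then have A: "A \<in> sets borel" by simp
      define J where "J z = (\<integral>\<^sup>+x. indicator A (sgn (blinfun_apply (snd z) x), snd z) * indicator (slab (snd z) (cball 0 1)) x \<partial>lborel)" for z :: "'a flag"
      have mJ: "J \<in> borel_measurable borel" unfolding J_def[abs_def] using A by (intro mint) simp
      have GA: "flag_act g -` A \<in> sets borel" using measurable_sets[OF measurable_flag_act[OF g] A] by simp
      have "emeasure (distr N borel (flag_act g)) A = emeasure N (flag_act g -` A)"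
        by (subst emeasure_distr[OF mga A]) (simp add: spN)
      also have "\<dots> = (\<integral>\<^sup>+z. (\<integral>\<^sup>+x. indicator (flag_act g -` A) (sgn (blinfun_apply (snd z) x), snd z) * indicator (slab (snd z) (cball 0 1)) x \<partial>lborel) \<partial>?F) / c"
        by (rule eN[OF GA])
      also have "(\<integral>\<^sup>+z. (\<integral>\<^sup>+x. indicator (flag_act g -` A) (sgn (blinfun_apply (snd z) x), snd z) * indicator (slab (snd z) (cball 0 1)) x \<partial>lborel) \<partial>?F) = (\<integral>\<^sup>+z. J (flag_act g z) \<partial>?F)"
      proof (rule nn_integral_cong)
        fix z :: "'a flag"
        let ?T = "conj_by g (snd z)"
        define f where "f x = indicator A (sgn (?T x), ?T) * (indicator (slab ?T (cball 0 1)) x :: ennreal)" for x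
        have mf: "f \<in> borel_measurable borel"
        proof -
          have "(\<lambda>x. (sgn (?T x), ?T)) \<in> borel \<rightarrow>\<^sub>M borel \<Otimes>\<^sub>M borel" by measurable
          then have "(\<lambda>x. (sgn (?T x), ?T)) \<in> borel \<rightarrow>\<^sub>M borel" by (simp add: borel_prod)
          then have "(\<lambda>x. indicator A (sgn (?T x), ?T) :: ennreal) \<in> borel_measurable borel"
            by (rule measurable_compose) (use A in simp)
          then show ?thesis unfolding f_def by measurable
        qed
        \<comment> \<open>Rotating \<open>x\<close> carries the tube of \<open>snd z\<close> onto
          the tube of its conjugate and preserves Lebesgue measure.\<close>
        have "J (flag_act g z) = (\<integral>\<^sup>+x. f x \<partial>distr lborel borel g)"
          by (simp add: lborel_orthogonal[OF g] J_def flag_act_def f_def)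
        also have "\<dots> = (\<integral>\<^sup>+x. f (g x) \<partial>lborel)" by (rule nn_integral_distr) (use mg mf in simp_all)
        also have "\<dots> = (\<integral>\<^sup>+x. indicator (flag_act g -` A) (sgn (blinfun_apply (snd z) x), snd z) * indicator (slab (snd z) (cball 0 1)) x \<partial>lborel)"
        proof (rule nn_integral_cong)
          fix x
          have "norm (g x - g (blinfun_apply (snd z) x)) = norm (x - blinfun_apply (snd z) x)" using orth_norm[OF g, of "x - blinfun_apply (snd z) x"] by (simp add: orth_linear[OF g])
          then show "f (g x) = indicator (flag_act g -` A) (sgn (blinfun_apply (snd z) x), snd z) * indicator (slab (snd z) (cball 0 1)) x"
            unfolding f_def by (auto simp: indicator_def slab_def conj_by_apply[OF g] inv_orth[OF g] orth_norm[OF g] flag_act_def orth_sgn[OF g])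
        qed
        finally show "(\<integral>\<^sup>+x. indicator (flag_act g -` A) (sgn (blinfun_apply (snd z) x), snd z) * indicator (slab (snd z) (cball 0 1)) x \<partial>lborel) = J (flag_act g z)" by simp
      qed
      also have "\<dots> = (\<integral>\<^sup>+z. J z \<partial>distr ?F borel (flag_act g))"
        by (rule nn_integral_distr[symmetric]) (use measurable_flag_act[OF g] mJ F(1) in \<open>simp_all cong: measurable_cong_sets\<close>)
      also have "\<dots> = (\<integral>\<^sup>+z. J z \<partial>?F)" by (simp add: F(4)[OF g])
      also have "\<dots> / c = emeasure N A" unfolding J_def by (rule eN[OF A, symmetric])
      finally show "emeasure (distr N borel (flag_act g)) A = emeasure N A" .
    qed
  qed (use sN pN F in auto)
  then have "(\<integral>\<^sup>+z. H z \<partial>?F) = (\<integral>\<^sup>+z. (\<integral>\<^sup>+x. H (sgn (blinfun_apply (snd z) x), snd z) * indicator (slab (snd z) (cball 0 1)) x \<partial>lborel) \<partial>?F) / c"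
    using int[OF H] by simp
  moreover have "c * (A / c) = A" for A :: ennreal
    unfolding ennreal_times_divide using c by (subst mult.commute) (rule mult_divide_eq_ennreal)
  ultimately show ?thesis unfolding c_def[symmetric] by simp
qed

section \<open>Polar coordinates\<close>

lemma measurable_sgn_vimage:
  assumes "C \<in> sets borel" shows "{x :: 'a::euclidean_space. sgn x \<in> C} \<in> sets borel"
  using measurable_sets[OF borel_measurable_sgn assms] by (simp add: vimage_def)

context
  fixes T :: "'a::euclidean_space \<Rightarrow>\<^sub>L 'a" and k :: nat and C :: "'a set"
  assumes T: "is_proj k T" and C: "C \<in> sets borel"
begin

lemma slab_cone_measurable:
  "{x. sgn x \<in> C \<and> norm x < r} \<in> sets borel" "{x. sgn x \<in> C \<and> norm x \<le> r} \<in> sets borel"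
proof -
  have [measurable]: "{x. sgn x \<in> C} \<in> sets borel" by (rule measurable_sgn_vimage[OF C])
  have "{x. sgn x \<in> C \<and> norm x < r} = {x. sgn x \<in> C} \<inter> ball 0 r" by auto
  then show "{x. sgn x \<in> C \<and> norm x < r} \<in> sets borel" by simp
  have "{x. sgn x \<in> C \<and> norm x \<le> r} = {x. sgn x \<in> C} \<inter> cball 0 r" by auto
  then show "{x. sgn x \<in> C \<and> norm x \<le> r} \<in> sets borel" by simp
qed

lemma slab_cone_scale:
  assumes r: "r > 0"
  shows "emeasure lborel (slab T {x. sgn x \<in> C \<and> norm x < r}) = ennreal (r ^ k) * emeasure lborel (slab T {x. sgn x \<in> C \<and> norm x < 1})"
proof -
  have "sgn (x /\<^sub>R r) = sgn x" for x :: 'a using r by (simp add: sgn_scaleR)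
  moreover have "norm (x /\<^sub>R r) < 1 \<longleftrightarrow> norm x < r" for x :: 'a using r by (simp add: field_simps)
  ultimately have "{x. sgn x \<in> C \<and> norm x < r} = {x. x /\<^sub>R r \<in> {x. sgn x \<in> C \<and> norm x < 1}}" by simp
  then show ?thesis using emeasure_slab_scale[OF T slab_cone_measurable(1)[of 1] r] by simp
qed

text \<open>The unit sphere carries no mass: the closed region lies in the open one of radius
  \<open>1 + 1 / Suc n\<close>, whose mass is \<open>(1 + 1 / Suc n) ^ k\<close> times that of
  radius 1.\<close>

lemma slab_cone_closed:
  "emeasure lborel (slab T {x. sgn x \<in> C \<and> norm x \<le> 1}) = emeasure lborel (slab T {x. sgn x \<in> C \<and> norm x < 1})"
proof (rule antisym)
  let ?e = "emeasure lborel (slab T {x. sgn x \<in> C \<and> norm x < 1})"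
  show "?e \<le> emeasure lborel (slab T {x. sgn x \<in> C \<and> norm x \<le> 1})"
    by (rule emeasure_mono) (use measurable_slab[OF slab_cone_measurable(2)] in \<open>auto simp: slab_def\<close>)
  have "?e \<le> emeasure lborel (slab T (cball 0 1))"
    by (rule emeasure_mono) (use measurable_slab[of "cball 0 1" T] in \<open>auto simp: slab_def\<close>)
  then have fin: "?e < top" using emeasure_slab_cball_finite[of T 1] by (rule le_less_trans)
  have le: "emeasure lborel (slab T {x. sgn x \<in> C \<and> norm x \<le> 1}) \<le> ennreal ((1 + 1 / real (Suc n)) ^ k * enn2real ?e)" for n
  proof -
    have "emeasure lborel (slab T {x. sgn x \<in> C \<and> norm x \<le> 1}) \<le> emeasure lborel (slab T {x. sgn x \<in> C \<and> norm x < 1 + 1 / real (Suc n)})"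
    proof (rule emeasure_mono)
      have "norm y < 1 + 1 / real (Suc n)" if "norm y \<le> 1" for y :: 'a
        by (rule le_less_trans[OF that]) simp
      then show "slab T {x. sgn x \<in> C \<and> norm x \<le> 1} \<subseteq> slab T {x. sgn x \<in> C \<and> norm x < 1 + 1 / real (Suc n)}"
        unfolding slab_def by blast
      show "slab T {x. sgn x \<in> C \<and> norm x < 1 + 1 / real (Suc n)} \<in> sets lborel"
        using measurable_slab[OF slab_cone_measurable(1)] by simp
    qed
    also have "\<dots> = ennreal ((1 + 1 / real (Suc n)) ^ k) * ?e" by (rule slab_cone_scale) (simp add: add_pos_pos)
    also have "\<dots> = ennreal ((1 + 1 / real (Suc n)) ^ k * enn2real ?e)" using fin by (simp add: ennreal_mult' )
    finally show ?thesis .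
  qed
  have "(\<lambda>n. (1 + 1 / real (Suc n)) ^ k * enn2real ?e) \<longlonglongrightarrow> (1 + 0) ^ k * enn2real ?e"
    by (intro tendsto_intros lim_1_over_n[THEN LIMSEQ_Suc])
  then have "(\<lambda>n. ennreal ((1 + 1 / real (Suc n)) ^ k * enn2real ?e)) \<longlonglongrightarrow> ennreal (enn2real ?e)"
    by (intro tendsto_ennrealI) simp
  then have "emeasure lborel (slab T {x. sgn x \<in> C \<and> norm x \<le> 1}) \<le> ennreal (enn2real ?e)"
    by (rule LIMSEQ_le_const) (use le in blast)
  then show "emeasure lborel (slab T {x. sgn x \<in> C \<and> norm x \<le> 1}) \<le> ?e" using fin by simp
qed

end

lemma slab_polar_simple:
  fixes T :: "'a::euclidean_space \<Rightarrow>\<^sub>L 'a"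
  assumes T: "is_proj k T" and k: "k \<ge> 1" and C: "C \<in> sets borel"
    and a: "simple_function borel a" "\<And>x. 0 \<le> a x"
  shows "emeasure lborel (slab T {x. sgn x \<in> C \<and> norm x < a (sgn x)}) =
     (\<integral>\<^sup>+x. ennreal (a (sgn (T x)) ^ k) * indicator C (sgn (T x)) * indicator (slab T (cball 0 1)) x \<partial>lborel)"
proof -
  have fin: "finite (range a)" using simple_functionD(1)[OF a(1)] by simp
  have ma: "a -` {y} \<in> sets borel" for y using simple_functionD(2)[OF a(1), of "{y}"] by simp
  define D where "D y = C \<inter> a -` {y}" for y
  have D: "D y \<in> sets borel" for y using C ma by (simp add: D_def)
  have mS: "slab T {x. sgn x \<in> D y \<and> norm x < r} \<in> sets lborel" "slab T {x. sgn x \<in> D y \<and> norm x \<le> r} \<in> sets lborel" for y r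
    using measurable_slab[OF slab_cone_measurable(1)[OF T D]] measurable_slab[OF slab_cone_measurable(2)[OF T D]] by auto
  have e1: "indicator (slab T {x. sgn x \<in> C \<and> norm x < a (sgn x)}) x = (\<Sum>y\<in>range a. indicator (slab T {x. sgn x \<in> D y \<and> norm x < y}) x :: ennreal)" for x
  proof -
    have "(\<Sum>y\<in>range a. indicator (slab T {x. sgn x \<in> D y \<and> norm x < y}) x :: ennreal) =
      (\<Sum>y\<in>range a. if y = a (sgn (T x)) then indicator (slab T {x. sgn x \<in> C \<and> norm x < a (sgn x)}) x else 0)"
      by (rule sum.cong) (auto simp: slab_def D_def indicator_def)
    then show ?thesis using fin by simp
  qed
  have "slab T {x. sgn x \<in> C \<and> norm x < a (sgn x)} = (\<Union>y\<in>range a. slab T {x. sgn x \<in> D y \<and> norm x < y})"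
    by (auto simp: slab_def D_def)
  then have mL: "slab T {x. sgn x \<in> C \<and> norm x < a (sgn x)} \<in> sets lborel"
    using mS(1) sets.finite_UN[OF fin, of "\<lambda>y. slab T {x. sgn x \<in> D y \<and> norm x < y}" lborel] by presburger
  have "emeasure lborel (slab T {x. sgn x \<in> C \<and> norm x < a (sgn x)}) = (\<integral>\<^sup>+x. indicator (slab T {x. sgn x \<in> C \<and> norm x < a (sgn x)}) x \<partial>lborel)"
    using mL by (subst nn_integral_indicator) auto
  also have "\<dots> = (\<Sum>y\<in>range a. emeasure lborel (slab T {x. sgn x \<in> D y \<and> norm x < y}))"
    unfolding e1 using mS by (subst nn_integral_sum) auto
  also have "\<dots> = (\<Sum>y\<in>range a. ennreal (y ^ k) * emeasure lborel (slab T {x. sgn x \<in> D y \<and> norm x \<le> 1}))"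
  proof (rule sum.cong[OF refl])
    fix y assume "y \<in> range a"
    then have y: "y \<ge> 0" using a(2) by auto
    show "emeasure lborel (slab T {x. sgn x \<in> D y \<and> norm x < y}) = ennreal (y ^ k) * emeasure lborel (slab T {x. sgn x \<in> D y \<and> norm x \<le> 1})"
    proof (cases "y = 0")
      case True
      \<comment> \<open>\<open>k \<ge> 1\<close> gives \<open>0 ^ k = 0\<close>, matching the empty
        region.\<close>
      then show ?thesis using k by (simp add: slab_def power_0_left)
    next
      case False
      then show ?thesis using slab_cone_scale[OF T D, of y] slab_cone_closed[OF T D, of y] y by simp
    qed
  qed
  also have "\<dots> = (\<integral>\<^sup>+x. (\<Sum>y\<in>range a. ennreal (y ^ k) * indicator (slab T {x. sgn x \<in> D y \<and> norm x \<le> 1}) x) \<partial>lborel)"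
    using mS by (subst nn_integral_sum) (auto simp: nn_integral_cmult)
  also have "\<dots> = (\<integral>\<^sup>+x. ennreal (a (sgn (T x)) ^ k) * indicator C (sgn (T x)) * indicator (slab T (cball 0 1)) x \<partial>lborel)"
  proof (rule nn_integral_cong)
    fix x
    have "(\<Sum>y\<in>range a. ennreal (y ^ k) * indicator (slab T {x. sgn x \<in> D y \<and> norm x \<le> 1}) x) =
      (\<Sum>y\<in>range a. if y = a (sgn (T x)) then ennreal (a (sgn (T x)) ^ k) * indicator C (sgn (T x)) * indicator (slab T (cball 0 1)) x else 0)"
      by (rule sum.cong) (auto simp: slab_def D_def indicator_def)
    then show "(\<Sum>y\<in>range a. ennreal (y ^ k) * indicator (slab T {x. sgn x \<in> D y \<and> norm x \<le> 1}) x) =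
      ennreal (a (sgn (T x)) ^ k) * indicator C (sgn (T x)) * indicator (slab T (cball 0 1)) x" using fin by simp
  qed
  finally show ?thesis .
qed

text \<open>Polar coordinates in the range of \<open>T\<close>, with the direction of
  \<open>T x\<close> over the unit tube in the role of the spherical measure; since directions are
  weighted by points of the unit ball, \<open>R ^ k\<close> stands where the usual formula has
  \<open>R ^ k / k\<close>. Scaling settles step functions, monotone limits the rest.\<close>

lemma slab_polar:
  fixes T :: "'a::euclidean_space \<Rightarrow>\<^sub>L 'a"
  assumes T: "is_proj k T" and k: "k \<ge> 1" and C: "C \<in> sets borel"
    and R: "R \<in> borel_measurable borel" "\<And>x. 0 \<le> R x"
  shows "emeasure lborel (slab T {x. sgn x \<in> C \<and> norm x < R (sgn x)}) =
     (\<integral>\<^sup>+x. ennreal (R (sgn (T x)) ^ k) * indicator C (sgn (T x)) * indicator (slab T (cball 0 1)) x \<partial>lborel)"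
proof -
  obtain a where a: "incseq a" "\<And>i. simple_function borel (a i)" "\<And>x. bdd_above (range (\<lambda>i. a i x))"
      "\<And>i x. 0 \<le> a i x" "R = (SUP i. a i)"
    using borel_measurable_implies_simple_function_sequence_real[OF R] by blast
  have aR: "R x = (SUP i. a i x)" for x by (simp add: a(5) image_image)
  have inc: "incseq (\<lambda>i. a i x)" for x using a(1) by (simp add: incseq_def le_fun_def)
  have lim: "(\<lambda>i. a i x) \<longlonglongrightarrow> R x" for x unfolding aR by (rule LIMSEQ_incseq_SUP[OF a(3) inc])
  have ma: "a i \<in> borel_measurable borel" for i using a(2) by (rule borel_measurable_simple_function)
  let ?L = "\<lambda>i. slab T {x. sgn x \<in> C \<and> norm x < a i (sgn x)}"
  have mL: "?L i \<in> sets lborel" for i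
  proof -
    have "{x. norm x < a i (sgn x)} \<in> sets borel" using ma[of i] by measurable
    then have "{x. sgn x \<in> C} \<inter> {x. norm x < a i (sgn x)} \<in> sets borel" using measurable_sgn_vimage[OF C] by simp
    then have "{x. sgn x \<in> C \<and> norm x < a i (sgn x)} \<in> sets borel" by (simp add: Collect_conj_eq)
    then show ?thesis by simp
  qed
  have "(\<lambda>i. emeasure lborel (?L i)) \<longlonglongrightarrow> emeasure lborel (\<Union>i. ?L i)"
  proof (rule Lim_emeasure_incseq)
    show "incseq ?L" using inc unfolding incseq_def slab_def by (auto intro: less_le_trans)
  qed (use mL in auto)
  \<comment> \<open>The strict inequality \<open>norm x < R (sgn x)\<close> makes the region of a
    supremum the union of the regions.\<close>
  also have "(\<Union>i. ?L i) = slab T {x. sgn x \<in> C \<and> norm x < R (sgn x)}"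
    using a(3) by (auto simp: slab_def aR less_cSUP_iff)
  finally have l1: "(\<lambda>i. emeasure lborel (?L i)) \<longlonglongrightarrow> emeasure lborel (slab T {x. sgn x \<in> C \<and> norm x < R (sgn x)})" .
  let ?f = "\<lambda>i x. ennreal (a i (sgn (T x)) ^ k) * indicator C (sgn (T x)) * indicator (slab T (cball 0 1)) x"
  have "(\<lambda>i. \<integral>\<^sup>+x. ?f i x \<partial>lborel) \<longlonglongrightarrow> (\<integral>\<^sup>+x. ennreal (R (sgn (T x)) ^ k) * indicator C (sgn (T x)) * indicator (slab T (cball 0 1)) x \<partial>lborel)"
  proof (rule nn_integral_LIMSEQ)
    show "incseq ?f"
      using inc a(4) unfolding incseq_def le_fun_def
      by (auto intro!: mult_right_mono ennreal_leI power_mono)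
    show "?f i \<in> borel_measurable lborel" for i
      using C ma[of i] by measurable
    fix x
    have "(\<lambda>i. ennreal (a i (sgn (T x)) ^ k)) \<longlonglongrightarrow> ennreal (R (sgn (T x)) ^ k)"
      by (intro tendsto_intros lim)
    then show "(\<lambda>i. ?f i x) \<longlonglongrightarrow> ennreal (R (sgn (T x)) ^ k) * indicator C (sgn (T x)) * indicator (slab T (cball 0 1)) x"
      by (auto simp: indicator_def)
  qed
  then have "(\<lambda>i. emeasure lborel (?L i)) \<longlonglongrightarrow> (\<integral>\<^sup>+x. ennreal (R (sgn (T x)) ^ k) * indicator C (sgn (T x)) * indicator (slab T (cball 0 1)) x \<partial>lborel)"
    using slab_polar_simple[OF T k C a(2) a(4)] by simp
  then show ?thesis using l1 by (rule LIMSEQ_unique[rotated])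
qed

section \<open>Integration over the sphere\<close>

lemma measurable_sgn_sphere:
  "sgn \<in> restrict_space lborel (cball (0::'a::euclidean_space) 1 - {0}) \<rightarrow>\<^sub>M restrict_space borel (sphere 0 1)"
proof (rule measurable_restrict_space2)
  show "sgn \<in> space (restrict_space lborel (cball (0::'a) 1 - {0})) \<rightarrow> sphere 0 1"
    by (auto simp: space_restrict_space norm_sgn)
  show "sgn \<in> restrict_space lborel (cball (0::'a) 1 - {0}) \<rightarrow>\<^sub>M borel"
    by (rule measurable_restrict_space1) simp
qed

text \<open>The completion does not affect integrals of Borel functions, and the origin, which
  \<open>sphere_lebesgue\<close> removes from the ball, is a null set.\<close>

lemma nn_integral_sphere_lebesgue:
  fixes f :: "'a::euclidean_space \<Rightarrow> ennreal"
  assumes f: "f \<in> borel_measurable borel"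
  shows "(\<integral>\<^sup>+u. f u \<partial>sphere_lebesgue) =
     of_nat DIM('a) * ennreal (unit_ball_vol (real DIM('a))) * (\<integral>\<^sup>+x. f (sgn x) \<partial>unif_ball)"
proof -
  let ?D = "distr (restrict_space lborel (cball (0::'a) 1 - {0})) (restrict_space borel (sphere 0 1)) sgn"
  have f': "f \<in> borel_measurable (restrict_space borel (sphere 0 1))" using f by (rule measurable_restrict_space1)
  have "(\<integral>\<^sup>+u. f u \<partial>sphere_lebesgue) = of_nat DIM('a) * (\<integral>\<^sup>+u. f u \<partial>?D)"
    unfolding sphere_lebesgue_def nn_integral_completion
    by (rule nn_integral_scale_measure) (use f' in simp)
  also have "(\<integral>\<^sup>+u. f u \<partial>?D) = (\<integral>\<^sup>+x. f (sgn x) \<partial>restrict_space lborel (cball (0::'a) 1 - {0}))"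
    by (rule nn_integral_distr[OF measurable_sgn_sphere]) (use f' in simp)
  also have "\<dots> = (\<integral>\<^sup>+x. f (sgn x) * indicator (cball 0 1 - {0}) x \<partial>lborel)"
    by (rule nn_integral_restrict_space) simp
  also have "\<dots> = (\<integral>\<^sup>+x. f (sgn x) * indicator (cball 0 1) x \<partial>lborel)"
  proof (rule nn_integral_cong_AE)
    have "AE x in lborel. x \<noteq> (0::'a)" by (rule AE_lborel_singleton)
    then show "AE x in lborel. f (sgn x) * indicator (cball 0 1 - {0}) x = f (sgn x) * indicator (cball 0 1) (x::'a)"
      by eventually_elim (simp add: indicator_def)
  qed
  also have "\<dots> = ennreal (unit_ball_vol (real DIM('a))) * (\<integral>\<^sup>+x. f (sgn x) \<partial>unif_ball)"
  proof -
    have m: "(\<lambda>x. f (sgn x)) \<in> borel_measurable borel" using measurable_compose[OF borel_measurable_sgn f] .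
    have "c * (A / c) = A" if "c \<noteq> 0" "c \<noteq> top" for A c :: ennreal
      unfolding ennreal_times_divide using that by (subst mult.commute) (rule mult_divide_eq_ennreal)
    then show ?thesis
      unfolding nn_integral_unif_ball[OF m] emeasure_unit_cball[symmetric] using emeasure_unit_cball_nz by metis
  qed
  finally show ?thesis by (simp add: mult.assoc)
qed

lemma AE_sphere_lebesgue:
  fixes P :: "'a::euclidean_space \<Rightarrow> bool"
  assumes P: "{u. P u} \<in> sets borel" and ae: "AE x in lborel. P (sgn x)"
  shows "AE u in sphere_lebesgue. P u"
proof -
  have "(\<integral>\<^sup>+u. indicator (- {u. P u}) u \<partial>sphere_lebesgue) = 
     of_nat DIM('a) * ennreal (unit_ball_vol (real DIM('a))) * (\<integral>\<^sup>+x. indicator (- {u. P u}) (sgn x) \<partial>unif_ball)"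
    by (rule nn_integral_sphere_lebesgue) (use P in \<open>auto simp: Compl_eq_Diff_UNIV\<close>)
  also have "(\<integral>\<^sup>+x. indicator (- {u. P u}) (sgn x) \<partial>unif_ball) = (\<integral>\<^sup>+x. 0 \<partial>(unif_ball :: 'a measure))"
    by (rule nn_integral_cong_AE) (use AE_unif_ball[OF ae] in \<open>auto elim!: eventually_mono\<close>)
  finally have z: "(\<integral>\<^sup>+u. indicator (- {u. P u}) u \<partial>sphere_lebesgue) = 0" by simp
  have sp: "space (sphere_lebesgue :: 'a measure) = sphere 0 1"
    by (simp add: sphere_lebesgue_def space_scale_measure space_restrict_space)
  have "sphere 0 1 - {u. P u} \<in> sets (restrict_space borel (sphere 0 1))"
    using P by (simp add: sets_restrict_space_iff)
  then have s: "sphere 0 1 - {u. P u} \<in> sets sphere_lebesgue"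
    by (simp add: sphere_lebesgue_def sets_completionI_sets)
  have "emeasure sphere_lebesgue (sphere 0 1 - {u. P u}) = (\<integral>\<^sup>+u. indicator (sphere 0 1 - {u. P u}) u \<partial>sphere_lebesgue)"
    using s by simp
  also have "\<dots> = (\<integral>\<^sup>+u. indicator (- {u. P u}) u \<partial>sphere_lebesgue)"
    by (rule nn_integral_cong) (auto simp: sp indicator_def)
  finally have "sphere 0 1 - {u. P u} \<in> null_sets sphere_lebesgue" using z s by (simp add: null_sets_def)
  then show ?thesis by (rule AE_I') (auto simp: sp)
qed

section \<open>Polytopes with given facet normals\<close>

definition tube_vol :: "('a::euclidean_space \<Rightarrow>\<^sub>L 'a) \<Rightarrow> 'a set \<Rightarrow> real" where
  "tube_vol T L = measure lborel (slab T L)"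

lemma tube_vol_nonneg [simp]: "0 \<le> tube_vol T L"
  by (simp add: tube_vol_def)

lemma slab_mono: "L \<subseteq> L' \<Longrightarrow> slab T L \<subseteq> slab T L'"
  by (auto simp: slab_def)

lemma emeasure_slab_bounded:
  fixes T :: "'a::euclidean_space \<Rightarrow>\<^sub>L 'a"
  assumes "L \<subseteq> cball 0 r"
  shows "emeasure lborel (slab T L) = ennreal (tube_vol T L)" "tube_vol T L \<le> measure lborel (cball (0::'a) (r + 1))"
    "emeasure lborel (slab T L) < top"
proof -
  have "slab T L \<subseteq> slab T (cball 0 r)" by (rule slab_mono[OF assms])
  then have sub: "slab T L \<subseteq> cball 0 (r + 1)" using slab_cball_subset by blast
  then have "emeasure lborel (slab T L) \<le> emeasure lborel (cball (0::'a) (r + 1))" by (rule emeasure_mono) simp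
  also have fin: "\<dots> < top" using emeasure_lborel_cball_finite[of "0::'a" "r+1"] by simp
  finally show fin': "emeasure lborel (slab T L) < top" .
  then show "emeasure lborel (slab T L) = ennreal (tube_vol T L)"
    unfolding tube_vol_def by (intro emeasure_eq_ennreal_measure) simp
  show "tube_vol T L \<le> measure lborel (cball (0::'a) (r + 1))"
    unfolding tube_vol_def measure_def using \<open>emeasure lborel (slab T L) \<le> emeasure lborel (cball 0 (r + 1))\<close> fin
    by (rule enn2real_mono)
qed

lemma measurable_emeasure_slab:
  fixes L :: "'a::euclidean_space set"
  assumes L: "L \<in> sets borel"
  shows "(\<lambda>T. emeasure lborel (slab T L)) \<in> borel_measurable borel"
proof -
  have "(\<lambda>Tx :: ('a \<Rightarrow>\<^sub>L 'a) \<times> 'a. blinfun_apply (fst Tx) (snd Tx)) \<in> borel \<rightarrow>\<^sub>M borel" by measurable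
  from measurable_sets[OF this L] have A: "{Tx :: ('a \<Rightarrow>\<^sub>L 'a) \<times> 'a. blinfun_apply (fst Tx) (snd Tx) \<in> L} \<in> sets borel"
    by (simp add: vimage_def)
  have B: "{Tx :: ('a \<Rightarrow>\<^sub>L 'a) \<times> 'a. norm (snd Tx - blinfun_apply (fst Tx) (snd Tx)) \<le> 1} \<in> sets borel" by measurable
  have AB: "{Tx :: ('a \<Rightarrow>\<^sub>L 'a) \<times> 'a. blinfun_apply (fst Tx) (snd Tx) \<in> L} \<inter> {Tx. norm (snd Tx - blinfun_apply (fst Tx) (snd Tx)) \<le> 1} \<in> sets (borel \<Otimes>\<^sub>M lborel)"
  proof -
    have "sets ((borel :: ('a \<Rightarrow>\<^sub>L 'a) measure) \<Otimes>\<^sub>M (lborel :: 'a measure)) = sets (borel \<Otimes>\<^sub>M borel)" by (intro sets_pair_measure_cong) auto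
    then show ?thesis using sets.Int[OF A B] unfolding borel_prod by blast
  qed
  have "(\<lambda>(T, x). indicator ({Tx :: ('a \<Rightarrow>\<^sub>L 'a) \<times> 'a. blinfun_apply (fst Tx) (snd Tx) \<in> L} \<inter> {Tx. norm (snd Tx - blinfun_apply (fst Tx) (snd Tx)) \<le> 1}) (T, x) :: ennreal) \<in> borel_measurable (borel \<Otimes>\<^sub>M lborel)"
    using borel_measurable_indicator[OF AB] by (simp add: case_prod_beta')
  from lborel.borel_measurable_nn_integral[OF this]
  have "(\<lambda>T :: 'a \<Rightarrow>\<^sub>L 'a. \<integral>\<^sup>+x. indicator ({Tx. blinfun_apply (fst Tx) (snd Tx) \<in> L} \<inter> {Tx. norm (snd Tx - blinfun_apply (fst Tx) (snd Tx)) \<le> 1}) (T, x) \<partial>lborel) \<in> borel_measurable borel" .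
  moreover have "(\<integral>\<^sup>+x. indicator ({Tx. blinfun_apply (fst Tx) (snd Tx) \<in> L} \<inter> {Tx. norm (snd Tx - blinfun_apply (fst Tx) (snd Tx)) \<le> 1}) (T, x) \<partial>lborel) = emeasure lborel (slab T L)" for T :: "'a \<Rightarrow>\<^sub>L 'a"
  proof -
    have "(\<integral>\<^sup>+x. indicator ({Tx. blinfun_apply (fst Tx) (snd Tx) \<in> L} \<inter> {Tx. norm (snd Tx - blinfun_apply (fst Tx) (snd Tx)) \<le> 1}) (T, x) \<partial>lborel) = (\<integral>\<^sup>+x. indicator (slab T L) x \<partial>lborel)"
      by (rule nn_integral_cong) (auto simp: slab_def indicator_def)
    then show ?thesis using measurable_slab[OF L, of T] by simp
  qed
  ultimately show ?thesis by simp
qed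

lemma measurable_tube_vol: "L \<in> sets borel \<Longrightarrow> (\<lambda>T. tube_vol T L) \<in> borel_measurable borel"
  unfolding tube_vol_def measure_def
  by (rule borel_measurable_enn2real[OF measurable_emeasure_slab])

text \<open>Section volumes are a constant multiple of tube volumes. A slab does not see whether
  \<open>L\<close> is intersected with the range, since \<open>T x\<close> always lies
  there.\<close>

lemma subspace_volume_tube_vol:
  fixes T :: "'a::euclidean_space \<Rightarrow>\<^sub>L 'a"
  assumes T: "is_proj m T" and m: "1 \<le> m" and L: "L \<in> sets borel" "L \<subseteq> cball 0 r"
  shows "subspace_volume (range (blinfun_apply T)) (L \<inter> range (blinfun_apply T)) =
    unit_ball_vol (real m) / enn2real (slab_const TYPE('a) m) * tube_vol T L"
    "0 < slab_const TYPE('a) m" "slab_const TYPE('a) m < top"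
proof -
  let ?\<xi> = "range (blinfun_apply T)"
  define c where "c = slab_const TYPE('a) m"
  have c: "0 < c" "c < top"
    using slab_const[OF T m] slab_cball_pos[OF T] emeasure_slab_cball_finite[of T 1] by (auto simp: c_def)
  then show "0 < slab_const TYPE('a) m" "slab_const TYPE('a) m < top" by (auto simp: c_def)
  have c': "enn2real c > 0" "c = ennreal (enn2real c)" using c by (auto simp: enn2real_positive_iff)
  have \<xi>: "?\<xi> \<in> sets borel" using closed_subspace[OF subspace_range_blinfun[of T]] by simp
  have "slab T (L \<inter> ?\<xi>) = slab T L" by (auto simp: slab_def)
  then have e: "emeasure (subspace_lborel ?\<xi>) (L \<inter> ?\<xi>) * c = ennreal (unit_ball_vol (real m)) * ennreal (tube_vol T L)"
    using subspace_lborel_slab[OF T, of "L \<inter> ?\<xi>"] L(1) \<xi> slab_const[OF T m] emeasure_slab_bounded(1)[OF L(2), of T]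
    by (simp add: c_def)
  have "enn2real (emeasure (subspace_lborel ?\<xi>) (L \<inter> ?\<xi>)) * enn2real c = unit_ball_vol (real m) * tube_vol T L"
    using arg_cong[OF e, of enn2real] by (simp add: enn2real_mult)
  then show "subspace_volume ?\<xi> (L \<inter> ?\<xi>) = unit_ball_vol (real m) / enn2real (slab_const TYPE('a) m) * tube_vol T L"
    using c'(1) by (simp add: subspace_volume_def measure_def c_def[symmetric] field_simps)
qed

text \<open>The numbers \<open>h u\<close> need not be support numbers: a half-space may be
  redundant, and its facet is then missing.\<close>

definition poly_body :: "'a::euclidean_space set \<Rightarrow> ('a \<Rightarrow> real) \<Rightarrow> 'a set" where
  "poly_body U h = {x. \<forall>u\<in>U. x \<bullet> u \<le> h u}"

text \<open>The open cone over the facet with outer normal \<open>u\<close>.\<close>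

definition facet_cone :: "'a::euclidean_space set \<Rightarrow> ('a \<Rightarrow> real) \<Rightarrow> 'a \<Rightarrow> 'a set" where
  "facet_cone U h u = {x. 0 < x \<bullet> u \<and> (\<forall>w\<in>U - {u}. (x \<bullet> w) * h u < (x \<bullet> u) * h w)}"

text \<open>For positive \<open>h\<close>, the open pyramid with apex at the origin over the
  facet.\<close>

definition facet_cell :: "'a::euclidean_space set \<Rightarrow> ('a \<Rightarrow> real) \<Rightarrow> 'a \<Rightarrow> 'a set" where
  "facet_cell U h u = {x \<in> facet_cone U h u. x \<bullet> u < h u}"

lemma closed_poly_body: "closed (poly_body U h)"
proof -
  have "poly_body U h = (\<Inter>u\<in>U. {x. x \<bullet> u \<le> h u})" by (auto simp: poly_body_def)
  moreover have "closed {x. x \<bullet> u \<le> h u}" for u by (intro closed_Collect_le continuous_intros)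
  ultimately show ?thesis by auto
qed

lemma poly_body_borel [measurable]: "poly_body (U :: 'a::euclidean_space set) h \<in> sets borel"
  by (rule borel_closed[OF closed_poly_body])

lemma facet_cone_borel:
  assumes "finite U" shows "facet_cone U h u \<in> sets borel" "facet_cell U h u \<in> sets borel"
proof -
  have "facet_cone U h u = {x. 0 < x \<bullet> u} \<inter> {x. \<forall>w\<in>U - {u}. (x \<bullet> w) * h u < (x \<bullet> u) * h w}"
    by (auto simp: facet_cone_def)
  moreover have "open {x. \<forall>w\<in>U - {u}. (x \<bullet> w) * h u < (x \<bullet> u) * h w}"
  proof -
    have "{x. \<forall>w\<in>U - {u}. (x \<bullet> w) * h u < (x \<bullet> u) * h w} = (\<Inter>w\<in>U - {u}. {x. (x \<bullet> w) * h u < (x \<bullet> u) * h w})" by auto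
    also have "open \<dots>" using assms by (intro open_INT ballI open_Collect_less continuous_intros) auto
    finally show ?thesis .
  qed
  moreover have "open {x. 0 < x \<bullet> u}" by (intro open_Collect_less continuous_intros)
  ultimately have o: "open (facet_cone U h u)" by auto
  then show "facet_cone U h u \<in> sets borel" by simp
  have "open {x. x \<bullet> u < h u}" by (intro open_Collect_less continuous_intros)
  moreover have "facet_cell U h u = facet_cone U h u \<inter> {x. x \<bullet> u < h u}" by (auto simp: facet_cell_def)
  ultimately show "facet_cell U h u \<in> sets borel" using o by simp
qed

lemma facet_cone_scale:
  assumes "r > 0" shows "r *\<^sub>R x \<in> facet_cone U h u \<longleftrightarrow> x \<in> facet_cone U h u"
  using assms by (auto simp: facet_cone_def zero_less_mult_iff mult.assoc)

lemma sgn_facet_cone: "sgn x \<in> facet_cone U h u \<longleftrightarrow> x \<in> facet_cone U h u"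
proof (cases "x = 0")
  case False
  then show ?thesis using facet_cone_scale[of "inverse (norm x)" x U h u] by (simp add: sgn_div_norm)
qed simp

lemma facet_cone_disjoint:
  assumes "u \<in> U" "w \<in> U" "x \<in> facet_cone U h u" "x \<in> facet_cone U h w"
  shows "u = w"
proof (rule ccontr)
  assume "u \<noteq> w"
  then have "(x \<bullet> w) * h u < (x \<bullet> u) * h w" "(x \<bullet> u) * h w < (x \<bullet> w) * h u"
    using assms by (auto simp: facet_cone_def)
  then show False by simp
qed

text \<open>\<open>positive\<close> expresses that \<open>U\<close> lies in no closed hemisphere,
  which is what bounds all bodies \<open>poly_body U h\<close>.\<close>

locale facet_normals =
  fixes U :: "'a::euclidean_space set"
  assumes finite_U: "finite U" and unit: "\<And>u. u \<in> U \<Longrightarrow> norm u = 1"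
    and positive: "\<And>x. x \<noteq> 0 \<Longrightarrow> \<exists>u\<in>U. 0 < x \<bullet> u"
begin

lemma inradius_const: "\<exists>\<delta>>0. \<forall>x. \<exists>u\<in>U. \<delta> * norm x \<le> x \<bullet> u"
proof -
  \<comment> \<open>Continuous, and positive on the sphere by \<open>positive\<close>; its minimum
    divided by \<open>card U\<close> is a lower bound for the largest summand.\<close>
  define f where "f x = (\<Sum>u\<in>U. max 0 (x \<bullet> u))" for x
  have cf: "continuous_on (sphere 0 1) f" unfolding f_def by (intro continuous_intros)
  have "(sphere (0::'a) 1) \<noteq> {}" by simp
  then obtain x0 where x0: "x0 \<in> sphere 0 1" "\<And>x. x \<in> sphere 0 1 \<Longrightarrow> f x0 \<le> f x"
    using continuous_attains_inf[OF compact_sphere _ cf] by metis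
  then obtain u0 where u0: "u0 \<in> U" "0 < x0 \<bullet> u0" using positive[of x0] by force
  have "0 < f x0" unfolding f_def using finite_U u0 by (intro sum_pos2[of _ u0]) auto
  moreover have U: "U \<noteq> {}" using u0 by auto
  ultimately have d: "0 < f x0 / card U" using finite_U by (simp add: card_gt_0_iff)
  have "\<exists>u\<in>U. f x0 / card U * norm x \<le> x \<bullet> u" for x
  proof (cases "x = 0")
    case True
    then show ?thesis using U by auto
  next
    case False
    show ?thesis
    proof (rule ccontr)
      assume "\<not> ?thesis"
      then have lt: "x \<bullet> u < f x0 / card U * norm x" if "u \<in> U" for u using that by force
      have "f (sgn x) < (\<Sum>u\<in>U. f x0 / card U)" unfolding f_def[of "sgn x"]
      proof (rule sum_strict_mono[OF finite_U U])
        fix u assume "u \<in> U"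
        from lt[OF this] have "sgn x \<bullet> u < f x0 / card U" using False by (simp add: sgn_div_norm field_simps)
        then show "max 0 (sgn x \<bullet> u) < f x0 / card U" using d by simp
      qed
      also have "\<dots> = f x0" using finite_U U by simp
      also have "\<dots> \<le> f (sgn x)" using False by (intro x0(2)) (simp add: norm_sgn)
      finally show False by simp
    qed
  qed
  then show ?thesis using d by blast
qed

lemma poly_body_bounded:
  "\<exists>c>0. \<forall>h B. (\<forall>u\<in>U. h u \<le> B) \<longrightarrow> poly_body U h \<subseteq> cball 0 (c * B)"
proof -
  obtain \<delta> where d: "\<delta> > 0" "\<And>x. \<exists>u\<in>U. \<delta> * norm x \<le> x \<bullet> u" using inradius_const by blast
  have "poly_body U h \<subseteq> cball 0 (1 / \<delta> * B)" if B: "\<forall>u\<in>U. h u \<le> B" for h B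
  proof
    fix x assume x: "x \<in> poly_body U h"
    obtain u where u: "u \<in> U" "\<delta> * norm x \<le> x \<bullet> u" using d(2) by blast
    moreover have "x \<bullet> u \<le> B" using x u B by (force simp: poly_body_def)
    ultimately have "\<delta> * norm x \<le> B" by linarith
    then show "x \<in> cball 0 (1 / \<delta> * B)" using d(1) by (simp add: field_simps)
  qed
  then show ?thesis using d(1) by (intro exI[of _ "1 / \<delta>"]) auto
qed

lemma poly_body_cball: "\<exists>r>0. poly_body U h \<subseteq> cball 0 r"
proof -
  obtain c where c: "c > 0" "\<And>h B. (\<forall>u\<in>U. h u \<le> B) \<Longrightarrow> poly_body U h \<subseteq> cball 0 (c * B)"
    using poly_body_bounded by blast
  define B where "B = max 1 (Max (h ` U))"
  have "\<forall>u\<in>U. h u \<le> B" using finite_U by (auto simp: B_def le_max_iff_disj)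
  then have "poly_body U h \<subseteq> cball 0 (c * B)" by (rule c(2))
  moreover have "c * B > 0" using c(1) by (simp add: B_def)
  ultimately show ?thesis by blast
qed

end

locale facet_body = facet_normals U for U :: "'a::euclidean_space set" +
  fixes h :: "'a \<Rightarrow> real"
  assumes hpos: "\<And>u. u \<in> U \<Longrightarrow> 0 < h u"
begin

abbreviation "P \<equiv> poly_body U h"

lemma zero_interior: "0 \<in> interior P"
proof -
  have "open {x. \<forall>u\<in>U. x \<bullet> u < h u}"
  proof -
    have "{x. \<forall>u\<in>U. x \<bullet> u < h u} = (\<Inter>u\<in>U. {x. x \<bullet> u < h u})" by auto
    also have "open \<dots>" using finite_U by (intro open_INT ballI open_Collect_less continuous_intros)
    finally show ?thesis .
  qed
  moreover have "{x. \<forall>u\<in>U. x \<bullet> u < h u} \<subseteq> P" by (auto simp: poly_body_def intro: less_imp_le)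
  ultimately show ?thesis using hpos by (auto simp: interior_def)
qed

lemma polytope_P: "polytope P"
proof -
  have "P = \<Inter>((\<lambda>u. {x. u \<bullet> x \<le> h u}) ` U)" by (auto simp: poly_body_def inner_commute)
  moreover have "polyhedron (\<Inter>((\<lambda>u. {x. u \<bullet> x \<le> h u}) ` U))"
    using finite_U by (intro polyhedron_Inter) (auto simp: polyhedron_halfspace_le)
  ultimately have "polyhedron P" by simp
  moreover have "bounded P" using poly_body_cball[of h] bounded_subset by blast
  ultimately show ?thesis by (simp add: polytope_eq_bounded_polyhedron)
qed

text \<open>Stated for a general map \<open>Q\<close> in order to serve twice: for points of the
  whole space, and for the projections \<open>T x\<close> that describe a section.\<close>

lemma facet_cone_AE:
  assumes a: "\<And>u w. u \<in> U \<Longrightarrow> w \<in> U - {u} \<Longrightarrow> h u *\<^sub>R w - h w *\<^sub>R u \<noteq> 0 \<Longrightarrow>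
      AE x in M. Q x \<bullet> (h u *\<^sub>R w - h w *\<^sub>R u) \<noteq> 0"
    and b: "AE x in M. Q x \<noteq> 0"
  shows "AE x in M. \<exists>u\<in>U. Q x \<in> facet_cone U h u"
proof -
  have "AE x in M. \<forall>u\<in>U. \<forall>w\<in>U - {u}. Q x \<bullet> (h u *\<^sub>R w - h w *\<^sub>R u) \<noteq> 0"
  proof (subst AE_finite_all[OF finite_U], intro ballI, subst AE_finite_all, simp add: finite_U, intro ballI)
    fix u w assume u: "u \<in> U" and w: "w \<in> U - {u}"
    have "h u *\<^sub>R w - h w *\<^sub>R u \<noteq> 0"
    proof
      assume "h u *\<^sub>R w - h w *\<^sub>R u = 0"
      then have e: "h u *\<^sub>R w = h w *\<^sub>R u" by simp
      have "norm (h u *\<^sub>R w) = norm (h w *\<^sub>R u)" unfolding e ..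
      then have hh: "h u = h w" using unit[OF u] unit[of w] w hpos[OF u] hpos[of w] by simp
      from e have "w = u" unfolding hh using hpos[of w] w by simp
      then show False using w by simp
    qed
    then show "AE x in M. Q x \<bullet> (h u *\<^sub>R w - h w *\<^sub>R u) \<noteq> 0" by (rule a[OF u w])
  qed
  then show ?thesis using b
  proof eventually_elim
    case (elim x)
    then obtain w where w: "w \<in> U" "0 < Q x \<bullet> w" using positive by blast
    \<comment> \<open>When positive, \<open>f u\<close> is the reciprocal of the parameter at which
      the ray through \<open>Q x\<close> meets the hyperplane of \<open>u\<close>. The largest value
      marks the facet hit first, and the first assumption excludes ties.\<close>
    define f where "f u = (Q x \<bullet> u) / h u" for u
    have "Max (f ` U) \<in> f ` U" using finite_U w by (intro Max_in) auto
    then obtain u where u: "u \<in> U" "f u = Max (f ` U)" by auto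
    have le: "f v \<le> f u" if "v \<in> U" for v using that finite_U u(2) by simp
    have "0 < f w" using w hpos by (simp add: f_def)
    then have "0 < f u" using le[OF w(1)] by linarith
    then have p: "0 < Q x \<bullet> u" using hpos[OF u(1)] by (simp add: f_def zero_less_divide_iff)
    have "(Q x \<bullet> v) * h u < (Q x \<bullet> u) * h v" if v: "v \<in> U - {u}" for v
    proof -
      have hv: "0 < h v" "0 < h u" using v u hpos by auto
      have "(Q x \<bullet> v) * h u \<le> (Q x \<bullet> u) * h v" using le[of v] v hv by (simp add: f_def field_simps)
      moreover have "Q x \<bullet> (h u *\<^sub>R v - h v *\<^sub>R u) \<noteq> 0" using elim(1) u(1) v by blast
      then have "(Q x \<bullet> v) * h u \<noteq> (Q x \<bullet> u) * h v" by (simp add: inner_diff_right mult.commute)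
      ultimately show ?thesis by simp
    qed
    then show ?case using u(1) p by (auto simp: facet_cone_def)
  qed
qed


context
  fixes u x :: 'a
  assumes u: "u \<in> U" and x: "x \<in> facet_cone U h u"
begin

lemma xu_pos: "0 < x \<bullet> u"
  using x by (simp add: facet_cone_def)

lemma cone_scaled_in_P:
  assumes t: "0 \<le> t" shows "t *\<^sub>R x \<in> P \<longleftrightarrow> t * (x \<bullet> u) \<le> h u"
proof
  assume "t *\<^sub>R x \<in> P" then show "t * (x \<bullet> u) \<le> h u" using u by (simp add: poly_body_def)
next
  assume le: "t * (x \<bullet> u) \<le> h u"
  have "t * (x \<bullet> w) \<le> h w" if w: "w \<in> U" for w
  proof (cases "w = u")
    case False
    then have "(x \<bullet> w) * h u \<le> (x \<bullet> u) * h w" using x w by (auto simp: facet_cone_def intro: less_imp_le)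
    then have "t * ((x \<bullet> w) * h u) \<le> t * ((x \<bullet> u) * h w)" using t by (rule mult_left_mono)
    also have "\<dots> = (t * (x \<bullet> u)) * h w" by simp
    also have "\<dots> \<le> h u * h w" using le hpos[OF w] by (intro mult_right_mono) auto
    finally have "(t * (x \<bullet> w)) * h u \<le> h w * h u" by (simp add: mult_ac)
    then show ?thesis using hpos[OF u] by simp
  qed (use le in simp)
  then show "t *\<^sub>R x \<in> P" by (simp add: poly_body_def)
qed

lemma radial_cone: "radial P x = h u / (x \<bullet> u)"
proof -
  have "{t. 0 \<le> t \<and> t *\<^sub>R x \<in> P} = {0..h u / (x \<bullet> u)}"
    using cone_scaled_in_P xu_pos by (auto simp: field_simps)
  moreover have "0 \<le> h u / (x \<bullet> u)" using xu_pos hpos[OF u] by simp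
  ultimately show ?thesis by (simp add: radial_def)
qed

text \<open>The boundary point \<open>y\<close> satisfies every other constraint strictly, so it can
  be moved a little inside the facet hyperplane along the tangential part \<open>d\<close> of any
  outer normal \<open>v\<close>; maximality at \<open>y\<close> forces \<open>d = 0\<close>.\<close>

lemma outer_normals_cone: "outer_unit_normals P (radial P x *\<^sub>R x) = {u}"
proof -
  define y where "y = radial P x *\<^sub>R x"
  have yu: "y \<bullet> u = h u" using xu_pos by (simp add: y_def radial_cone)
  have yw: "y \<bullet> w < h w" if w: "w \<in> U" "w \<noteq> u" for w
  proof -
    have "(x \<bullet> w) * h u < (x \<bullet> u) * h w" using x w by (auto simp: facet_cone_def)
    then show ?thesis using xu_pos by (simp add: y_def radial_cone field_simps)
  qed
  have "u \<in> outer_unit_normals P y"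
    using u unit by (auto simp: outer_unit_normals_def yu poly_body_def)
  moreover have "v = u" if v: "v \<in> outer_unit_normals P y" for v
  proof -
    have nv: "norm v = 1" and vm: "\<And>z. z \<in> P \<Longrightarrow> z \<bullet> v \<le> y \<bullet> v" using v by (auto simp: outer_unit_normals_def)
    define d where "d = v - (v \<bullet> u) *\<^sub>R u"
    have uu: "u \<bullet> u = 1" using unit[OF u] by (simp add: dot_square_norm)
    have du: "d \<bullet> u = 0" by (simp add: d_def inner_diff_left uu)
    have "\<forall>\<^sub>F e in at_right 0. \<forall>w\<in>U - {u}. (y + e *\<^sub>R d) \<bullet> w < h w"
    proof (subst eventually_ball_finite_distrib, simp add: finite_U, intro ballI)
      fix w assume w: "w \<in> U - {u}"
      have "((\<lambda>e. (y + e *\<^sub>R d) \<bullet> w) \<longlongrightarrow> (y + 0 *\<^sub>R d) \<bullet> w) (at_right 0)" by (intro tendsto_intros)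
      then show "\<forall>\<^sub>F e in at_right 0. (y + e *\<^sub>R d) \<bullet> w < h w"
        by (rule order_tendstoD) (use yw w in simp)
    qed
    then have "\<forall>\<^sub>F e::real in at_right 0. e > 0 \<and> (\<forall>w\<in>U - {u}. (y + e *\<^sub>R d) \<bullet> w < h w)"
      using eventually_at_right_less[of "0::real"] by eventually_elim simp
    then obtain e :: real where e: "e > 0" "\<And>w. w \<in> U - {u} \<Longrightarrow> (y + e *\<^sub>R d) \<bullet> w < h w"
      using eventually_happens[of _ "at_right (0::real)"] by (metis (no_types, lifting) trivial_limit_at_right_real)
    have "y + e *\<^sub>R d \<in> P"
      unfolding poly_body_def
    proof safe
      fix w assume "w \<in> U"
      then show "(y + e *\<^sub>R d) \<bullet> w \<le> h w"
        using e(2)[of w] by (cases "w = u") (simp add: inner_add_left yu du, force)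
    qed
    from vm[OF this] have "e * (d \<bullet> v) \<le> 0" by (simp add: inner_add_left)
    then have "d \<bullet> v \<le> 0" using e(1) by (simp add: mult_le_0_iff)
    moreover have "d \<bullet> v = d \<bullet> d"
    proof -
      have "d \<bullet> d = d \<bullet> (v - (v \<bullet> u) *\<^sub>R u)" unfolding d_def ..
      then show ?thesis using du by (simp add: inner_diff_right)
    qed
    ultimately have "d \<bullet> d \<le> 0" by simp
    then have "d = 0" by (metis inner_eq_zero_iff inner_ge_zero order_antisym)
    then have vu: "v = (v \<bullet> u) *\<^sub>R u" by (simp add: d_def)
    have "norm ((v \<bullet> u) *\<^sub>R u) = \<bar>v \<bullet> u\<bar>" using unit[OF u] by simp
    then have "\<bar>v \<bullet> u\<bar> = 1" using vu nv by metis
    \<comment> \<open>The origin belongs to the body, which excludes \<open>v = - u\<close>.\<close>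
    have "0 \<le> y \<bullet> v" using vm[of 0] hpos by (force simp: poly_body_def less_imp_le)
    moreover have "y \<bullet> v = (v \<bullet> u) * (y \<bullet> u)" using vu by (metis inner_scaleR_right)
    ultimately have "0 \<le> (v \<bullet> u) * h u" by (simp add: yu)
    then have "0 \<le> v \<bullet> u" using hpos[OF u] by (simp add: zero_le_mult_iff)
    then have "v \<bullet> u = 1" using \<open>\<bar>v \<bullet> u\<bar> = 1\<close> by simp
    then show "v = u" using vu by simp
  qed
  ultimately show ?thesis unfolding y_def by blast
qed

lemma outer_normal_cone: "outer_unit_normal P (radial P x *\<^sub>R x) = u"
  unfolding outer_unit_normal_def outer_normals_cone by simp

end

end

section \<open>The curvature measure of a polytope\<close>

text \<open>Up to a constant the mean over \<open>\<xi>\<close> of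
  \<open>|P \<inter> \<xi>| ^ (n - 1) * |P \<inter> \<xi> \<inter> C|\<close>, with tubes instead of
  sections.\<close>

definition facet_flux :: "nat \<Rightarrow> 'a::euclidean_space set \<Rightarrow> ('a \<Rightarrow> real) \<Rightarrow> 'a \<Rightarrow> ennreal" where
  "facet_flux m U h u = (\<integral>\<^sup>+z. ennreal (tube_vol (snd z) (poly_body U h) ^ (DIM('a) - 1)) *
     emeasure lborel (slab (snd z) (facet_cell U h u)) \<partial>flag_haar m)"

text \<open>Three normalisations: \<open>m * unit_ball_vol m\<close> is the dual Radon constant
  after its denominator has cancelled against the total mass of the sphere; the power converts tube
  volumes into section volumes in \<open>n - 1\<close> factors; the last division comes from
  \<open>flag_haar_disintegration\<close>.\<close>

definition curvature_const :: "'a::euclidean_space itself \<Rightarrow> nat \<Rightarrow> real" where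
  "curvature_const _ m = real m * unit_ball_vol (real m) *
     (unit_ball_vol (real m) / enn2real (slab_const TYPE('a) m)) ^ (DIM('a) - 1) / enn2real (slab_const TYPE('a) m)"

lemma slab_const_pos:
  assumes m: "1 \<le> m" "m \<le> DIM('a::euclidean_space)"
  shows "0 < slab_const TYPE('a) m" "slab_const TYPE('a) m < top" "0 < enn2real (slab_const TYPE('a) m)"
proof -
  interpret F: prob_space "flag_haar m :: 'a flag measure" by (rule flag_haar_props(2)[OF m])
  have "\<exists>z :: 'a flag. flag m z"
  proof (rule ccontr)
    assume "\<not> ?thesis"
    then have "\<not> flag m z" for z :: "'a flag" by blast
    with flag_haar_props(3)[OF m] have "AE z in (flag_haar m :: 'a flag measure). False" by simp
    then show False using F.AE_False by simp
  qed
  then obtain z :: "'a flag" where "is_proj m (snd z)" by (auto simp: flag_def)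
  from subspace_volume_tube_vol(2,3)[OF this m(1), of "{}" 0]
  show "0 < slab_const TYPE('a) m" "slab_const TYPE('a) m < top" by auto
  then show "0 < enn2real (slab_const TYPE('a) m)" by (simp add: enn2real_positive_iff)
qed

lemma curvature_const_pos:
  assumes m: "1 \<le> m" "m \<le> DIM('a::euclidean_space)"
  shows "0 < curvature_const TYPE('a) m"
  using slab_const_pos[OF m] m by (simp add: curvature_const_def)

lemma measurable_tube_vol_snd:
  fixes L :: "'a::euclidean_space set"
  assumes "L \<in> sets borel"
  shows "(\<lambda>z :: 'a flag. tube_vol (snd z) L ^ k) \<in> borel_measurable borel"
proof -
  have "(snd :: 'a flag \<Rightarrow> _) \<in> borel_measurable borel" using measurable_snd_borel[OF measurable_ident] by simp
  from measurable_compose[OF this measurable_tube_vol[OF assms]] show ?thesis by measurable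
qed

context facet_body
begin

text \<open>\<open>R\<close> is the radial function on the cone over the facet. Disintegration puts
  the subspace first, and polar coordinates inside it turn the integral of \<open>R ^ m\<close> over
  directions into the volume of the pyramid.\<close>

lemma facet_flux_sphere:
  assumes m: "1 \<le> m" "m \<le> DIM('a)" and u: "u \<in> U"
  defines "R \<equiv> (\<lambda>x. if 0 < x \<bullet> u then h u / (x \<bullet> u) else 0)"
  shows "slab_const TYPE('a) m * (\<integral>\<^sup>+x. indicator (facet_cone U h u) (sgn x) * ennreal (R (sgn x) ^ m) *
      (\<integral>\<^sup>+z. ennreal (tube_vol (snd z) P ^ (DIM('a) - 1)) \<partial>flags_at (sgn x) (m - 1)) \<partial>unif_ball) = facet_flux m U h u"
proof -
  define V where "V z = ennreal (tube_vol (snd z) P ^ (DIM('a) - 1))" for z :: "'a flag"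
  have mV: "V \<in> borel_measurable borel"
    unfolding V_def using measurable_tube_vol_snd[OF poly_body_borel] by measurable
  note C = facet_cone_borel[OF finite_U, of h u]
  have mR: "R \<in> borel_measurable borel" unfolding R_def by measurable
  have R0: "0 \<le> R x" for x using hpos[OF u] by (simp add: R_def)
  define H where "H z = indicator (facet_cone U h u) (fst z) * ennreal (R (fst z) ^ m) * V z" for z :: "'a flag"
  have mfst: "(fst :: 'a flag \<Rightarrow> 'a) \<in> borel_measurable borel" using measurable_fst_borel[OF measurable_ident] by simp
  have mRf: "(\<lambda>z :: 'a flag. R (fst z)) \<in> borel_measurable borel" by (rule measurable_compose[OF mfst mR])
  have mCf: "(\<lambda>z :: 'a flag. indicator (facet_cone U h u) (fst z) :: ennreal) \<in> borel_measurable borel"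
    by (rule measurable_compose[OF mfst]) (use C in simp)
  have mH: "H \<in> borel_measurable borel"
    unfolding H_def using mV mRf mCf by measurable
  have "(\<integral>\<^sup>+x. indicator (facet_cone U h u) (sgn x) * ennreal (R (sgn x) ^ m) * (\<integral>\<^sup>+z. V z \<partial>flags_at (sgn x) (m - 1)) \<partial>unif_ball) =
    (\<integral>\<^sup>+x. (\<integral>\<^sup>+z. H z \<partial>flags_at (sgn x) (m - 1)) \<partial>(unif_ball :: 'a measure))"
  proof (rule nn_integral_cong_AE)
    have "AE x in lborel. x \<noteq> (0::'a)" by (rule AE_lborel_singleton)
    then have "AE x in unif_ball. x \<noteq> (0::'a)" by (rule AE_unif_ball)
    then show "AE x in (unif_ball :: 'a measure). indicator (facet_cone U h u) (sgn x) * ennreal (R (sgn x) ^ m) * (\<integral>\<^sup>+z. V z \<partial>flags_at (sgn x) (m - 1))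
        = (\<integral>\<^sup>+z. H z \<partial>flags_at (sgn x) (m - 1))"
    proof eventually_elim
      case (elim x)
      then have s: "norm (sgn x) = 1" by (simp add: norm_sgn)
      have k: "Suc (m - 1) \<le> DIM('a)" using m by simp
      note F = flags_at_props[OF s k]
      have "(\<integral>\<^sup>+z. H z \<partial>flags_at (sgn x) (m - 1)) = (\<integral>\<^sup>+z. indicator (facet_cone U h u) (sgn x) * ennreal (R (sgn x) ^ m) * V z \<partial>flags_at (sgn x) (m - 1))"
        by (rule nn_integral_cong_AE, use F(3) in eventually_elim) (simp add: H_def)
      also have "\<dots> = indicator (facet_cone U h u) (sgn x) * ennreal (R (sgn x) ^ m) * (\<integral>\<^sup>+z. V z \<partial>flags_at (sgn x) (m - 1))"
        by (rule nn_integral_cmult) (use mV F(1) in \<open>simp cong: measurable_cong_sets\<close>)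
      finally show ?case by simp
    qed
  qed
  also have "\<dots> = (\<integral>\<^sup>+z. H z \<partial>(flag_haar m :: 'a flag measure))" by (rule flag_haar_props(5)[OF m mH, symmetric])
  finally have "slab_const TYPE('a) m * (\<integral>\<^sup>+x. indicator (facet_cone U h u) (sgn x) * ennreal (R (sgn x) ^ m) * (\<integral>\<^sup>+z. V z \<partial>flags_at (sgn x) (m - 1)) \<partial>unif_ball)
     = slab_const TYPE('a) m * (\<integral>\<^sup>+z. H z \<partial>(flag_haar m :: 'a flag measure))" by simp
  also have "\<dots> = (\<integral>\<^sup>+z. (\<integral>\<^sup>+x. H (sgn (blinfun_apply (snd z) x), snd z) * indicator (slab (snd z) (cball 0 1)) x \<partial>lborel) \<partial>(flag_haar m :: 'a flag measure))"
    by (rule flag_haar_disintegration[OF m mH, symmetric])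
  also have "\<dots> = (\<integral>\<^sup>+z. V z * emeasure lborel (slab (snd z) (facet_cell U h u)) \<partial>(flag_haar m :: 'a flag measure))"
  proof (rule nn_integral_cong_AE, use flag_haar_props(3)[OF m] in eventually_elim)
    fix z :: "'a flag" assume z: "flag m z"
    then have T: "is_proj m (snd z)" by (simp add: flag_def)
    have cell: "{x. sgn x \<in> facet_cone U h u \<and> norm x < R (sgn x)} = facet_cell U h u"
    proof -
      have "norm x < R (sgn x) \<longleftrightarrow> x \<bullet> u < h u" if "x \<in> facet_cone U h u" for x
      proof -
        have xu: "0 < x \<bullet> u" using that by (simp add: facet_cone_def)
        then have "x \<noteq> 0" by auto
        then have nx: "0 < norm x" by simp
        have "0 < sgn x \<bullet> u" using xu nx by (simp add: sgn_div_norm)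
        then have "R (sgn x) = h u / (sgn x \<bullet> u)" by (simp add: R_def)
        also have "\<dots> = norm x * (h u / (x \<bullet> u))" using nx by (simp add: sgn_div_norm field_simps)
        finally have e: "R (sgn x) = norm x * (h u / (x \<bullet> u))" .
        have "norm x < norm x * (h u / (x \<bullet> u)) \<longleftrightarrow> 1 < h u / (x \<bullet> u)"
          using nx mult_less_cancel_left_pos[of "norm x" 1 "h u / (x \<bullet> u)"] by simp
        then show ?thesis unfolding e using xu by (simp add: less_divide_eq)
      qed
      then show ?thesis by (auto simp: facet_cell_def sgn_facet_cone)
    qed
    have "(\<integral>\<^sup>+x. H (sgn (snd z x), snd z) * indicator (slab (snd z) (cball 0 1)) x \<partial>lborel) =
      (\<integral>\<^sup>+x. V z * (ennreal (R (sgn (snd z x)) ^ m) * indicator (facet_cone U h u) (sgn (snd z x)) * indicator (slab (snd z) (cball 0 1)) x) \<partial>lborel)"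
      by (rule nn_integral_cong) (simp add: H_def V_def mult_ac)
    also have "\<dots> = V z * (\<integral>\<^sup>+x. ennreal (R (sgn (snd z x)) ^ m) * indicator (facet_cone U h u) (sgn (snd z x)) * indicator (slab (snd z) (cball 0 1)) x \<partial>lborel)"
    proof (rule nn_integral_cmult)
      show "(\<lambda>x. ennreal (R (sgn (snd z x)) ^ m) * indicator (facet_cone U h u) (sgn (snd z x)) * indicator (slab (snd z) (cball 0 1)) x) \<in> borel_measurable lborel"
        using mR C by measurable
    qed
    also have "\<dots> = V z * emeasure lborel (slab (snd z) {x. sgn x \<in> facet_cone U h u \<and> norm x < R (sgn x)})"
      by (subst slab_polar[OF T m(1) C(1) mR R0]) simp
    finally show "(\<integral>\<^sup>+x. H (sgn (snd z x), snd z) * indicator (slab (snd z) (cball 0 1)) x \<partial>lborel) = V z * emeasure lborel (slab (snd z) (facet_cell U h u))"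
      unfolding cell .
  qed
  finally show ?thesis unfolding V_def facet_flux_def .
qed

lemma ennreal_dual_radon:
  assumes m: "1 \<le> m" "m \<le> DIM('a)" and x: "norm x = 1"
  defines "D \<equiv> dual_radon m (\<lambda>\<xi>. subspace_volume \<xi> (P \<inter> \<xi>) ^ (DIM('a) - 1)) x"
  shows "0 \<le> D"
    "ennreal D = ennreal ((real m * unit_ball_vol (real m)) / (real DIM('a) * unit_ball_vol (real DIM('a))) *
       (unit_ball_vol (real m) / enn2real (slab_const TYPE('a) m)) ^ (DIM('a) - 1)) *
       (\<integral>\<^sup>+z. ennreal (tube_vol (snd z) P ^ (DIM('a) - 1)) \<partial>flags_at x (m - 1))"
proof -
  let ?n = "DIM('a) - 1"
  define c2 where "c2 = unit_ball_vol (real m) / enn2real (slab_const TYPE('a) m)"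
  define c1 where "c1 = (real m * unit_ball_vol (real m)) / (real DIM('a) * unit_ball_vol (real DIM('a)))"
  have c: "0 \<le> c1" "0 \<le> c2" by (simp_all add: c1_def c2_def)
  obtain r where r: "P \<subseteq> cball 0 r" using poly_body_cball[of h] by blast
  have k: "Suc (m - 1) \<le> DIM('a)" using m by simp
  note F = flags_at_props[OF x k]
  interpret F: prob_space "flags_at x (m - 1)" by (rule F(2))
  have mV: "(\<lambda>z :: 'a flag. tube_vol (snd z) P ^ ?n) \<in> borel_measurable borel"
    by (rule measurable_tube_vol_snd[OF poly_body_borel])
  have D: "D = c1 * (\<integral>z. (c2 * tube_vol (snd z) P) ^ ?n \<partial>flags_at x (m - 1))"
    unfolding D_def c1_def
  proof (rule dual_radon_flags_at[OF x m])
    show "(\<lambda>T. (c2 * tube_vol T P) ^ ?n) \<in> borel_measurable borel"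
      using measurable_tube_vol[OF poly_body_borel] by measurable
    show "subspace_volume (range (blinfun_apply T)) (P \<inter> range (blinfun_apply T)) ^ ?n = (c2 * tube_vol T P) ^ ?n" if "is_proj m T" for T :: "'a \<Rightarrow>\<^sub>L 'a"
      using subspace_volume_tube_vol(1)[OF that m(1) poly_body_borel r] by (simp add: c2_def)
  qed
  then have D': "D = c1 * c2 ^ ?n * (\<integral>z. tube_vol (snd z) P ^ ?n \<partial>flags_at x (m - 1))"
    by (simp add: power_mult_distrib)
  show "0 \<le> D" unfolding D' using c by (intro mult_nonneg_nonneg integral_nonneg) auto
  have "(\<integral>\<^sup>+z. ennreal (tube_vol (snd z) P ^ ?n) \<partial>flags_at x (m - 1)) = ennreal (\<integral>z. tube_vol (snd z) P ^ ?n \<partial>flags_at x (m - 1))"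
  proof (rule nn_integral_eq_integral)
    show "integrable (flags_at x (m - 1)) (\<lambda>z. tube_vol (snd z) P ^ ?n)"
    proof (rule F.integrable_const_bound)
      show "AE z in flags_at x (m - 1). norm (tube_vol (snd z) P ^ ?n) \<le> measure lborel (cball (0::'a) (r + 1)) ^ ?n"
        by (rule AE_I2) (use emeasure_slab_bounded(2)[OF r] in \<open>simp add: power_mono\<close>)
      show "(\<lambda>z. tube_vol (snd z) P ^ ?n) \<in> borel_measurable (flags_at x (m - 1))"
        using mV F(1) by (simp cong: measurable_cong_sets)
    qed
  qed simp
  then show "ennreal D = ennreal ((real m * unit_ball_vol (real m)) / (real DIM('a) * unit_ball_vol (real DIM('a))) *
       (unit_ball_vol (real m) / enn2real (slab_const TYPE('a) m)) ^ ?n) *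
       (\<integral>\<^sup>+z. ennreal (tube_vol (snd z) P ^ ?n) \<partial>flags_at x (m - 1))"
    unfolding D' c1_def[symmetric] c2_def[symmetric] using c by (simp add: ennreal_mult)
qed

lemma reverse_image_cone:
  assumes u: "u \<in> U" and x: "x \<in> facet_cone U h u" "norm x = 1"
  shows "x \<in> reverse_radial_gauss_image P \<eta> \<longleftrightarrow> u \<in> \<eta>"
proof -
  have "outer_unit_normals P (radial P x *\<^sub>R x) = {u}" by (rule outer_normals_cone[OF u x(1)])
  then show ?thesis using x(2) by (simp add: reverse_radial_gauss_image_def)
qed

text \<open>Applied with \<open>s = x \<bullet> u\<close> and \<open>t = h u\<close>, so that
  \<open>t / s\<close> is the radial function: on one facet the whole dependence on \<open>p\<close>
  reduces to the constant factor \<open>h u powr (- p)\<close>.\<close>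

lemma curvature_weight:
  assumes "0 < s" "0 < t"
  shows "s powr (- p) * (t / s) powr (real m - p) = t powr (- p) * (t / s) ^ m"
proof -
  have "(t / s) powr (real m - p) = (t / s) ^ m * (t / s) powr (- p)"
    using assms by (simp add: powr_diff powr_minus_divide powr_realpow)
  moreover have "s powr (- p) * (t / s) powr (- p) = t powr (- p)"
    using assms by (simp add: powr_mult[symmetric])
  ultimately show ?thesis by (simp add: mult_ac)
qed

text \<open>Almost every direction lies in exactly one facet cone, where the normal is constant. So
  \<open>\<eta>\<close> enters only through the finitely many normals it contains, and the formula
  holds for every set.\<close>

theorem curvature_poly_body:
  assumes m: "1 \<le> m" "m \<le> DIM('a)"
  shows "affine_dual_curvature p m P \<eta> =
    (\<Sum>u\<in>U. indicator \<eta> u * (ennreal (curvature_const TYPE('a) m * h u powr (- p)) * facet_flux m U h u))"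
proof -
  let ?n = "DIM('a) - 1"
  define Q where "Q x = (\<integral>\<^sup>+z. ennreal (tube_vol (snd z) P ^ ?n) \<partial>flags_at x (m - 1))" for x :: 'a
  define c where "c = enn2real (slab_const TYPE('a) m)"
  have c: "0 < c" "slab_const TYPE('a) m = ennreal c" using slab_const_pos[OF m] by (auto simp: c_def)
  define c3 where "c3 = (real m * unit_ball_vol (real m)) / (real DIM('a) * unit_ball_vol (real DIM('a))) *
       (unit_ball_vol (real m) / c) ^ ?n"
  have c3: "0 \<le> c3" using c by (simp add: c3_def)
  define R where "R u x = (if 0 < x \<bullet> u then h u / (x \<bullet> u) else 0)" for u x
  define W where "W u x = indicator (facet_cone U h u) x * ennreal (R u x ^ m) * Q x" for u x
  have "(\<lambda>z :: 'a flag. ennreal (tube_vol (snd z) P ^ ?n)) \<in> borel_measurable borel"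
    using measurable_tube_vol_snd[OF poly_body_borel] by measurable
  then have "(\<lambda>z. \<integral>\<^sup>+y. ennreal (tube_vol (snd y) P ^ ?n) \<partial>flag_chain (return borel z) (m - 1)) \<in> borel_measurable borel"
    by (rule measurable_flag_chain_return)
  moreover have "(\<lambda>x :: 'a. (x, rank1 x)) \<in> borel \<rightarrow>\<^sub>M borel" unfolding borel_prod[symmetric] by measurable
  ultimately have mQ: "Q \<in> borel_measurable borel"
    unfolding Q_def flags_at_def using measurable_compose by blast
  have mR: "R u \<in> borel_measurable borel" for u unfolding R_def by measurable
  have mW: "W u \<in> borel_measurable borel" for u
    unfolding W_def using mQ mR[of u] facet_cone_borel(1)[OF finite_U, of h u] by measurable
  have "affine_dual_curvature p m P \<eta> = (\<integral>\<^sup>+x. (\<Sum>u\<in>U. indicator \<eta> u * (ennreal (h u powr (- p) * c3) * W u x)) \<partial>sphere_lebesgue)"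
    unfolding affine_dual_curvature_def
  proof (rule nn_integral_cong_AE)
    have "AE x in sphere_lebesgue. \<exists>u\<in>U. x \<in> facet_cone U h u"
    proof (rule AE_sphere_lebesgue)
      have "{x. \<exists>u\<in>U. x \<in> facet_cone U h u} = (\<Union>u\<in>U. facet_cone U h u)" by auto
      then show "{x. \<exists>u\<in>U. x \<in> facet_cone U h u} \<in> sets borel"
        using finite_U facet_cone_borel(1)[OF finite_U] by (simp add: sets.finite_UN)
      show "AE x in lborel. \<exists>u\<in>U. sgn x \<in> facet_cone U h u"
        unfolding sgn_facet_cone by (rule facet_cone_AE) (rule AE_lborel_hyperplane, assumption, rule AE_lborel_singleton)
    qed
    moreover have "AE x in (sphere_lebesgue :: 'a measure). norm x = 1"
      by (rule AE_I2) (simp add: sphere_lebesgue_def space_scale_measure space_restrict_space)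
    ultimately show "AE x in sphere_lebesgue.
       ennreal ((x \<bullet> outer_unit_normal P (radial P x *\<^sub>R x)) powr (- p) * radial P x powr (real m - p) *
                dual_radon m (\<lambda>\<xi>. subspace_volume \<xi> (P \<inter> \<xi>) ^ ?n) x) *
       indicator (reverse_radial_gauss_image P \<eta>) x =
       (\<Sum>u\<in>U. indicator \<eta> u * (ennreal (h u powr (- p) * c3) * W u x))"
    proof eventually_elim
      case (elim x)
      then obtain u where u: "u \<in> U" "x \<in> facet_cone U h u" and x: "norm x = 1" by blast
      have xu: "0 < x \<bullet> u" using u(2) by (simp add: facet_cone_def)
      note D = ennreal_dual_radon[OF m x]
      have "(\<Sum>w\<in>U. indicator \<eta> w * (ennreal (h w powr (- p) * c3) * W w x)) =
         (\<Sum>w\<in>U. if w = u then indicator \<eta> u * (ennreal (h u powr (- p) * c3) * W u x) else 0)"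
      proof (rule sum.cong[OF refl])
        fix w assume w: "w \<in> U"
        have "x \<notin> facet_cone U h w" if "w \<noteq> u" using facet_cone_disjoint[OF w u(1) _ u(2)] that by blast
        then show "indicator \<eta> w * (ennreal (h w powr (- p) * c3) * W w x) = (if w = u then indicator \<eta> u * (ennreal (h u powr (- p) * c3) * W u x) else 0)"
          by (auto simp: W_def)
      qed
      also have "\<dots> = indicator \<eta> u * (ennreal (h u powr (- p) * c3) * W u x)" using u(1) finite_U by simp
      also have "\<dots> = indicator \<eta> u * (ennreal (h u powr (- p)) * ennreal ((h u / (x \<bullet> u)) ^ m) * (ennreal c3 * Q x))"
        using u(2) xu c3 by (simp add: W_def R_def ennreal_mult mult_ac)
      also have "ennreal c3 * Q x = ennreal (dual_radon m (\<lambda>\<xi>. subspace_volume \<xi> (P \<inter> \<xi>) ^ ?n) x)"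
        unfolding D(2) c3_def Q_def c_def ..
      also have "ennreal (h u powr (- p)) * ennreal ((h u / (x \<bullet> u)) ^ m) = ennreal (h u powr (- p) * (h u / (x \<bullet> u)) ^ m)"
        using xu hpos[OF u(1)] by (simp add: ennreal_mult)
      also have "h u powr (- p) * (h u / (x \<bullet> u)) ^ m = (x \<bullet> u) powr (- p) * (h u / (x \<bullet> u)) powr (real m - p)"
        by (rule curvature_weight[OF xu hpos[OF u(1)], symmetric])
      also have "ennreal \<dots> * ennreal (dual_radon m (\<lambda>\<xi>. subspace_volume \<xi> (P \<inter> \<xi>) ^ ?n) x) =
          ennreal ((x \<bullet> u) powr (- p) * (h u / (x \<bullet> u)) powr (real m - p) * dual_radon m (\<lambda>\<xi>. subspace_volume \<xi> (P \<inter> \<xi>) ^ ?n) x)"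
        using D(1) by (simp add: ennreal_mult)
      also have "indicator \<eta> u * \<dots> = \<dots> * indicator (reverse_radial_gauss_image P \<eta>) x"
        using reverse_image_cone[OF u x] by (simp add: indicator_def)
      finally show ?case unfolding outer_normal_cone[OF u] unfolding radial_cone[OF u] by simp
    qed
  qed
  also have "\<dots> = of_nat DIM('a) * ennreal (unit_ball_vol (real DIM('a))) *
      (\<integral>\<^sup>+x. (\<Sum>u\<in>U. indicator \<eta> u * (ennreal (h u powr (- p) * c3) * W u (sgn x))) \<partial>unif_ball)"
    by (rule nn_integral_sphere_lebesgue) (use mW in measurable)
  also have "(\<integral>\<^sup>+x. (\<Sum>u\<in>U. indicator \<eta> u * (ennreal (h u powr (- p) * c3) * W u (sgn x))) \<partial>unif_ball) =
      (\<Sum>u\<in>U. indicator \<eta> u * (ennreal (h u powr (- p) * c3) * (\<integral>\<^sup>+x. W u (sgn x) \<partial>unif_ball)))"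
  proof -
    have mWs: "(\<lambda>x. W u (sgn x)) \<in> borel_measurable unif_ball" for u using measurable_compose[OF borel_measurable_sgn mW] by simp
    show ?thesis
      by (subst nn_integral_sum) (use mWs in \<open>auto simp: nn_integral_cmult intro!: borel_measurable_times_ennreal\<close>)
  qed
  also have "of_nat DIM('a) * ennreal (unit_ball_vol (real DIM('a))) * \<dots> =
    (\<Sum>u\<in>U. indicator \<eta> u * (ennreal (curvature_const TYPE('a) m * h u powr (- p)) * facet_flux m U h u))"
    unfolding sum_distrib_left
  proof (rule sum.cong[OF refl])
    fix u assume u: "u \<in> U"
    let ?I = "\<integral>\<^sup>+x. W u (sgn x) \<partial>unif_ball"
    have f: "facet_flux m U h u = ennreal c * ?I"
      using facet_flux_sphere[OF m u] unfolding c(2) W_def R_def Q_def by simp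
    define b where "b = unit_ball_vol (real DIM('a))"
    have b: "0 < b" by (simp add: b_def)
    \<comment> \<open>The total mass of the sphere, \<open>DIM('a) * b\<close>, cancels the
      denominator of the dual Radon constant.\<close>
    have "real DIM('a) * b * c3 = curvature_const TYPE('a) m * c"
      using b c(1) by (simp add: c3_def curvature_const_def c_def[symmetric] b_def[symmetric])
    then have e: "real DIM('a) * b * (h u powr (- p) * c3) = curvature_const TYPE('a) m * h u powr (- p) * c"
      by (simp add: mult_ac)
    have "of_nat DIM('a) * ennreal b * (indicator \<eta> u * (ennreal (h u powr (- p) * c3) * ?I)) =
      indicator \<eta> u * (ennreal (real DIM('a) * b * (h u powr (- p) * c3)) * ?I)"
      using b c3 by (simp add: ennreal_mult ennreal_of_nat_eq_real_of_nat mult_ac)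
    also have "\<dots> = indicator \<eta> u * (ennreal (curvature_const TYPE('a) m * h u powr (- p)) * facet_flux m U h u)"
      unfolding e f using c(1) curvature_const_pos[OF m] by (simp add: ennreal_mult mult_ac)
    finally show "of_nat DIM('a) * ennreal (unit_ball_vol (real DIM('a))) * (indicator \<eta> u * (ennreal (h u powr (- p) * c3) * ?I)) =
       indicator \<eta> u * (ennreal (curvature_const TYPE('a) m * h u powr (- p)) * facet_flux m U h u)" by (simp add: b_def)
  qed
  finally show ?thesis .
qed

end

section \<open>The maximisation problem\<close>

lemma finite_convergent_subsequence:
  fixes f :: "nat \<Rightarrow> 'b \<Rightarrow> real"
  assumes "finite U" "\<And>u. u \<in> U \<Longrightarrow> bounded (range (\<lambda>l. f l u))"
  shows "\<exists>r g. strict_mono (r :: nat \<Rightarrow> nat) \<and> (\<forall>u\<in>U. (\<lambda>l. f (r l) u) \<longlonglongrightarrow> g u)"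
  using assms
proof (induction U)
  case empty
  then show ?case by (intro exI[of _ id]) (auto simp: strict_mono_def)
next
  case (insert u U)
  then obtain r g where r: "strict_mono (r :: nat \<Rightarrow> nat)" "\<And>w. w \<in> U \<Longrightarrow> (\<lambda>l. f (r l) w) \<longlonglongrightarrow> g w" by auto
  have "bounded (range (\<lambda>l. f (r l) u))"
    using insert.prems[of u] by (rule bounded_subset) auto
  then obtain y s where s: "strict_mono (s :: nat \<Rightarrow> nat)" "((\<lambda>l. f (r l) u) \<circ> s) \<longlonglongrightarrow> y"
    using bounded_imp_convergent_subsequence by blast
  have "(\<lambda>l. f ((r \<circ> s) l) w) \<longlonglongrightarrow> (g(u := y)) w" if "w \<in> insert u U" for w
  proof (cases "w = u")
    case True
    then show ?thesis using s(2) by (simp add: o_def)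
  next
    case False
    then have "w \<in> U" using that by simp
    from LIMSEQ_subseq_LIMSEQ[OF r(2)[OF this] s(1)] show ?thesis using False by (simp add: o_def)
  qed
  then show ?case using strict_mono_o[OF r(1) s(1)] by blast
qed

locale section_problem = facet_normals U for U :: "'a::euclidean_space set" +
  fixes m :: nat and p :: real and \<alpha> :: "'a \<Rightarrow> real"
  assumes m: "1 \<le> m" "m \<le> DIM('a)" and p: "1 < p" and \<alpha>: "\<And>u. u \<in> U \<Longrightarrow> 0 < \<alpha> u"
begin

abbreviation vol :: "'a flag \<Rightarrow> ('a \<Rightarrow> real) \<Rightarrow> real" where
  "vol z h \<equiv> tube_vol (snd z) (poly_body U h)"

text \<open>By \<open>subspace_volume_tube_vol\<close> this is, up to a constant factor, the mean of the \<open>n\<close>-th powers of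
  the volumes of the \<open>m\<close>-dimensional sections.\<close>

definition Phi :: "('a \<Rightarrow> real) \<Rightarrow> real" where
  "Phi h = (\<integral>z. vol z h ^ DIM('a) \<partial>flag_haar m)"

definition Nm :: "('a \<Rightarrow> real) \<Rightarrow> real" where
  "Nm h = (\<Sum>u\<in>U. \<alpha> u * h u powr p)"

lemma prob_haar: "prob_space (flag_haar m :: 'a flag measure)"
  by (rule flag_haar_props(2)[OF m])

sublocale haar: prob_space "flag_haar m :: 'a flag measure"
  by (rule prob_haar)

lemma measurable_haar: "measurable (flag_haar m :: 'a flag measure) N = measurable borel N"
  by (rule measurable_cong_sets[OF flag_haar_props(1)[OF m] refl])

lemma AE_flag: "AE z in (flag_haar m :: 'a flag measure). flag m z"
  by (rule flag_haar_props(3)[OF m])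

lemma vol_bounded: "\<exists>B. \<forall>z. vol z h \<le> B"
proof -
  obtain r where "poly_body U h \<subseteq> cball 0 r" using poly_body_cball[of h] by blast
  from emeasure_slab_bounded(2)[OF this] show ?thesis by blast
qed

lemma emeasure_vol: "emeasure lborel (slab T (poly_body U h)) = ennreal (tube_vol T (poly_body U h))"
  using poly_body_cball[of h] emeasure_slab_bounded(1) by blast

lemma measurable_vol_power: "(\<lambda>z. vol z h ^ k) \<in> borel_measurable (flag_haar m)"
  unfolding measurable_haar by (rule measurable_tube_vol_snd[OF poly_body_borel])

lemma integrable_vol: "integrable (flag_haar m) (\<lambda>z. vol z h ^ k)"
proof -
  obtain B where "\<And>z. vol z h \<le> B" using vol_bounded[of h] by blast
  then show ?thesis
    by (intro haar.integrable_const_bound[where B="B ^ k"] AE_I2 measurable_vol_power) (simp add: power_mono)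
qed

lemma poly_body_mono: "(\<And>u. u \<in> U \<Longrightarrow> h u \<le> h' u) \<Longrightarrow> poly_body U h \<subseteq> poly_body U h'"
  by (force simp: poly_body_def)

lemma tube_vol_mono:
  assumes "L \<subseteq> poly_body U h" "L \<in> sets borel"
  shows "tube_vol T L \<le> tube_vol T (poly_body U h)"
  unfolding tube_vol_def
proof (rule measure_mono_fmeasurable)
  show "slab T L \<subseteq> slab T (poly_body U h)" by (rule slab_mono[OF assms(1)])
  show "slab T L \<in> sets lborel" using measurable_slab[OF assms(2)] by simp
  show "slab T (poly_body U h) \<in> fmeasurable lborel"
    using measurable_slab[OF poly_body_borel] emeasure_vol[of T h] by (intro fmeasurableI) (auto simp: less_top)
qed

lemma vol_mono: "(\<And>u. u \<in> U \<Longrightarrow> h u \<le> h' u) \<Longrightarrow> vol z h \<le> vol z h'"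
  by (intro tube_vol_mono poly_body_mono poly_body_borel)

lemma Phi_mono: "(\<And>u. u \<in> U \<Longrightarrow> h u \<le> h' u) \<Longrightarrow> Phi h \<le> Phi h'"
  unfolding Phi_def by (intro integral_mono integrable_vol power_mono vol_mono) auto

lemma tube_vol_scale:
  assumes T: "is_proj m T" and L: "L \<in> sets borel" and s: "s > 0"
  shows "tube_vol T {x. x /\<^sub>R s \<in> L} = s ^ m * tube_vol T L"
  unfolding tube_vol_def measure_def emeasure_slab_scale[OF T L s] using s by (simp add: enn2real_mult)

lemma poly_body_scale: "s > 0 \<Longrightarrow> poly_body U (\<lambda>u. s * h u) = {x. x /\<^sub>R s \<in> poly_body U h}"
  by (auto simp: poly_body_def field_simps)

lemma vol_scale: "flag m z \<Longrightarrow> s > 0 \<Longrightarrow> vol z (\<lambda>u. s * h u) = s ^ m * vol z h"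
  unfolding poly_body_scale by (rule tube_vol_scale) (auto simp: flag_def poly_body_borel)

lemma Phi_scale:
  assumes s: "s > 0" shows "Phi (\<lambda>u. s * h u) = s ^ (m * DIM('a)) * Phi h"
proof -
  have "Phi (\<lambda>u. s * h u) = (\<integral>z. s ^ (m * DIM('a)) * vol z h ^ DIM('a) \<partial>flag_haar m)"
    unfolding Phi_def
  proof (rule integral_cong_AE)
    show "AE z in flag_haar m. vol z (\<lambda>u. s * h u) ^ DIM('a) = s ^ (m * DIM('a)) * vol z h ^ DIM('a)"
      using AE_flag by eventually_elim (simp add: vol_scale[OF _ s] power_mult_distrib power_mult)
  qed (use measurable_vol_power in measurable)
  then show ?thesis by (simp add: Phi_def)
qed

lemma Phi_nonneg: "0 \<le> Phi h"
  unfolding Phi_def by (intro Bochner_Integration.integral_nonneg) simp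

text \<open>The bodies decrease to \<open>poly_body U h\<close>, so each tube volume converges from
  above, dominated by its first value.\<close>

lemma Phi_right_continuous: "(\<lambda>k. Phi (\<lambda>u. h u + 1 / real (Suc k))) \<longlonglongrightarrow> Phi h"
proof -
  obtain B where B: "\<And>z. vol z (\<lambda>u. h u + 1) \<le> B" using vol_bounded by blast
  have conv: "(\<lambda>k. vol z (\<lambda>u. h u + 1 / real (Suc k))) \<longlonglongrightarrow> vol z h" for z
  proof -
    let ?A = "\<lambda>k. slab (snd z) (poly_body U (\<lambda>u. h u + 1 / real (Suc k)))"
    have "(\<lambda>k. measure lborel (?A k)) \<longlonglongrightarrow> measure lborel (\<Inter>k. ?A k)"
    proof (rule Lim_measure_decseq)
      show "range ?A \<subseteq> sets lborel" using measurable_slab[OF poly_body_borel] by auto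
      show "decseq ?A"
      proof (rule decseq_SucI)
        fix k show "?A (Suc k) \<subseteq> ?A k"
          by (intro slab_mono poly_body_mono) (simp add: frac_le)
      qed
      show "emeasure lborel (?A k) \<noteq> \<infinity>" for k unfolding emeasure_vol by simp
    qed
    moreover have "(\<Inter>k. ?A k) = slab (snd z) (poly_body U h)"
    proof -
      have "x \<in> poly_body U h" if x: "\<And>k. x \<in> poly_body U (\<lambda>u. h u + 1 / real (Suc k))" for x
        unfolding poly_body_def
      proof safe
        fix u assume u: "u \<in> U"
        have "(\<lambda>k. h u + 1 / real (Suc k)) \<longlonglongrightarrow> h u + 0" by (intro tendsto_intros lim_1_over_n[THEN LIMSEQ_Suc])
        moreover have "\<forall>k\<ge>0. x \<bullet> u \<le> h u + 1 / real (Suc k)" using x u by (simp add: poly_body_def)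
        ultimately show "x \<bullet> u \<le> h u" using LIMSEQ_le_const by fastforce
      qed
      moreover have "poly_body U h \<subseteq> poly_body U (\<lambda>u. h u + 1 / real (Suc k))" for k by (rule poly_body_mono) simp
      ultimately show ?thesis by (auto simp: slab_def)
    qed
    ultimately show ?thesis by (simp add: tube_vol_def)
  qed
  show ?thesis unfolding Phi_def
  proof (rule integral_dominated_convergence)
    show "integrable (flag_haar m) (\<lambda>z :: 'a flag. B ^ DIM('a))" by simp
    show "AE z in flag_haar m. (\<lambda>k. vol z (\<lambda>u. h u + 1 / real (Suc k)) ^ DIM('a)) \<longlonglongrightarrow> vol z h ^ DIM('a)"
      by (intro AE_I2 tendsto_power conv)
    show "AE z in flag_haar m. norm (vol z (\<lambda>u. h u + 1 / real (Suc k)) ^ DIM('a)) \<le> B ^ DIM('a)" for k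
    proof (rule AE_I2)
      fix z :: "'a flag"
      have "vol z (\<lambda>u. h u + 1 / real (Suc k)) \<le> vol z (\<lambda>u. h u + 1)" by (rule vol_mono) (simp add: divide_le_eq)
      then have "vol z (\<lambda>u. h u + 1 / real (Suc k)) \<le> B" using B[of z] by simp
      then show "norm (vol z (\<lambda>u. h u + 1 / real (Suc k)) ^ DIM('a)) \<le> B ^ DIM('a)" by (simp add: power_mono)
    qed
  qed (rule measurable_vol_power)+
qed

text \<open>Monotonicity upgrades right continuity: eventually \<open>f l\<close> lies below
  \<open>h + 1 / Suc k\<close> on \<open>U\<close>. Upper semicontinuity is what a maximum
  requires.\<close>

lemma Phi_upper_semicontinuous:
  assumes "\<And>u. u \<in> U \<Longrightarrow> (\<lambda>l. f l u) \<longlonglongrightarrow> h u" "(\<lambda>l. Phi (f l)) \<longlonglongrightarrow> c"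
  shows "c \<le> Phi h"
proof (rule LIMSEQ_le_const[OF Phi_right_continuous], intro exI allI impI)
  fix k :: nat
  have "\<forall>\<^sub>F l in sequentially. \<forall>u\<in>U. f l u < h u + 1 / real (Suc k)"
    unfolding eventually_ball_finite_distrib[OF finite_U]
    by (intro ballI order_tendstoD(2)[OF assms(1)]) simp_all
  then have "\<forall>\<^sub>F l in sequentially. Phi (f l) \<le> Phi (\<lambda>u. h u + 1 / real (Suc k))"
    by eventually_elim (rule Phi_mono, simp add: less_imp_le)
  then show "c \<le> Phi (\<lambda>u. h u + 1 / real (Suc k))" by (rule tendsto_upperbound[OF assms(2)]) simp
qed

lemma Phi_pos:
  assumes r: "r > 0" shows "0 < Phi (\<lambda>u. r)"
proof (rule ccontr)
  assume "\<not> 0 < Phi (\<lambda>u. r)"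
  then have "(\<integral>z. vol z (\<lambda>u. r) ^ DIM('a) \<partial>flag_haar m) = 0" using Phi_nonneg[of "\<lambda>u. r"] unfolding Phi_def by linarith
  then have "AE z in flag_haar m. vol z (\<lambda>u. r) ^ DIM('a) = 0"
    by (subst (asm) integral_nonneg_eq_0_iff_AE) (auto intro!: integrable_vol)
  then have "AE z in (flag_haar m :: 'a flag measure). False"
    using AE_flag
  proof eventually_elim
    case (elim z)
    then have T: "is_proj m (snd z)" by (simp add: flag_def)
    have "{x. x /\<^sub>R r \<in> cball 0 1} \<subseteq> poly_body U (\<lambda>u. r)"
    proof safe
      fix x :: 'a assume "x /\<^sub>R r \<in> cball 0 1"
      then have "norm x \<le> r" using r by (simp add: field_simps)
      then have "x \<bullet> u \<le> r" if "u \<in> U" for u using norm_cauchy_schwarz[of x u] unit[OF that] by simp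
      then show "x \<in> poly_body U (\<lambda>u. r)" by (simp add: poly_body_def)
    qed
    moreover have "{x :: 'a. x /\<^sub>R r \<in> cball 0 1} = cball 0 r" using r by (auto simp: field_simps)
    ultimately have "tube_vol (snd z) {x. x /\<^sub>R r \<in> cball 0 1} \<le> vol z (\<lambda>u. r)"
      by (intro tube_vol_mono) auto
    moreover have "0 < tube_vol (snd z) (cball 0 1)"
      using slab_cball_pos[OF T] emeasure_slab_cball_finite[of "snd z" 1]
      by (simp add: tube_vol_def measure_def enn2real_positive_iff)
    ultimately have "0 < vol z (\<lambda>u. r)"
      using tube_vol_scale[OF T _ r, of "cball 0 1"] r by (simp add: less_le_trans[rotated])
    then show False using elim by simp
  qed
  then show False using haar.AE_False by simp
qed

lemma Nm_scale: "s > 0 \<Longrightarrow> (\<And>u. u \<in> U \<Longrightarrow> 0 \<le> h u) \<Longrightarrow> Nm (\<lambda>u. s * h u) = s powr p * Nm h"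
  unfolding Nm_def sum_distrib_left by (intro sum.cong) (auto simp: powr_mult)

lemma Nm_nonneg: "0 \<le> Nm h"
  unfolding Nm_def using \<alpha> by (intro sum_nonneg mult_nonneg_nonneg) (auto intro: less_imp_le)

lemma U_nonempty: "U \<noteq> {}"
proof -
  obtain b :: 'a where "b \<in> Basis" using nonempty_Basis by blast
  then have "b \<noteq> 0" using nonzero_Basis by blast
  then show ?thesis using positive by blast
qed

lemma feasible_bound:
  assumes "\<And>u. u \<in> U \<Longrightarrow> 0 \<le> h u" "Nm h \<le> 1" "u \<in> U"
  shows "h u \<le> (1 / \<alpha> u) powr (1 / p)"
proof -
  have "\<alpha> u * h u powr p \<le> Nm h" unfolding Nm_def
    using \<alpha> assms(3) finite_U by (intro member_le_sum) (auto intro!: mult_nonneg_nonneg simp: less_imp_le)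
  then have "h u powr p \<le> 1 / \<alpha> u" using assms(2) \<alpha>[OF assms(3)] by (simp add: field_simps)
  then have "(h u powr p) powr (1 / p) \<le> (1 / \<alpha> u) powr (1 / p)" using p by (intro powr_mono2) auto
  then show ?thesis using assms(1)[OF assms(3)] p by (simp add: powr_powr)
qed

text \<open>Positivity of \<open>\<alpha> u\<close> bounds every \<open>h u\<close> on the
  constraint set, so a maximising sequence has a coordinatewise convergent subsequence. Closedness
  under limits is the reason for \<open>0 \<le> h u\<close>, which admits facets through the
  origin.\<close>

lemma maximiser_exists:
  "\<exists>h. (\<forall>u\<in>U. 0 \<le> h u) \<and> Nm h \<le> 1 \<and> (\<forall>h'. (\<forall>u\<in>U. 0 \<le> h' u) \<longrightarrow> Nm h' \<le> 1 \<longrightarrow> Phi h' \<le> Phi h)"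
proof -
  define F where "F = {h. (\<forall>u\<in>U. 0 \<le> h u) \<and> Nm h \<le> 1}"
  define B where "B = Max ((\<lambda>u. (1 / \<alpha> u) powr (1 / p)) ` U)"
  have B: "h u \<le> B" if "h \<in> F" "u \<in> U" for h u
    using feasible_bound[of h u] that finite_U unfolding F_def B_def
    by (auto intro: order_trans[OF _ Max_ge])
  have F0: "(\<lambda>u. 0) \<in> F" using p by (simp add: F_def Nm_def)
  have bdd: "bdd_above (Phi ` F)"
  proof (rule bdd_aboveI2)
    fix h assume "h \<in> F" then show "Phi h \<le> Phi (\<lambda>u. B)" using B by (intro Phi_mono) auto
  qed
  define S where "S = Sup (Phi ` F)"
  have le: "Phi h \<le> S" if "h \<in> F" for h unfolding S_def using bdd that by (intro cSup_upper) auto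
  have "\<exists>h\<in>F. S - 1 / real (Suc l) < Phi h" for l
  proof -
    have "S - 1 / real (Suc l) < Sup (Phi ` F)" by (simp add: S_def)
    then show ?thesis using F0 bdd by (subst (asm) less_cSup_iff) auto
  qed
  then obtain f where f: "\<And>l. f l \<in> F" "\<And>l. S - 1 / real (Suc l) < Phi (f l)" by metis
  have "bounded (range (\<lambda>l. f l u))" if "u \<in> U" for u
  proof (rule boundedI)
    fix x assume "x \<in> range (\<lambda>l. f l u)"
    then obtain l where "x = f l u" by blast
    then show "norm x \<le> B" using f(1)[of l] B[OF f(1)[of l] that] that by (auto simp: F_def)
  qed
  then obtain r h where r: "strict_mono (r :: nat \<Rightarrow> nat)" "\<And>u. u \<in> U \<Longrightarrow> (\<lambda>l. f (r l) u) \<longlonglongrightarrow> h u"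
    using finite_convergent_subsequence[OF finite_U, of f] by blast
  have "(\<lambda>l. Phi (f l)) \<longlonglongrightarrow> S"
  proof (rule tendsto_sandwich)
    show "(\<lambda>l. S - 1 / real (Suc l)) \<longlonglongrightarrow> S"
      using tendsto_diff[OF tendsto_const[of S] lim_1_over_n[THEN LIMSEQ_Suc]] by simp
    show "(\<lambda>l. S) \<longlonglongrightarrow> S" by simp
  qed (use f le in \<open>auto intro!: always_eventually less_imp_le simp del: of_nat_Suc\<close>)
  then have lim: "(\<lambda>l. Phi (f (r l))) \<longlonglongrightarrow> S" using LIMSEQ_subseq_LIMSEQ[OF _ r(1)] by (simp add: o_def)
  have max: "S \<le> Phi h" by (rule Phi_upper_semicontinuous[OF r(2) lim])
  have h0: "0 \<le> h u" if "u \<in> U" for u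
    by (rule LIMSEQ_le_const[OF r(2)[OF that]]) (use f(1) that in \<open>auto simp: F_def\<close>)
  have "(\<lambda>l. Nm (f (r l))) \<longlonglongrightarrow> Nm h"
    unfolding Nm_def
    by (intro tendsto_sum tendsto_mult tendsto_const tendsto_powr' r(2)) (use p f(1) in \<open>auto simp: F_def\<close>)
  then have "Nm h \<le> 1" by (rule LIMSEQ_le_const2) (use f(1) in \<open>auto simp: F_def\<close>)
  then show ?thesis using h0 max le unfolding F_def by (intro exI[of _ h]) force
qed

text \<open>Quotient of the degrees of homogeneity, \<open>m * n\<close> for \<open>Phi\<close> and
  \<open>p\<close> for \<open>Nm\<close>.\<close>

definition ratio :: real where "ratio = real (m * DIM('a)) / p"

text \<open>Homogeneity turns the constrained maximum into an inequality for all \<open>h'\<close>,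
  which allows variations that leave the constraint set.\<close>

lemma optimal_exists:
  "\<exists>h. (\<forall>u\<in>U. 0 \<le> h u) \<and> Nm h = 1 \<and> 0 < Phi h \<and>
     (\<forall>h'. (\<forall>u\<in>U. 0 \<le> h' u) \<longrightarrow> 0 < Nm h' \<longrightarrow> Phi h' \<le> Phi h * Nm h' powr ratio)"
proof -
  obtain h where h: "\<And>u. u \<in> U \<Longrightarrow> 0 \<le> h u" "Nm h \<le> 1"
    and max: "\<And>h'. (\<forall>u\<in>U. 0 \<le> h' u) \<Longrightarrow> Nm h' \<le> 1 \<Longrightarrow> Phi h' \<le> Phi h"
    using maximiser_exists by blast
  have glob: "Phi h' \<le> Phi h * Nm h' powr ratio" if h': "\<forall>u\<in>U. 0 \<le> h' u" and N: "0 < Nm h'" for h'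
  proof -
    define s where "s = Nm h' powr (- 1 / p)"
    have s: "s > 0" using N by (simp add: s_def)
    have "Nm (\<lambda>u. s * h' u) = s powr p * Nm h'" using h' by (intro Nm_scale s) auto
    also have "s powr p = Nm h' powr (- 1 / p * p)" by (simp only: s_def powr_powr)
    also have "- 1 / p * p = - 1" using p by simp
    also have "Nm h' powr (- 1) = inverse (Nm h')" using N by (simp add: powr_minus)
    finally have "Nm (\<lambda>u. s * h' u) = 1" using N by simp
    then have "Phi (\<lambda>u. s * h' u) \<le> Phi h" using h' s by (intro max) auto
    then have le: "s ^ (m * DIM('a)) * Phi h' \<le> Phi h" by (simp only: Phi_scale[OF s])
    have "s ^ (m * DIM('a)) = s powr real (m * DIM('a))" using s by (simp only: powr_realpow)
    also have "\<dots> = Nm h' powr (- ratio)" by (simp add: s_def powr_powr ratio_def)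
    finally have "Nm h' powr (- ratio) * Phi h' \<le> Phi h" using le by simp
    then show ?thesis using N by (simp add: powr_minus field_simps)
  qed
  have pos: "0 < Phi h"
  proof -
    define N1 where "N1 = Nm (\<lambda>u. 1)"
    have "N1 > 0" unfolding N1_def Nm_def using U_nonempty \<alpha> finite_U by (intro sum_pos) auto
    moreover have "0 < Phi (\<lambda>u. 1)" by (rule Phi_pos) simp
    moreover have "Phi (\<lambda>u. 1) \<le> Phi h * N1 powr ratio" unfolding N1_def by (rule glob) (use \<open>N1 > 0\<close> in \<open>auto simp: N1_def\<close>)
    ultimately have "0 < Phi h * N1 powr ratio" by simp
    then show ?thesis using \<open>N1 > 0\<close> by (simp add: zero_less_mult_iff)
  qed
  have r: "ratio > 0" using m p by (simp add: ratio_def)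
  \<comment> \<open>If \<open>Nm h\<close> vanished, \<open>2 * h\<close> would still be admissible,
    while \<open>Phi\<close> would grow by the factor \<open>2 ^ (m * n)\<close>.\<close>
  have "Nm h > 0"
  proof (rule ccontr)
    assume "\<not> Nm h > 0"
    then have N0: "Nm h = 0" using Nm_nonneg[of h] by simp
    have "Nm (\<lambda>u. 2 * h u) = 0" using Nm_scale[of 2 h] h(1) N0 by simp
    then have "Phi (\<lambda>u. 2 * h u) \<le> Phi h" using h(1) by (intro max) auto
    then have "2 ^ (m * DIM('a)) * Phi h \<le> 1 * Phi h" using Phi_scale[of 2 h] by simp
    then have "(2 :: real) ^ (m * DIM('a)) \<le> 1" using pos by (simp only: mult_le_cancel_right_pos)
    moreover have "(1 :: real) < 2 ^ (m * DIM('a))" using m by (intro one_less_power) auto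
    ultimately show False by simp
  qed
  \<comment> \<open>The inequality \<open>glob\<close> is applied to \<open>h\<close>
    itself.\<close>
  moreover have "Nm h \<ge> 1"
  proof (rule ccontr)
    assume "\<not> Nm h \<ge> 1"
    then have "Nm h powr ratio < 1 powr ratio" using \<open>Nm h > 0\<close> r by (intro powr_less_mono2) auto
    then have "Phi h * Nm h powr ratio < Phi h" using pos by simp
    moreover have "Phi h \<le> Phi h * Nm h powr ratio" using glob h(1) \<open>Nm h > 0\<close> by blast
    ultimately show False by simp
  qed
  ultimately have "Nm h = 1" using h(2) by simp
  then show ?thesis using h(1) pos glob by blast
qed

end

section \<open>All support numbers of a maximiser are positive\<close>

lemma tube_vol_translate:
  fixes T :: "'a::euclidean_space \<Rightarrow>\<^sub>L 'a"
  assumes A: "A \<in> sets borel" and v: "T v = v"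
  shows "tube_vol T {x. x + v \<in> A} = tube_vol T A"
proof -
  have "slab T {x. x + v \<in> A} = {x. x + v \<in> slab T A}"
    by (auto simp: slab_def blinfun.add_right v)
  then show ?thesis using translate_lborel[OF measurable_slab[OF A], of v] by (simp add: tube_vol_def measure_def)
qed

text \<open>The derivative of \<open>x powr q\<close> at 1, sampled along \<open>s\<close> and
  weighted by \<open>w\<close>; it serves for the exponents \<open>ratio\<close>, \<open>p\<close>
  and \<open>m\<close>.\<close>

lemma tendsto_powr_difference:
  fixes s w :: "nat \<Rightarrow> real"
  assumes s: "s \<longlonglongrightarrow> 0" "\<And>l. 0 < s l" and w: "(\<lambda>l. w l * s l) \<longlonglongrightarrow> y"
  shows "(\<lambda>l. w l * ((1 + s l) powr q - 1)) \<longlonglongrightarrow> q * y"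
proof -
  have "((\<lambda>x :: real. (1 + x) powr q) has_real_derivative q) (at 0)"
    by (auto intro!: derivative_eq_intros)
  then have "((\<lambda>x. ((1 + x) powr q - 1) / x) \<longlongrightarrow> q) (at 0)"
    by (simp add: has_field_derivative_iff)
  moreover have "filterlim s (at 0) sequentially"
    using s by (intro filterlim_atI always_eventually) (auto simp: less_le)
  ultimately have "(\<lambda>l. ((1 + s l) powr q - 1) / s l) \<longlonglongrightarrow> q"
    by (rule filterlim_compose)
  from tendsto_mult[OF this w] have "(\<lambda>l. ((1 + s l) powr q - 1) / s l * (w l * s l)) \<longlonglongrightarrow> q * y" .
  moreover have "((1 + s l) powr q - 1) / s l * (w l * s l) = w l * ((1 + s l) powr q - 1)" for l
    using s(2)[of l] by (simp add: field_simps)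
  ultimately show ?thesis by simp
qed

text \<open>The first two binomial terms, which turn a gain of volume into a gain of its
  \<open>n\<close>-th power.\<close>

lemma power_add_ge:
  fixes a b :: real
  assumes "0 \<le> a" "0 \<le> b"
  shows "a ^ n + real n * a ^ (n - 1) * b \<le> (a + b) ^ n"
proof (induction n)
  case (Suc n)
  have "a ^ Suc n + real (Suc n) * a ^ n * b \<le> (a + b) * (a ^ n + real n * a ^ (n - 1) * b)"
  proof (cases n)
    case (Suc k)
    have "(a + b) * (a ^ n + real n * a ^ (n - 1) * b) = a ^ Suc n + real (Suc n) * a ^ n * b + real n * a ^ (n - 1) * b * b"
      by (simp add: Suc algebra_simps)
    moreover have "0 \<le> real n * a ^ (n - 1) * b * b" using assms by simp
    ultimately show ?thesis by linarith
  qed simp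
  also have "\<dots> \<le> (a + b) * (a + b) ^ n" using Suc assms by (intro mult_left_mono) auto
  finally show ?case by simp
qed simp

context section_problem
begin

lemma slab_finite: "L \<subseteq> poly_body U h \<Longrightarrow> L \<in> sets borel \<Longrightarrow> slab T L \<in> fmeasurable lborel"
  using emeasure_mono[OF slab_mono[of L "poly_body U h" T], of lborel] measurable_slab[of L T]
    measurable_slab[OF poly_body_borel, of T U h] emeasure_vol[of T h]
  by (intro fmeasurableI) (auto simp: less_top[symmetric] top_unique)

text \<open>If the origin lies on the facets with normals in \<open>{u. h u = 0}\<close>, pushing these facets outwards
  by \<open>t\<close> enlarges the section by at least a multiple of \<open>t\<close>: translates of the layer
  \<open>{x. x \<in> C, x + t v \<notin> C}\<close> of the cone \<open>C\<close> at the origin cover a small copy of the section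
  with about \<open>1 / t\<close> pieces.\<close>

lemma zero_facet_gain:
  fixes T :: "'a \<Rightarrow>\<^sub>L 'a"
  assumes T: "is_proj m T" and h: "\<And>u. u \<in> U \<Longrightarrow> 0 \<le> h u" and J: "\<exists>u\<in>U. h u = 0"
    and L: "0 < L" "\<And>w. w \<in> U \<Longrightarrow> h w \<noteq> 0 \<Longrightarrow> 4 * L \<le> h w"
    and Tu: "\<And>u. u \<in> U \<Longrightarrow> T u \<noteq> 0" and V: "0 < tube_vol T (poly_body U h)"
  shows "\<exists>c>0. \<forall>l. tube_vol T (poly_body U h) + c / real (Suc l) \<le>
     tube_vol T (poly_body U (\<lambda>u. h u + (if h u = 0 then L / real (Suc l) else 0)))"
proof -
  define Q where "Q = poly_body U h"
  obtain r where r: "0 < r" "Q \<subseteq> cball 0 r" using poly_body_cball[of h] unfolding Q_def by blast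
  have aeU: "AE x in lborel. \<forall>u\<in>U. T x \<bullet> u \<noteq> 0"
  proof (subst AE_finite_all[OF finite_U], intro ballI)
    fix u assume "u \<in> U"
    have "AE x in lborel. x \<bullet> T u \<noteq> 0" by (rule AE_lborel_hyperplane[OF Tu[OF \<open>u \<in> U\<close>]])
    then show "AE x in lborel. T x \<bullet> u \<noteq> 0" by (simp add: is_projD(2)[OF T])
  qed
  have aeQ: "\<not> (AE x in lborel. x \<notin> slab T Q)"
  proof
    assume "AE x in lborel. x \<notin> slab T Q"
    then have "slab T Q \<in> null_sets lborel"
      using AE_iff_null_sets[of "slab T Q" lborel] measurable_slab[OF poly_body_borel] by (simp add: Q_def)
    then have "tube_vol T Q = 0" by (simp add: tube_vol_def measure_def null_sets_def)
    then show False using V by (simp add: Q_def)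
  qed
  \<comment> \<open>The section has positive volume, so some point of it avoids the null set where
    \<open>T x \<bullet> u = 0\<close> for some \<open>u\<close>. It then lies strictly inside every
    half-space with \<open>h u = 0\<close>.\<close>
  have "\<exists>x. x \<in> slab T Q \<and> (\<forall>u\<in>U. T x \<bullet> u \<noteq> 0)"
  proof (rule ccontr)
    assume "\<not> ?thesis"
    then have "x \<notin> slab T Q" if "\<forall>u\<in>U. T x \<bullet> u \<noteq> 0" for x using that by blast
    with aeU have "AE x in lborel. x \<notin> slab T Q" by (rule eventually_mono)
    then show False using aeQ by contradiction
  qed
  then obtain y where y: "y \<in> slab T Q" "\<And>u. u \<in> U \<Longrightarrow> T y \<bullet> u \<noteq> 0" by blast
  define x0 where "x0 = T y"
  have x0: "x0 \<in> Q" "T x0 = x0" using y(1) by (auto simp: x0_def slab_def is_projD(1)[OF T])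
  have neg: "x0 \<bullet> u < 0" if "u \<in> U" "h u = 0" for u
    using x0(1) y(2)[OF that(1)] that by (fastforce simp: x0_def Q_def poly_body_def)
  \<comment> \<open>This scale gives \<open>v \<bullet> u \<le> 1\<close>, so a move by
    \<open>t v\<close> raises each inner product by at most \<open>t\<close>; the summand 1 keeps
    \<open>\<rho>\<close> positive. The vector \<open>v\<close> stays in the range of
    \<open>T\<close> and points outwards through all facets with \<open>h u = 0\<close>.\<close>
  define \<rho> where "\<rho> = (\<Sum>u\<in>U. \<bar>x0 \<bullet> u\<bar>) + 1"
  have \<rho>: "0 < \<rho>" unfolding \<rho>_def by (intro add_nonneg_pos sum_nonneg) auto
  define v where "v = - (x0 /\<^sub>R \<rho>)"
  have Tv: "T v = v" by (simp add: v_def blinfun.minus_right blinfun.scaleR_right x0)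
  have vu: "v \<bullet> u \<le> 1" if "u \<in> U" for u
  proof -
    have "\<bar>x0 \<bullet> u\<bar> \<le> (\<Sum>u\<in>U. \<bar>x0 \<bullet> u\<bar>)" using that finite_U by (intro member_le_sum) auto
    then have "- (x0 \<bullet> u) \<le> \<rho>" by (simp add: \<rho>_def)
    then show ?thesis using \<rho> by (simp add: v_def field_simps)
  qed
  have vpos: "0 < v \<bullet> u" if "u \<in> U" "h u = 0" for u
    using neg[OF that] \<rho> by (simp add: v_def field_simps)
  obtain u0 where u0: "u0 \<in> U" "h u0 = 0" using J by blast
  define \<beta> where "\<beta> = v \<bullet> u0"
  have \<beta>: "0 < \<beta>" using vpos[OF u0] by (simp add: \<beta>_def)
  \<comment> \<open>\<open>\<eta> \<le> 1/4\<close> leaves room for a shift of total length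
    \<open>L \<le> h w / 4\<close> inside the half-size body. The other bound ensures that the full
    shift \<open>L v\<close> pushes every point of the small copy out of \<open>C\<close>.\<close>
  define \<eta> where "\<eta> = min (1/4) (L * \<beta> / (2 * r))"
  have \<eta>: "0 < \<eta>" "\<eta> \<le> 1/4" using L \<beta> r by (auto simp: \<eta>_def)
  have \<eta>r: "\<eta> * r < L * \<beta>"
  proof -
    have "\<eta> \<le> L * \<beta> / (2 * r)" by (simp add: \<eta>_def)
    then have "\<eta> * r \<le> L * \<beta> / 2" using r(1) by (simp add: field_simps)
    moreover have "0 < L * \<beta>" using L \<beta> by simp
    ultimately show ?thesis by linarith
  qed
  define C where "C = {x. \<forall>u\<in>U. h u = 0 \<longrightarrow> x \<bullet> u \<le> 0}"
  have "C = poly_body {u \<in> U. h u = 0} (\<lambda>u. 0)" by (auto simp: C_def poly_body_def)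
  then have mC: "C \<in> sets borel" by (simp add: poly_body_borel)
  define Rh where "Rh = poly_body U (\<lambda>u. h u / 2)"
  define Rs where "Rs = poly_body U (\<lambda>u. \<eta> * h u)"
  have volRs: "tube_vol T Rs = \<eta> ^ m * tube_vol T Q"
    unfolding Rs_def Q_def poly_body_scale[OF \<eta>(1)] by (rule tube_vol_scale[OF T poly_body_borel \<eta>(1)])
  have "tube_vol T Q + (\<eta> ^ m * tube_vol T Q) / real (Suc l) \<le>
     tube_vol T (poly_body U (\<lambda>u. h u + (if h u = 0 then L / real (Suc l) else 0)))" for l
  proof -
    define N where "N = Suc l"
    define t where "t = L / real N"
    have t: "0 < t" "real N * t = L" "t \<le> L" using L by (auto simp: t_def N_def field_simps)
    have mtr: "{x. x + w \<in> A} \<in> sets borel" if "A \<in> sets borel" for A :: "'a set" and w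
      using measurable_sets[of "\<lambda>x. x + w" borel borel A] that by (simp add: vimage_def)
    \<comment> \<open>\<open>D\<close> is the layer of the half-size body that leaves
      \<open>C\<close> in one step of length \<open>t\<close>; \<open>E k\<close> consists of the
      points of the small copy that are in \<open>C\<close> after \<open>k\<close> steps and outside
      after one more.\<close>
    define D where "D = {x \<in> Rh. x + t *\<^sub>R v \<notin> C}"
    have "D = Rh - {x. x + t *\<^sub>R v \<in> C}" by (auto simp: D_def)
    then have mD: "D \<in> sets borel" using mtr[OF mC] by (simp add: Rh_def poly_body_borel)
    have DRh: "D \<subseteq> poly_body U (\<lambda>u. h u / 2)" by (auto simp: D_def Rh_def)
    define E where "E k = {x \<in> Rs. x + (real k * t) *\<^sub>R v \<in> C \<and> x + (real (Suc k) * t) *\<^sub>R v \<notin> C}" for k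
    have "E k = (Rs \<inter> {x. x + (real k * t) *\<^sub>R v \<in> C}) - {x. x + (real (Suc k) * t) *\<^sub>R v \<in> C}" for k
      by (auto simp: E_def)
    then have mE: "E k \<in> sets borel" for k using mtr[OF mC] by (simp add: Rs_def poly_body_borel)
    have cover: "Rs \<subseteq> (\<Union>k<N. E k)"
    proof
      fix x assume x: "x \<in> Rs"
      have xC: "x + (real 0 * t) *\<^sub>R v \<in> C" using x by (auto simp: C_def Rs_def poly_body_def)
      have "x /\<^sub>R \<eta> \<in> Q" using x unfolding Rs_def Q_def poly_body_scale[OF \<eta>(1)] by simp
      then have "norm x \<le> \<eta> * r" using r(2) \<eta>(1) by (force simp: field_simps)
      then have "- (\<eta> * r) \<le> x \<bullet> u0" using Cauchy_Schwarz_ineq2[of x u0] unit[OF u0(1)] by simp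
      moreover have "(x + (real N * t) *\<^sub>R v) \<bullet> u0 = x \<bullet> u0 + L * \<beta>" by (simp add: inner_add_left t(2) \<beta>_def)
      ultimately have "0 < (x + (real N * t) *\<^sub>R v) \<bullet> u0" using \<eta>r by simp
      then have NC: "x + (real N * t) *\<^sub>R v \<notin> C" using u0 by (auto simp: C_def not_le)
      define j where "j = (LEAST j. x + (real j * t) *\<^sub>R v \<notin> C)"
      have j: "x + (real j * t) *\<^sub>R v \<notin> C" "j \<le> N"
        unfolding j_def by (rule LeastI[of "\<lambda>j. x + (real j * t) *\<^sub>R v \<notin> C", OF NC], rule Least_le[of "\<lambda>j. x + (real j * t) *\<^sub>R v \<notin> C", OF NC])
      have "j \<noteq> 0"
      proof
        assume "j = 0"
        then show False using j(1) xC by simp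
      qed
      then obtain k where k: "j = Suc k" using not0_implies_Suc by blast
      have "x + (real k * t) *\<^sub>R v \<in> C"
        using not_less_Least[of k "\<lambda>j. x + (real j * t) *\<^sub>R v \<notin> C"] k unfolding j_def by simp
      then have "x \<in> E k" using x j(1) k by (simp add: E_def)
      then show "x \<in> (\<Union>k<N. E k)" using j(2) k by auto
    qed
    \<comment> \<open>After \<open>k\<close> steps \<open>E k\<close> lies in \<open>D\<close>. So
      each of the \<open>N\<close> pieces has at most the volume of \<open>D\<close>, and
      \<open>D\<close> has at least \<open>1 / N\<close> of the volume of the small copy.\<close>
    have Esub: "E k \<subseteq> {x. x + (real k * t) *\<^sub>R v \<in> D}" if k: "k < N" for k
    proof
      fix x assume x: "x \<in> E k"
      define x' where "x' = x + (real k * t) *\<^sub>R v"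
      have x'C: "x' \<in> C" and x'': "x' + t *\<^sub>R v \<notin> C" using x by (auto simp: E_def x'_def algebra_simps)
      have kt: "0 \<le> real k * t" "real k * t \<le> L"
        using t k mult_right_mono[of "real k" "real N" t] by auto
      have "x' \<bullet> w \<le> h w / 2" if w: "w \<in> U" for w
      proof (cases "h w = 0")
        case True
        then show ?thesis using x'C w by (auto simp: C_def)
      next
        case False
        have "x \<bullet> w \<le> \<eta> * h w" using x w by (simp add: E_def Rs_def poly_body_def)
        also have "\<dots> \<le> 1/4 * h w" using \<eta>(2) h[OF w] by (intro mult_right_mono) auto
        finally have "x \<bullet> w \<le> h w / 4" by simp
        moreover have "(real k * t) * (v \<bullet> w) \<le> (real k * t) * 1" using vu[OF w] kt by (intro mult_left_mono) auto
        then have "(real k * t) * (v \<bullet> w) \<le> L" using kt by simp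
        ultimately show ?thesis using L(2)[OF w False] by (simp add: x'_def inner_add_left)
      qed
      then show "x \<in> {x. x + (real k * t) *\<^sub>R v \<in> D}" using x'' by (simp add: D_def Rh_def poly_body_def x'_def)
    qed
    have volE: "tube_vol T (E k) \<le> tube_vol T D" if k: "k < N" for k
    proof -
      have Tkv: "T ((real k * t) *\<^sub>R v) = (real k * t) *\<^sub>R v" by (simp add: blinfun.scaleR_right Tv)
      have e: "tube_vol T {x. x + (real k * t) *\<^sub>R v \<in> D} = tube_vol T D" by (rule tube_vol_translate[of D T, OF mD Tkv])
      have "slab T {x. x + (real k * t) *\<^sub>R v \<in> D} = {x. x + (real k * t) *\<^sub>R v \<in> slab T D}"
        by (auto simp: slab_def blinfun.add_right Tkv)
      then have "emeasure lborel (slab T {x. x + (real k * t) *\<^sub>R v \<in> D}) = emeasure lborel (slab T D)"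
        using translate_lborel[OF measurable_slab[OF mD]] by simp
      also have "\<dots> < top" using slab_finite[OF DRh mD] by (simp add: fmeasurable_def)
      finally have fin: "slab T {x. x + (real k * t) *\<^sub>R v \<in> D} \<in> fmeasurable lborel"
        using measurable_slab[OF mtr[OF mD]] by (intro fmeasurableI) auto
      have "tube_vol T (E k) \<le> tube_vol T {x. x + (real k * t) *\<^sub>R v \<in> D}"
        unfolding tube_vol_def using measurable_slab[OF mE]
        by (intro measure_mono_fmeasurable[OF slab_mono[OF Esub[OF k]] _ fin]) simp
      then show ?thesis using e by simp
    qed
    have Efin: "slab T (E k) \<in> fmeasurable lborel" for k
      by (rule slab_finite[of _ "\<lambda>u. \<eta> * h u", OF _ mE]) (auto simp: E_def Rs_def)
    have "tube_vol T Rs \<le> measure lborel (\<Union>k<N. slab T (E k))"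
      unfolding tube_vol_def
    proof (rule measure_mono_fmeasurable)
      show "slab T Rs \<subseteq> (\<Union>k<N. slab T (E k))" using cover by (auto simp: slab_def)
      show "slab T Rs \<in> sets lborel" using measurable_slab[OF poly_body_borel] by (simp add: Rs_def)
      show "(\<Union>k<N. slab T (E k)) \<in> fmeasurable lborel" using Efin by (intro fmeasurable.finite_UN) auto
    qed
    also have "\<dots> \<le> (\<Sum>k<N. measure lborel (slab T (E k)))"
      using measurable_slab[OF mE] by (intro measure_UNION_le) auto
    also have "\<dots> \<le> (\<Sum>k<N. tube_vol T D)" by (intro sum_mono) (use volE in \<open>auto simp: tube_vol_def\<close>)
    finally have "\<eta> ^ m * tube_vol T Q \<le> real N * tube_vol T D" using volRs by simp
    then have D_ge: "\<eta> ^ m * tube_vol T Q / real N \<le> tube_vol T D" by (simp add: N_def field_simps)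
    \<comment> \<open>One step further the layer is outside \<open>C\<close>, hence disjoint from
      the old section, but still inside the enlarged body.\<close>
    define D' where "D' = {x. x + (- (t *\<^sub>R v)) \<in> D}"
    have mD': "D' \<in> sets borel" unfolding D'_def by (rule mtr[OF mD])
    have volD': "tube_vol T D' = tube_vol T D" unfolding D'_def
      by (rule tube_vol_translate[OF mD]) (simp add: blinfun.minus_right blinfun.scaleR_right Tv)
    define ht where "ht u = h u + (if h u = 0 then L / real (Suc l) else 0)" for u
    have sub1: "Q \<subseteq> poly_body U ht" unfolding Q_def using L by (intro poly_body_mono) (simp add: ht_def)
    have sub2: "D' \<subseteq> poly_body U ht"
      unfolding poly_body_def
    proof safe
      fix x u assume x: "x \<in> D'" and u: "u \<in> U"
      have "(x - t *\<^sub>R v) \<bullet> u \<le> h u / 2" using x u by (auto simp: D'_def D_def Rh_def poly_body_def)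
      moreover have "t * (v \<bullet> u) \<le> t * 1" using vu[OF u] t by (intro mult_left_mono) auto
      ultimately have le: "x \<bullet> u \<le> h u / 2 + t" by (simp add: inner_diff_left)
      show "x \<bullet> u \<le> ht u"
      proof (cases "h u = 0")
        case True
        then show ?thesis using le by (simp add: ht_def t_def N_def)
      next
        case False
        then show ?thesis using le L(2)[OF u False] t(3) L(1) by (simp add: ht_def)
      qed
    qed
    have disj: "slab T Q \<inter> slab T D' = {}"
    proof -
      have "Q \<subseteq> C" by (auto simp: Q_def poly_body_def C_def)
      moreover have "D' \<inter> C = {}" by (auto simp: D'_def D_def)
      ultimately show ?thesis by (auto simp: slab_def)
    qed
    have "tube_vol T Q + tube_vol T D' = measure lborel (slab T Q \<union> slab T D')"
      unfolding tube_vol_def using disj slab_finite[OF sub2 mD'] slab_finite[OF sub1] poly_body_borel[of U h]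
      by (subst measure_Un3) (auto simp: Q_def)
    also have "\<dots> \<le> tube_vol T (poly_body U ht)"
      unfolding tube_vol_def
    proof (rule measure_mono_fmeasurable)
      show "slab T Q \<union> slab T D' \<subseteq> slab T (poly_body U ht)" using slab_mono[OF sub1] slab_mono[OF sub2] by blast
      show "slab T Q \<union> slab T D' \<in> sets lborel" using measurable_slab[OF mD'] measurable_slab[OF poly_body_borel] by (simp add: Q_def)
      show "slab T (poly_body U ht) \<in> fmeasurable lborel" by (rule slab_finite[OF order_refl poly_body_borel])
    qed
    finally have "tube_vol T Q + \<eta> ^ m * tube_vol T Q / real (Suc l) \<le> tube_vol T (poly_body U ht)"
      using D_ge volD' unfolding N_def by linarith
    then show ?thesis unfolding ht_def[abs_def] .
  qed
  moreover have "0 < \<eta> ^ m * tube_vol T Q" using \<eta> V by (simp add: Q_def)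
  ultimately show ?thesis unfolding Q_def by blast
qed

text \<open>The vector \<open>u\<close> of a flag satisfies
  \<open>u \<bullet> v = u \<bullet> T v\<close>, and being a uniform direction it is almost surely
  not orthogonal to \<open>v\<close>.\<close>

lemma AE_proj_apply_nonzero:
  assumes v: "v \<noteq> 0" shows "AE z in flag_haar m. blinfun_apply (snd z) v \<noteq> (0 :: 'a)"
proof -
  have mset: "{z :: 'a flag. fst z \<bullet> v = 0} \<in> sets borel" by measurable
  have "(\<integral>\<^sup>+z. indicator {z. fst z \<bullet> v = 0} z \<partial>(flag_haar m :: 'a flag measure)) =
    (\<integral>\<^sup>+x. (\<integral>\<^sup>+z. indicator {z. fst z \<bullet> v = 0} z \<partial>flags_at (sgn x) (m - 1)) \<partial>unif_ball)"
    by (rule flag_haar_props(5)[OF m]) (use mset in simp)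
  also have "\<dots> = (\<integral>\<^sup>+x. 0 \<partial>(unif_ball :: 'a measure))"
  proof (rule nn_integral_cong_AE)
    have "AE x in unif_ball. x \<noteq> (0::'a)" by (rule AE_unif_ball[OF AE_lborel_singleton])
    moreover have "AE x in unif_ball. x \<bullet> v \<noteq> 0" by (rule AE_unif_ball[OF AE_lborel_hyperplane[OF v]])
    ultimately show "AE x in unif_ball. (\<integral>\<^sup>+z. indicator {z. fst z \<bullet> v = 0} z \<partial>flags_at (sgn x) (m - 1)) = 0"
    proof eventually_elim
      case (elim x)
      have "Suc (m - 1) \<le> DIM('a)" using m by simp
      note F = flags_at_props[OF _ this, of "sgn x"]
      have s: "norm (sgn x) = 1" using elim by (simp add: norm_sgn)
      have "AE z in flags_at (sgn x) (m - 1). indicator {z. fst z \<bullet> v = 0} z = (0::ennreal)"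
        using F(3)[OF s] by eventually_elim (use elim in \<open>simp add: sgn_div_norm\<close>)
      then show ?case by (subst nn_integral_cong_AE[where v="\<lambda>_. 0"]) auto
    qed
  qed
  finally have "emeasure (flag_haar m) {z :: 'a flag. fst z \<bullet> v = 0} = 0"
    using mset flag_haar_props(1)[OF m] by simp
  then have "{z :: 'a flag. fst z \<bullet> v = 0} \<in> null_sets (flag_haar m)"
    using mset flag_haar_props(1)[OF m] by (simp add: null_sets_def)
  then have "AE z in flag_haar m. z \<notin> {z :: 'a flag. fst z \<bullet> v = 0}" by (rule AE_not_in)
  then show ?thesis using AE_flag
  proof eventually_elim
    case (elim z)
    have "fst z \<bullet> v = fst z \<bullet> snd z v" using elim(2) is_projD(2)[of m "snd z" "fst z" v] by (simp add: flag_def)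
    then show ?case using elim(1) by auto
  qed
qed

text \<open>Fatou's lemma for the difference quotients \<open>b\<close> of \<open>Phi\<close>: they
  tend to 0, as the constraint grows only like \<open>t powr p\<close>, whereas
  \<open>zero_facet_gain\<close> keeps the quotients of each generic section of positive volume away
  from 0. Almost all sections would then have volume 0.\<close>

lemma optimal_pos:
  assumes h: "\<And>u. u \<in> U \<Longrightarrow> 0 \<le> h u" and N: "Nm h = 1" and P: "0 < Phi h"
    and opt: "\<And>h'. (\<forall>u\<in>U. 0 \<le> h' u) \<Longrightarrow> 0 < Nm h' \<Longrightarrow> Phi h' \<le> Phi h * Nm h' powr ratio"
    and u: "u \<in> U"
  shows "0 < h u"
proof (rule ccontr)
  assume "\<not> 0 < h u"
  then have J: "\<exists>u\<in>U. h u = 0" using h[OF u] u by force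
  let ?n = "DIM('a)"
  \<comment> \<open>Inserting 1 covers the case that all \<open>h u\<close> vanish; the quarter is
    what \<open>zero_facet_gain\<close> asks for.\<close>
  define L where "L = Min (insert 1 (h ` {u \<in> U. h u \<noteq> 0})) / 4"
  have fin: "finite (insert 1 (h ` {u \<in> U. h u \<noteq> 0}))" using finite_U by simp
  have "0 < Min (insert 1 (h ` {u \<in> U. h u \<noteq> 0}))" using h fin by (subst Min_gr_iff) (auto simp: less_le)
  then have L0: "0 < L" by (simp add: L_def)
  have L: "4 * L \<le> h w" if "w \<in> U" "h w \<noteq> 0" for w using that fin by (auto simp: L_def)
  define t where "t l = L / real (Suc l)" for l
  have t: "0 < t l" for l using L0 by (simp add: t_def)
  define g where "g l u = h u + (if h u = 0 then t l else 0)" for l u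
  define a where "a = (\<Sum>u\<in>{u \<in> U. h u = 0}. \<alpha> u)"
  have a: "0 < a" unfolding a_def using finite_U J \<alpha> by (intro sum_pos) auto
  have gN: "Nm (g l) = 1 + a * t l powr p" for l
  proof -
    have "Nm (g l) = (\<Sum>u\<in>U. \<alpha> u * h u powr p + (if h u = 0 then \<alpha> u * t l powr p else 0))"
      unfolding Nm_def g_def by (rule sum.cong) auto
    also have "\<dots> = Nm h + (\<Sum>u\<in>{u \<in> U. h u = 0}. \<alpha> u * t l powr p)"
      using finite_U by (simp add: sum.distrib Nm_def sum.inter_filter)
    finally show ?thesis by (simp add: N a_def sum_distrib_right)
  qed
  have opt': "Phi (g l) \<le> Phi h * (1 + a * t l powr p) powr ratio" for l
    using opt[of "g l"] h t[of l] a unfolding gN by (auto simp: g_def less_imp_le add_pos_nonneg)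
  define b where "b l = real (Suc l) * (Phi (g l) - Phi h)" for l
  have b0: "0 \<le> b l" for l unfolding b_def
    using t[of l] by (intro mult_nonneg_nonneg) (auto intro!: Phi_mono simp: g_def)
  have "b \<longlonglongrightarrow> 0"
  proof (rule tendsto_sandwich[of "\<lambda>_. 0"])
    have inf: "filterlim (\<lambda>l. real (Suc l)) at_top sequentially"
      by (rule filterlim_compose[OF filterlim_real_sequentially filterlim_Suc])
    have t0: "t \<longlonglongrightarrow> 0" unfolding t_def by (rule tendsto_divide_0[OF tendsto_const]) (rule filterlim_at_top_imp_at_infinity[OF inf])
    have "(\<lambda>l. t l powr p) \<longlonglongrightarrow> 0 powr p" using p t by (intro tendsto_powr'[OF t0 tendsto_const]) (auto intro!: always_eventually less_imp_le)
    then have s0: "(\<lambda>l. a * t l powr p) \<longlonglongrightarrow> 0" using tendsto_mult_right_zero by fastforce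
    \<comment> \<open>Here \<open>p > 1\<close> makes the exponent \<open>1 - p\<close>
      negative.\<close>
    have e: "real (Suc l) * (a * t l powr p) = a * L powr p * real (Suc l) powr (1 - p)" for l
      using L0 by (simp add: t_def powr_divide powr_diff del: of_nat_Suc)
    have "(\<lambda>l. real (Suc l) powr (1 - p)) \<longlonglongrightarrow> 0" using p by (intro tendsto_neg_powr inf) auto
    then have "(\<lambda>l. real (Suc l) * (a * t l powr p)) \<longlonglongrightarrow> 0" unfolding e by (rule tendsto_mult_right_zero)
    moreover have "0 < a * t l powr p" for l using a t[of l] by simp
    ultimately have "(\<lambda>l. real (Suc l) * ((1 + a * t l powr p) powr ratio - 1)) \<longlonglongrightarrow> ratio * 0"
      by (intro tendsto_powr_difference s0)
    then have "(\<lambda>l. Phi h * (real (Suc l) * ((1 + a * t l powr p) powr ratio - 1))) \<longlonglongrightarrow> Phi h * 0"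
      by (intro tendsto_mult_left) simp
    then show "(\<lambda>l. Phi h * (real (Suc l) * ((1 + a * t l powr p) powr ratio - 1))) \<longlonglongrightarrow> 0" by simp
    show "\<forall>\<^sub>F l in sequentially. b l \<le> Phi h * (real (Suc l) * ((1 + a * t l powr p) powr ratio - 1))"
    proof (intro always_eventually allI)
      fix l
      have "b l \<le> real (Suc l) * (Phi h * (1 + a * t l powr p) powr ratio - Phi h)"
        unfolding b_def using opt'[of l] by (intro mult_left_mono) auto
      then show "b l \<le> Phi h * (real (Suc l) * ((1 + a * t l powr p) powr ratio - 1))" by (simp add: algebra_simps)
    qed
  qed (use b0 in auto)
  then have "(\<lambda>l. ennreal (b l)) \<longlonglongrightarrow> ennreal 0" by (rule tendsto_ennrealI)
  then have lb: "liminf (\<lambda>l. ennreal (b l)) = 0" using lim_imp_Liminf[OF trivial_limit_sequentially] by fastforce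
  define G where "G l z = ennreal (real (Suc l) * (vol z (g l) ^ ?n - vol z h ^ ?n))" for l z
  have mono: "vol z h \<le> vol z (g l)" for l z using t[of l] by (intro vol_mono) (simp add: g_def)
  have mG: "G l \<in> borel_measurable (flag_haar m)" for l
    unfolding G_def using measurable_vol_power[of h ?n] measurable_vol_power[of "g l" ?n] by measurable
  have "(\<integral>\<^sup>+z. G l z \<partial>flag_haar m) = ennreal (b l)" for l
  proof -
    have i: "integrable (flag_haar m) (\<lambda>z. real (Suc l) * (vol z (g l) ^ ?n - vol z h ^ ?n))"
      by (intro integrable_mult_right Bochner_Integration.integrable_diff integrable_vol)
    have "(\<integral>\<^sup>+z. G l z \<partial>flag_haar m) = ennreal (\<integral>z. real (Suc l) * (vol z (g l) ^ ?n - vol z h ^ ?n) \<partial>flag_haar m)"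
      unfolding G_def using mono by (intro nn_integral_eq_integral i AE_I2 mult_nonneg_nonneg) (auto intro: power_mono)
    also have "(\<integral>z. real (Suc l) * (vol z (g l) ^ ?n - vol z h ^ ?n) \<partial>flag_haar m) = b l"
      unfolding b_def Phi_def using integrable_vol by simp
    finally show ?thesis .
  qed
  then have "(\<integral>\<^sup>+z. liminf (\<lambda>l. G l z) \<partial>flag_haar m) \<le> 0"
    using nn_integral_liminf[of G, OF mG] lb by simp
  then have "AE z in flag_haar m. liminf (\<lambda>l. G l z) = 0"
    using mG by (subst nn_integral_0_iff_AE[symmetric]) auto
  moreover have "AE z in flag_haar m. \<forall>u\<in>U. blinfun_apply (snd z) u \<noteq> (0::'a)"
    using unit by (subst AE_finite_all[OF finite_U]) (force intro: AE_proj_apply_nonzero)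
  ultimately have "AE z in flag_haar m. vol z h ^ ?n = 0"
    using AE_flag
  proof eventually_elim
    case (elim z)
    have T: "is_proj m (snd z)" using elim(3) by (simp add: flag_def)
    show ?case
    proof (rule ccontr)
      assume "vol z h ^ ?n \<noteq> 0"
      then have V: "0 < vol z h" using tube_vol_nonneg[of "snd z" "poly_body U h"] by (auto simp: less_le)
      from zero_facet_gain[OF T h J L0 L _ V] elim(2) obtain c where c: "0 < c"
        "\<And>l. vol z h + c / real (Suc l) \<le> vol z (\<lambda>u. h u + (if h u = 0 then L / real (Suc l) else 0))" by blast
      have "ennreal (c * vol z h ^ (?n - 1)) \<le> G l z" for l
      proof -
        have ge: "vol z h + c / real (Suc l) \<le> vol z (g l)" unfolding g_def[abs_def] t_def by (rule c(2))
        have "vol z h ^ ?n + c / real (Suc l) * vol z h ^ (?n - 1) = (vol z h + c / real (Suc l)) * vol z h ^ (?n - 1)"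
          by (simp add: power_eq_if[of _ "DIM('a)"] algebra_simps)
        also have "\<dots> \<le> vol z (g l) * vol z (g l) ^ (?n - 1)"
          using ge mono[of z l] by (intro mult_mono power_mono) auto
        also have "\<dots> = vol z (g l) ^ ?n" by (simp add: power_eq_if[of _ "DIM('a)"])
        finally have "c / real (Suc l) * vol z h ^ (?n - 1) \<le> vol z (g l) ^ ?n - vol z h ^ ?n" by simp
        then have "real (Suc l) * (c / real (Suc l) * vol z h ^ (?n - 1)) \<le> real (Suc l) * (vol z (g l) ^ ?n - vol z h ^ ?n)"
          by (rule mult_left_mono) simp
        then show ?thesis unfolding G_def by (intro ennreal_leI) simp
      qed
      then have le: "ennreal (c * vol z h ^ (?n - 1)) \<le> liminf (\<lambda>l. G l z)" by (intro Liminf_bounded always_eventually) auto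
      have "ennreal (c * vol z h ^ (?n - 1)) = 0" using le[unfolded elim(1)] by (simp only: le_zero_eq)
      then have "c * vol z h ^ (?n - 1) \<le> 0" by (rule ennreal_eq_0_iff[THEN iffD1])
      moreover have "0 < c * vol z h ^ (?n - 1)" using c(1) V by simp
      ultimately show False by linarith
    qed
  qed
  then have "Phi h = 0" unfolding Phi_def by (subst integral_cong_AE[where g="\<lambda>_. 0"]) (auto intro: measurable_vol_power)
  then show False using P by simp
qed

end

section \<open>First variation and solution\<close>

context section_problem
begin

text \<open>The cone over the facet of the enlarged body, cut off at the old height, so that its
  dilate by \<open>c\<close> is the pyramid over the new facet. As \<open>c\<close> decreases to 1
  these sets exhaust the open facet cell.\<close>

definition near_cell :: "('a \<Rightarrow> real) \<Rightarrow> 'a \<Rightarrow> real \<Rightarrow> 'a set" where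
  "near_cell h u c = {x \<in> facet_cone U (h(u := c * h u)) u. x \<bullet> u \<le> h u}"

lemma near_cell_borel: "near_cell h u c \<in> sets borel"
proof -
  have "near_cell h u c = facet_cone U (h(u := c * h u)) u \<inter> {x. x \<bullet> u \<le> h u}" by (auto simp: near_cell_def)
  moreover have "{x. x \<bullet> u \<le> h u} \<in> sets borel" by measurable
  ultimately show ?thesis using facet_cone_borel(1)[OF finite_U] by simp
qed

lemma near_cell_iff:
  "x \<in> near_cell h u c \<longleftrightarrow> 0 < x \<bullet> u \<and> x \<bullet> u \<le> h u \<and> (\<forall>w\<in>U - {u}. (x \<bullet> w) * (c * h u) < (x \<bullet> u) * h w)"
  by (auto simp: near_cell_def facet_cone_def)

lemma near_cell_subset:
  assumes h: "\<And>u. u \<in> U \<Longrightarrow> 0 < h u" and u: "u \<in> U" and c: "1 \<le> c"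
  shows "near_cell h u c \<subseteq> poly_body U h"
  unfolding poly_body_def
proof safe
  fix x w assume x: "x \<in> near_cell h u c" and w: "w \<in> U"
  show "x \<bullet> w \<le> h w"
  proof (cases "w = u \<or> x \<bullet> w \<le> 0")
    case True
    then show ?thesis using x h[OF w] by (auto simp: near_cell_iff)
  next
    case False
    then have "(x \<bullet> w) * (c * h u) < (x \<bullet> u) * h w" using x w by (auto simp: near_cell_iff)
    also have "\<dots> \<le> h u * h w" using x h[OF w] by (intro mult_right_mono) (auto simp: near_cell_iff)
    finally have "(c * (x \<bullet> w)) * h u < h w * h u" by (simp add: mult_ac)
    then have "c * (x \<bullet> w) < h w" using h[OF u] by simp
    moreover have "1 * (x \<bullet> w) \<le> c * (x \<bullet> w)" using c False by (intro mult_right_mono) auto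
    ultimately show ?thesis by simp
  qed
qed

text \<open>Replace the near cell by its dilate \<open>C\<close>, which still lies in the enlarged
  body. A point of \<open>C\<close> below the old height is in the near cell already, so
  \<open>C\<close> is disjoint from the rest of the old body and the net gain is
  \<open>c ^ m - 1\<close> times the cell.\<close>

lemma facet_gain:
  fixes T :: "'a \<Rightarrow>\<^sub>L 'a"
  assumes T: "is_proj m T" and h: "\<And>u. u \<in> U \<Longrightarrow> 0 < h u" and u: "u \<in> U" and c: "1 < c"
  shows "tube_vol T (poly_body U h) + (c ^ m - 1) * tube_vol T (near_cell h u c) \<le>
    tube_vol T (poly_body U (h(u := c * h u)))"
proof -
  let ?h = "h(u := c * h u)" and ?S = "near_cell h u c"
  have c0: "0 < c" using c by simp
  define C where "C = {x. x /\<^sub>R c \<in> ?S}"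
  have sub: "?S \<subseteq> poly_body U h" by (rule near_cell_subset[OF h u]) (use c in auto)
  have subh: "poly_body U h \<subseteq> poly_body U ?h" using c h[OF u] by (intro poly_body_mono) auto
  have mC: "C \<in> sets borel"
    unfolding C_def using measurable_sets[of "\<lambda>x. x /\<^sub>R c" borel borel ?S] near_cell_borel[of h u c] by (simp add: vimage_def)
  have C_iff: "x \<in> C \<longleftrightarrow> 0 < x \<bullet> u \<and> x \<bullet> u \<le> c * h u \<and> (\<forall>w\<in>U - {u}. (x \<bullet> w) * (c * h u) < (x \<bullet> u) * h w)" for x
  proof -
    have "x \<in> C \<longleftrightarrow> x \<in> facet_cone U ?h u \<and> x \<bullet> u \<le> c * h u"
      using facet_cone_scale[of "inverse c" x U ?h u] c0
      by (simp add: C_def near_cell_def inverse_eq_divide divide_le_eq mult.commute)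
    then show ?thesis by (auto simp: facet_cone_def)
  qed
  have subC: "C \<subseteq> poly_body U ?h"
    unfolding poly_body_def
  proof safe
    fix x w assume x: "x \<in> C" and w: "w \<in> U"
    show "x \<bullet> w \<le> ?h w"
    proof (cases "w = u")
      case True
      then show ?thesis using x by (simp add: C_iff)
    next
      case False
      then have "(x \<bullet> w) * (c * h u) < (x \<bullet> u) * h w" using x w by (auto simp: C_iff)
      also have "\<dots> \<le> (c * h u) * h w" using x h[OF w] by (intro mult_right_mono) (auto simp: C_iff)
      finally have "(x \<bullet> w) * (c * h u) < h w * (c * h u)" by (simp add: mult_ac)
      moreover have "0 < c * h u" using c0 h[OF u] by simp
      ultimately have "x \<bullet> w < h w" by (simp only: mult_less_cancel_right_pos)
      then show ?thesis using False by simp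
    qed
  qed
  have volC: "tube_vol T C = c ^ m * tube_vol T ?S"
    unfolding C_def by (rule tube_vol_scale[OF T near_cell_borel c0])
  have disj: "(slab T (poly_body U h) - slab T ?S) \<inter> slab T C = {}"
    by (auto simp: slab_def C_iff near_cell_iff) (use u in \<open>auto simp: poly_body_def\<close>)
  have f1: "slab T (poly_body U h) \<in> fmeasurable lborel" by (rule slab_finite[OF order_refl poly_body_borel])
  have f2: "slab T ?S \<in> fmeasurable lborel" by (rule slab_finite[OF sub near_cell_borel])
  have f3: "slab T C \<in> fmeasurable lborel" by (rule slab_finite[OF subC mC])
  have "tube_vol T (poly_body U h) - tube_vol T ?S = measure lborel (slab T (poly_body U h) - slab T ?S)"
    unfolding tube_vol_def using f1 f2 slab_mono[OF sub] by (intro measurable_measure_Diff[symmetric]) (auto simp: fmeasurableD)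
  then have "tube_vol T (poly_body U h) - tube_vol T ?S + tube_vol T C = measure lborel ((slab T (poly_body U h) - slab T ?S) \<union> slab T C)"
    unfolding tube_vol_def using disj f1 f2 f3 by (subst measure_Un3) (auto intro: fmeasurable_Diff simp: fmeasurableD)
  also have "\<dots> \<le> tube_vol T (poly_body U ?h)"
    unfolding tube_vol_def
  proof (rule measure_mono_fmeasurable)
    show "(slab T (poly_body U h) - slab T ?S) \<union> slab T C \<subseteq> slab T (poly_body U ?h)"
      using slab_mono[OF subh] slab_mono[OF subC] by blast
    show "(slab T (poly_body U h) - slab T ?S) \<union> slab T C \<in> sets lborel" using f1 f2 f3 by (auto dest!: fmeasurableD)
    show "slab T (poly_body U ?h) \<in> fmeasurable lborel" by (rule slab_finite[OF order_refl poly_body_borel])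
  qed
  finally show ?thesis using volC by (simp add: algebra_simps)
qed

lemma near_cell_incseq:
  assumes h: "\<And>u. u \<in> U \<Longrightarrow> 0 < h u" and u: "u \<in> U"
  shows "incseq (\<lambda>k. near_cell h u (1 + 1 / real (Suc k)))"
proof (rule incseq_SucI, rule subsetI)
  fix k x assume x: "x \<in> near_cell h u (1 + 1 / real (Suc k))"
  have le: "1 + 1 / real (Suc (Suc k)) \<le> 1 + 1 / real (Suc k)" by (simp add: frac_le)
  have "(x \<bullet> w) * ((1 + 1 / real (Suc (Suc k))) * h u) < (x \<bullet> u) * h w" if w: "w \<in> U - {u}" for w
  proof (cases "0 \<le> x \<bullet> w")
    case True
    have hu: "0 < h u" by (rule h[OF u])
    have "(x \<bullet> w) * ((1 + 1 / real (Suc (Suc k))) * h u) \<le> (x \<bullet> w) * ((1 + 1 / real (Suc k)) * h u)"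
      by (rule mult_left_mono[OF mult_right_mono[OF le less_imp_le[OF hu]] True])
    also have "\<dots> < (x \<bullet> u) * h w" using x w unfolding near_cell_iff by blast
    finally show ?thesis .
  next
    case False
    have "0 < (1 + 1 / real (Suc (Suc k))) * h u" using h[OF u] by (intro mult_pos_pos) (auto simp: add_pos_pos)
    then have "(x \<bullet> w) * ((1 + 1 / real (Suc (Suc k))) * h u) < 0" using False by (intro mult_neg_pos) auto
    also have "0 < (x \<bullet> u) * h w" using x w h[of w] unfolding near_cell_iff by auto
    finally show ?thesis .
  qed
  then show "x \<in> near_cell h u (1 + 1 / real (Suc (Suc k)))" using x unfolding near_cell_iff by blast
qed

lemma facet_cell_subset_near_cells:
  "facet_cell U h u \<subseteq> (\<Union>k. near_cell h u (1 + 1 / real (Suc k)))"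
proof
  fix x assume x: "x \<in> facet_cell U h u"
  have "\<forall>\<^sub>F k in sequentially. \<forall>w\<in>U - {u}. (x \<bullet> w) * ((1 + 1 / real (Suc k)) * h u) < (x \<bullet> u) * h w"
  proof (subst eventually_ball_finite_distrib, simp add: finite_U, intro ballI)
    fix w assume w: "w \<in> U - {u}"
    have "(\<lambda>k. (x \<bullet> w) * ((1 + 1 / real (Suc k)) * h u)) \<longlonglongrightarrow> (x \<bullet> w) * ((1 + 0) * h u)"
      by (intro tendsto_intros lim_1_over_n[THEN LIMSEQ_Suc])
    then show "\<forall>\<^sub>F k in sequentially. (x \<bullet> w) * ((1 + 1 / real (Suc k)) * h u) < (x \<bullet> u) * h w"
      by (rule order_tendstoD(2)) (use x w in \<open>auto simp: facet_cell_def facet_cone_def\<close>)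
  qed
  then obtain k where "\<forall>w\<in>U - {u}. (x \<bullet> w) * ((1 + 1 / real (Suc k)) * h u) < (x \<bullet> u) * h w"
    using eventually_happens'[OF trivial_limit_sequentially] by blast
  then have "x \<in> near_cell h u (1 + 1 / real (Suc k))"
    using x unfolding near_cell_iff by (auto simp: facet_cell_def facet_cone_def)
  then show "x \<in> (\<Union>k. near_cell h u (1 + 1 / real (Suc k)))" by blast
qed

text \<open>One-sided first variation: multiply \<open>h u\<close> by a factor \<open>c k\<close>
  slightly above 1, compare the gain of \<open>Phi\<close> guaranteed by \<open>facet_gain\<close>
  with the gain permitted by \<open>opt\<close>, divide, and let \<open>k\<close> grow.\<close>

lemma flux_le:
  assumes h: "\<And>u. u \<in> U \<Longrightarrow> 0 < h u" and N: "Nm h = 1"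
    and opt: "\<And>h'. (\<forall>u\<in>U. 0 \<le> h' u) \<Longrightarrow> 0 < Nm h' \<Longrightarrow> Phi h' \<le> Phi h * Nm h' powr ratio"
    and u: "u \<in> U"
  shows "facet_flux m U h u \<le> ennreal (Phi h * (\<alpha> u * h u powr p))"
proof -
  let ?n = "DIM('a)" and ?S = "\<lambda>k. near_cell h u (1 + 1 / real (Suc k))"
  define a where "a = \<alpha> u * h u powr p"
  have a: "0 < a" using \<alpha>[OF u] h[OF u] by (simp add: a_def)
  define c where "c k = 1 + 1 / real (Suc k)" for k
  have c: "1 < c k" for k by (simp add: c_def)
  define I where "I k = (\<integral>z. vol z h ^ (?n - 1) * tube_vol (snd z) (?S k) \<partial>flag_haar m)" for k
  have sub: "?S k \<subseteq> poly_body U h" for k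
    by (rule near_cell_subset[OF h u less_imp_le]) (use c[of k] in \<open>simp_all only: c_def\<close>)
  have mI: "(\<lambda>z. vol z h ^ (?n - 1) * tube_vol (snd z) (?S k)) \<in> borel_measurable (flag_haar m)" for k
  proof -
    have "(\<lambda>z :: 'a flag. tube_vol (snd z) (?S k)) \<in> borel_measurable borel"
      using measurable_tube_vol_snd[OF near_cell_borel, of h u "1 + 1 / real (Suc k)" 1] by (simp only: power_one_right)
    then show ?thesis
      unfolding measurable_haar
      by (intro borel_measurable_times measurable_tube_vol_snd[OF poly_body_borel])
  qed
  have tv: "tube_vol (snd z) (?S k) \<le> vol z h" for z :: "'a flag" and k by (rule tube_vol_mono[OF sub near_cell_borel])
  have iI: "integrable (flag_haar m) (\<lambda>z. vol z h ^ (?n - 1) * tube_vol (snd z) (?S k))" for k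
  proof (rule Bochner_Integration.integrable_bound[OF integrable_vol[of h ?n] mI])
    show "AE z in flag_haar m. norm (vol z h ^ (?n - 1) * tube_vol (snd z) (?S k)) \<le> norm (vol z h ^ ?n)"
    proof (rule AE_I2)
      fix z :: "'a flag"
      have "vol z h ^ (?n - 1) * tube_vol (snd z) (?S k) \<le> vol z h ^ (?n - 1) * vol z h"
        using tv by (intro mult_left_mono) auto
      also have "\<dots> = vol z h ^ ?n" by (simp add: power_eq_if[of _ "DIM('a)"])
      finally show "norm (vol z h ^ (?n - 1) * tube_vol (snd z) (?S k)) \<le> norm (vol z h ^ ?n)" by simp
    qed
  qed
  \<comment> \<open>\<open>s k\<close> is the growth of \<open>Nm\<close>, and
    \<open>1 / w k\<close> is the factor of \<open>I k\<close> in the lower bound for the growth of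
    \<open>Phi\<close>.\<close>
  define s where "s k = a * (c k powr p - 1)" for k
  define w where "w k = 1 / (real ?n * (c k ^ m - 1))" for k
  have cp: "1 < c k powr p" "1 < c k ^ m" for k
    using powr_less_mono2[of p 1 "c k"] c[of k] p m by (auto intro!: one_less_power)
  have s0: "0 < s k" for k using a cp(1)[of k] by (simp add: s_def)
  have I_le: "I k \<le> Phi h * (w k * ((1 + s k) powr ratio - 1))" for k
  proof -
    let ?h = "h(u := c k * h u)"
    have cn: "0 \<le> c k" using c[of k] by simp
    have "Nm ?h = (\<Sum>v\<in>U. \<alpha> v * h v powr p + (if v = u then s k else 0))"
      unfolding Nm_def
      by (rule sum.cong) (use h[OF u] cn in \<open>auto simp: s_def a_def powr_mult algebra_simps\<close>)
    also have "\<dots> = Nm h + s k" using finite_U u by (simp add: sum.distrib Nm_def)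
    finally have Nm': "Nm ?h = 1 + s k" using N by simp
    have "Phi ?h \<le> Phi h * (1 + s k) powr ratio"
      using opt[of ?h] h c[of k] s0[of k] unfolding Nm' by (auto simp: less_imp_le)
    moreover have "Phi h + real ?n * (c k ^ m - 1) * I k \<le> Phi ?h"
    proof -
      have "Phi h + real ?n * (c k ^ m - 1) * I k =
         (\<integral>z. vol z h ^ ?n + real ?n * (c k ^ m - 1) * (vol z h ^ (?n - 1) * tube_vol (snd z) (?S k)) \<partial>flag_haar m)"
        unfolding Phi_def I_def using iI integrable_vol by simp
      also have "\<dots> \<le> Phi ?h"
        unfolding Phi_def
      proof (rule integral_mono_AE)
        show "AE z in flag_haar m. vol z h ^ ?n + real ?n * (c k ^ m - 1) * (vol z h ^ (?n - 1) * tube_vol (snd z) (?S k)) \<le> vol z ?h ^ ?n"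
          using AE_flag
        proof eventually_elim
          case (elim z)
          then have T: "is_proj m (snd z)" by (simp add: flag_def)
          define y where "y = (c k ^ m - 1) * tube_vol (snd z) (?S k)"
          have y: "0 \<le> y" using cp(2)[of k] by (simp add: y_def)
          have "vol z h ^ ?n + real ?n * vol z h ^ (?n - 1) * y \<le> (vol z h + y) ^ ?n"
            by (rule power_add_ge) (use y in auto)
          also have "\<dots> \<le> vol z ?h ^ ?n"
            using facet_gain[OF T h u c[of k]] y unfolding y_def c_def by (intro power_mono) auto
          finally show ?case by (simp add: y_def mult_ac)
        qed
      qed (use iI integrable_vol in auto)
      finally show ?thesis .
    qed
    ultimately have "real ?n * (c k ^ m - 1) * I k \<le> Phi h * ((1 + s k) powr ratio - 1)" by (simp add: algebra_simps)
    moreover have "0 < real ?n * (c k ^ m - 1)" using cp(2)[of k] by simp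
    ultimately show ?thesis by (simp add: w_def field_simps)
  qed
  \<comment> \<open>Both growths are of first order in \<open>1 / Suc k\<close>:
    \<open>w k * s k\<close> tends to \<open>a * p / (m * n)\<close>, and the factor
    \<open>ratio = m * n / p\<close> from the outer power leaves exactly \<open>a\<close>.\<close>
  have lim: "(\<lambda>k. w k * ((1 + s k) powr ratio - 1)) \<longlonglongrightarrow> a"
  proof -
    have pw: "(\<lambda>k. real (Suc k) * (c k powr q - 1)) \<longlonglongrightarrow> q" for q
    proof -
      have "(\<lambda>k. real (Suc k) * ((1 + 1 / real (Suc k)) powr q - 1)) \<longlonglongrightarrow> q * 1"
        by (rule tendsto_powr_difference[OF lim_1_over_n[THEN LIMSEQ_Suc]]) (auto simp del: of_nat_Suc)
      then show ?thesis by (simp add: c_def)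
    qed
    have mpow: "c k powr real m = c k ^ m" for k using c[of k] by (intro powr_realpow) simp
    have "(\<lambda>k. real (Suc k) * (c k ^ m - 1)) \<longlonglongrightarrow> real m" using pw[of "real m"] unfolding mpow .
    then have "(\<lambda>k. a / real ?n * ((real (Suc k) * (c k powr p - 1)) / (real (Suc k) * (c k ^ m - 1)))) \<longlonglongrightarrow> a / real ?n * (p / real m)"
      using m by (intro tendsto_intros pw) auto
    moreover have "a / real ?n * ((real (Suc k) * (c k powr p - 1)) / (real (Suc k) * (c k ^ m - 1))) = w k * s k" for k
      by (simp add: w_def s_def del: of_nat_Suc)
    ultimately have ws: "(\<lambda>k. w k * s k) \<longlonglongrightarrow> a / real ?n * (p / real m)" by simp
    have "c \<longlonglongrightarrow> 1 + 0"
      unfolding c_def[abs_def] by (intro tendsto_intros lim_1_over_n[THEN LIMSEQ_Suc])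
    then have "(\<lambda>k. c k powr p) \<longlonglongrightarrow> (1 + 0) powr p" by (rule tendsto_powr[OF _ tendsto_const]) simp
    then have "(\<lambda>k. a * (c k powr p - 1)) \<longlonglongrightarrow> a * ((1 + 0) powr p - 1)"
      by (rule tendsto_mult[OF tendsto_const tendsto_diff[OF _ tendsto_const]])
    then have "s \<longlonglongrightarrow> 0" by (simp add: s_def[abs_def])
    from tendsto_powr_difference[OF this s0 ws, of ratio]
    have "(\<lambda>k. w k * ((1 + s k) powr ratio - 1)) \<longlonglongrightarrow> ratio * (a / real ?n * (p / real m))" .
    moreover have "ratio * (a / real ?n * (p / real m)) = a" using p m by (simp add: ratio_def)
    ultimately show ?thesis by simp
  qed
  \<comment> \<open>The near cells increase and cover the open facet cell, so in each section the
    liminf is at least the contribution to the flux.\<close>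
  have "facet_flux m U h u \<le> (\<integral>\<^sup>+z. liminf (\<lambda>k. ennreal (vol z h ^ (?n - 1) * tube_vol (snd z) (?S k))) \<partial>flag_haar m)"
    unfolding facet_flux_def
  proof (rule nn_integral_mono)
    fix z :: "'a flag"
    let ?E = "\<lambda>k. slab (snd z) (?S k)"
    have mE: "range ?E \<subseteq> sets lborel" using measurable_slab[OF near_cell_borel] by auto
    have inc: "incseq ?S" by (rule near_cell_incseq[of h u, OF h u])
    have "incseq ?E" unfolding incseq_def by (intro allI impI slab_mono) (rule incseqD[OF inc])
    then have "(\<lambda>k. emeasure lborel (?E k)) \<longlonglongrightarrow> emeasure lborel (\<Union>k. ?E k)" by (rule Lim_emeasure_incseq[OF mE])
    then have "(\<lambda>k. ennreal (vol z h ^ (?n - 1)) * emeasure lborel (?E k)) \<longlonglongrightarrow> ennreal (vol z h ^ (?n - 1)) * emeasure lborel (\<Union>k. ?E k)"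
      by (intro ennreal_tendsto_cmult) auto
    moreover have "ennreal (vol z h ^ (?n - 1)) * emeasure lborel (?E k) = ennreal (vol z h ^ (?n - 1) * tube_vol (snd z) (?S k))" for k
    proof -
      obtain r where "poly_body U h \<subseteq> cball 0 r" using poly_body_cball[of h] by blast
      then have "?S k \<subseteq> cball 0 r" using sub by blast
      from emeasure_slab_bounded(1)[OF this] show ?thesis by (simp add: ennreal_mult)
    qed
    ultimately have "(\<lambda>k. ennreal (vol z h ^ (?n - 1) * tube_vol (snd z) (?S k))) \<longlonglongrightarrow> ennreal (vol z h ^ (?n - 1)) * emeasure lborel (\<Union>k. ?E k)" by simp
    from lim_imp_Liminf[OF trivial_limit_sequentially this]
    have "liminf (\<lambda>k. ennreal (vol z h ^ (?n - 1) * tube_vol (snd z) (?S k))) = ennreal (vol z h ^ (?n - 1)) * emeasure lborel (\<Union>k. ?E k)" .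
    moreover have "emeasure lborel (slab (snd z) (facet_cell U h u)) \<le> emeasure lborel (\<Union>k. ?E k)"
    proof (rule emeasure_mono)
      show "slab (snd z) (facet_cell U h u) \<subseteq> (\<Union>k. ?E k)" using facet_cell_subset_near_cells[of h u] by (auto simp: slab_def)
      show "(\<Union>k. ?E k) \<in> sets lborel" using mE by (intro sets.countable_UN)
    qed
    ultimately show "ennreal (vol z h ^ (?n - 1)) * emeasure lborel (slab (snd z) (facet_cell U h u)) \<le> liminf (\<lambda>k. ennreal (vol z h ^ (?n - 1) * tube_vol (snd z) (?S k)))"
      by (simp add: mult_left_mono)
  qed
  also have "\<dots> \<le> liminf (\<lambda>k. \<integral>\<^sup>+z. ennreal (vol z h ^ (?n - 1) * tube_vol (snd z) (?S k)) \<partial>flag_haar m)"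
    by (rule nn_integral_liminf) (use mI in measurable)
  also have "\<dots> = liminf (\<lambda>k. ennreal (I k))"
    unfolding I_def by (subst nn_integral_eq_integral[OF iI]) auto
  also have "\<dots> \<le> liminf (\<lambda>k. ennreal (Phi h * (w k * ((1 + s k) powr ratio - 1))))"
    by (intro Liminf_mono always_eventually allI ennreal_leI I_le)
  also have "\<dots> = ennreal (Phi h * a)"
    by (intro lim_imp_Liminf[OF trivial_limit_sequentially] tendsto_ennrealI tendsto_mult_left lim)
  finally show ?thesis by (simp add: a_def)
qed

section \<open>Euler's identity and equality of the masses\<close>

lemma measurable_facet_flux:
  "(\<lambda>z. ennreal (vol z h ^ k) * emeasure lborel (slab (snd z) (facet_cell U h u))) \<in> borel_measurable (flag_haar m)"
proof -
  have "(snd :: 'a flag \<Rightarrow> _) \<in> borel_measurable borel" using measurable_snd_borel[OF measurable_ident] by simp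
  from measurable_compose[OF this measurable_emeasure_slab[OF facet_cone_borel(2)[OF finite_U]]]
  have "(\<lambda>z :: 'a flag. emeasure lborel (slab (snd z) (facet_cell U h u))) \<in> borel_measurable borel" .
  then show ?thesis unfolding measurable_haar
    using measurable_tube_vol_snd[OF poly_body_borel, of U h k] by measurable
qed

text \<open>In almost every subspace almost every point of the section lies in one of the pyramids
  over the facets. For a maximiser the reverse inequality comes from summing
  \<open>flux_le\<close>.\<close>

lemma Phi_le_sum_flux:
  assumes h: "\<And>u. u \<in> U \<Longrightarrow> 0 < h u"
  shows "ennreal (Phi h) \<le> (\<Sum>u\<in>U. facet_flux m U h u)"
proof -
  let ?n = "DIM('a)"
  interpret facet_body U h by standard (rule h)
  \<comment> \<open>A hyperplane with normal \<open>e\<close> meets the range of \<open>T\<close> in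
    a null set as soon as \<open>T e \<noteq> 0\<close>; finitely many vectors \<open>e\<close> are
    avoided by almost every subspace.\<close>
  have "AE z in flag_haar m. \<forall>u\<in>U. \<forall>w\<in>U - {u}. h u *\<^sub>R w - h w *\<^sub>R u \<noteq> 0 \<longrightarrow> blinfun_apply (snd z) (h u *\<^sub>R w - h w *\<^sub>R u) \<noteq> (0::'a)"
  proof (subst AE_finite_all[OF finite_U], intro ballI, subst AE_finite_all, simp add: finite_U, intro ballI)
    fix u w
    show "AE z in flag_haar m. h u *\<^sub>R w - h w *\<^sub>R u \<noteq> 0 \<longrightarrow> blinfun_apply (snd z) (h u *\<^sub>R w - h w *\<^sub>R u) \<noteq> (0::'a)"
      using AE_proj_apply_nonzero[of "h u *\<^sub>R w - h w *\<^sub>R u"] by (cases "h u *\<^sub>R w - h w *\<^sub>R u = 0") auto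
  qed
  moreover have "AE z in flag_haar m. \<forall>u\<in>U. blinfun_apply (snd z) u \<noteq> (0::'a)"
    using unit by (subst AE_finite_all[OF finite_U]) (force intro: AE_proj_apply_nonzero)
  ultimately have ae: "AE z in flag_haar m. emeasure lborel (slab (snd z) P) \<le> (\<Sum>u\<in>U. emeasure lborel (slab (snd z) (facet_cell U h u)))"
    using AE_flag
  proof eventually_elim
    case (elim z)
    let ?T = "snd z"
    have T: "is_proj m ?T" using elim(3) by (simp add: flag_def)
    have "AE x in lborel. \<exists>u\<in>U. ?T x \<in> facet_cone U h u"
    proof (rule facet_cone_AE)
      fix u w assume "u \<in> U" "w \<in> U - {u}" "h u *\<^sub>R w - h w *\<^sub>R u \<noteq> 0"
      then have "?T (h u *\<^sub>R w - h w *\<^sub>R u) \<noteq> 0" using elim(1) by blast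
      from AE_lborel_hyperplane[OF this, of 0]
      show "AE x in lborel. ?T x \<bullet> (h u *\<^sub>R w - h w *\<^sub>R u) \<noteq> 0" unfolding is_projD(2)[OF T] .
    next
      show "AE x in lborel. ?T x \<noteq> 0" using elim(3) by (intro AE_proj_nonzero[OF T, of "fst z"]) (auto simp: flag_def)
    qed
    moreover have "AE x in lborel. \<forall>u\<in>U. ?T x \<bullet> u \<noteq> h u"
    proof (subst AE_finite_all[OF finite_U], intro ballI)
      fix u assume "u \<in> U"
      then have "?T u \<noteq> 0" using elim(2) by blast
      from AE_lborel_hyperplane[OF this, of "h u"]
      show "AE x in lborel. ?T x \<bullet> u \<noteq> h u" unfolding is_projD(2)[OF T] .
    qed
    ultimately have "AE x in lborel. x \<in> slab ?T P \<longrightarrow> x \<in> (\<Union>u\<in>U. slab ?T (facet_cell U h u))"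
    proof eventually_elim
      case (elim x)
      show ?case
      proof
        assume x: "x \<in> slab ?T P"
        obtain u where u: "u \<in> U" "?T x \<in> facet_cone U h u" using elim(1) by blast
        have "?T x \<bullet> u \<le> h u" using x u(1) by (simp add: slab_def poly_body_def)
        then have "?T x \<bullet> u < h u" using elim(2) u(1) by (simp add: less_le)
        then show "x \<in> (\<Union>u\<in>U. slab ?T (facet_cell U h u))" using x u by (auto simp: slab_def facet_cell_def)
      qed
    qed
    then have "emeasure lborel (slab ?T P) \<le> emeasure lborel (\<Union>u\<in>U. slab ?T (facet_cell U h u))"
      by (rule emeasure_mono_AE) (use finite_U measurable_slab[OF facet_cone_borel(2)[OF finite_U]] in auto)
    also have "\<dots> \<le> (\<Sum>u\<in>U. emeasure lborel (slab ?T (facet_cell U h u)))"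
      by (rule emeasure_subadditive_finite[OF finite_U]) (use measurable_slab[OF facet_cone_borel(2)[OF finite_U]] in auto)
    finally show ?case .
  qed
  have "ennreal (Phi h) = (\<integral>\<^sup>+z. ennreal (vol z h ^ ?n) \<partial>flag_haar m)"
    unfolding Phi_def by (rule nn_integral_eq_integral[symmetric, OF integrable_vol]) simp
  also have "\<dots> = (\<integral>\<^sup>+z. ennreal (vol z h ^ (?n - 1)) * emeasure lborel (slab (snd z) P) \<partial>flag_haar m)"
    by (rule nn_integral_cong) (simp add: emeasure_vol power_eq_if[of _ "DIM('a)"] ennreal_mult mult.commute)
  also have "\<dots> \<le> (\<integral>\<^sup>+z. (\<Sum>u\<in>U. ennreal (vol z h ^ (?n - 1)) * emeasure lborel (slab (snd z) (facet_cell U h u))) \<partial>flag_haar m)"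
    by (rule nn_integral_mono_AE, use ae in eventually_elim) (simp add: sum_distrib_left[symmetric] mult_left_mono)
  also have "\<dots> = (\<Sum>u\<in>U. facet_flux m U h u)"
    unfolding facet_flux_def by (rule nn_integral_sum[OF measurable_facet_flux])
  finally show ?thesis .
qed

text \<open>The upper bounds sum to \<open>Phi h * Nm h = Phi h\<close>, which the total flux
  reaches; a strict inequality at one normal would contradict this.\<close>

lemma optimal_flux:
  assumes h: "\<And>u. u \<in> U \<Longrightarrow> 0 < h u" and N: "Nm h = 1"
    and opt: "\<And>h'. (\<forall>u\<in>U. 0 \<le> h' u) \<Longrightarrow> 0 < Nm h' \<Longrightarrow> Phi h' \<le> Phi h * Nm h' powr ratio"
    and u: "u \<in> U"
  shows "facet_flux m U h u = ennreal (Phi h * (\<alpha> u * h u powr p))"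
proof -
  define f where "f v = enn2real (facet_flux m U h v)" for v
  have le: "facet_flux m U h v \<le> ennreal (Phi h * (\<alpha> v * h v powr p))" if "v \<in> U" for v
    by (rule flux_le[OF h N opt that])
  have nn: "0 \<le> Phi h * (\<alpha> v * h v powr p)" if "v \<in> U" for v
    using Phi_nonneg[of h] \<alpha>[OF that] by simp
  have fin: "facet_flux m U h v = ennreal (f v)" if "v \<in> U" for v
    unfolding f_def using le[OF that] by (simp add: le_less_trans[OF _ ennreal_less_top])
  have fle: "f v \<le> Phi h * (\<alpha> v * h v powr p)" if "v \<in> U" for v
    unfolding f_def using le[OF that] nn[OF that] by (intro enn2real_leI)
  have f0: "0 \<le> f v" for v by (simp add: f_def)
  have "ennreal (Phi h) \<le> (\<Sum>v\<in>U. ennreal (f v))" using Phi_le_sum_flux[of h, OF h] fin by simp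
  also have "\<dots> = ennreal (\<Sum>v\<in>U. f v)" using f0 by (simp add: sum_ennreal)
  finally have ge: "Phi h \<le> (\<Sum>v\<in>U. f v)" using f0 by (simp add: ennreal_le_iff sum_nonneg)
  have sum: "(\<Sum>v\<in>U. Phi h * (\<alpha> v * h v powr p)) = Phi h"
    using N by (simp add: Nm_def sum_distrib_left[symmetric])
  have "f u = Phi h * (\<alpha> u * h u powr p)"
  proof (rule ccontr)
    assume "f u \<noteq> Phi h * (\<alpha> u * h u powr p)"
    then have "f u < Phi h * (\<alpha> u * h u powr p)" using fle[OF u] by simp
    then have "(\<Sum>v\<in>U. f v) < (\<Sum>v\<in>U. Phi h * (\<alpha> v * h v powr p))"
      using fle u by (intro sum_strict_mono_ex1[OF finite_U]) auto
    then show False using ge sum by simp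
  qed
  then show ?thesis using fin[OF u] by simp
qed

text \<open>A dilation leaves the cones unchanged and multiplies each of the \<open>n\<close> volume
  factors by \<open>s ^ m\<close>.\<close>

lemma facet_flux_scale:
  assumes s: "0 < s"
  shows "facet_flux m U (\<lambda>u. s * h u) u = ennreal (s ^ (m * DIM('a))) * facet_flux m U h u"
proof -
  let ?n = "DIM('a)"
  have cell: "facet_cell U (\<lambda>u. s * h u) u = {x. x /\<^sub>R s \<in> facet_cell U h u}"
  proof -
    have "facet_cone U (\<lambda>u. s * h u) u = facet_cone U h u"
      using s by (simp add: facet_cone_def mult.left_commute[of _ s])
    moreover have "x /\<^sub>R s \<in> facet_cone U h u \<longleftrightarrow> x \<in> facet_cone U h u" for x
      using s by (intro facet_cone_scale) simp
    moreover have "(x /\<^sub>R s) \<bullet> u < h u \<longleftrightarrow> x \<bullet> u < s * h u" for x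
      using s by (simp add: inverse_eq_divide divide_less_eq mult.commute)
    ultimately show ?thesis by (simp add: facet_cell_def)
  qed
  have "facet_flux m U (\<lambda>u. s * h u) u =
     (\<integral>\<^sup>+z. ennreal (s ^ (m * ?n)) * (ennreal (vol z h ^ (?n - 1)) * emeasure lborel (slab (snd z) (facet_cell U h u))) \<partial>flag_haar m)"
    unfolding facet_flux_def
  proof (rule nn_integral_cong_AE, use AE_flag in eventually_elim)
    fix z :: "'a flag" assume z: "flag m z"
    then have T: "is_proj m (snd z)" by (simp add: flag_def)
    have e: "s ^ (m * ?n) = (s ^ m) ^ (?n - 1) * s ^ m"
      by (simp add: power_mult power_eq_if[of _ "DIM('a)"] mult.commute)
    show "ennreal (vol z (\<lambda>u. s * h u) ^ (?n - 1)) * emeasure lborel (slab (snd z) (facet_cell U (\<lambda>u. s * h u) u)) =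
      ennreal (s ^ (m * ?n)) * (ennreal (vol z h ^ (?n - 1)) * emeasure lborel (slab (snd z) (facet_cell U h u)))"
      unfolding cell emeasure_slab_scale[OF T facet_cone_borel(2)[OF finite_U] s] vol_scale[OF z s] e
      using s by (simp add: power_mult_distrib ennreal_mult mult_ac)
  qed
  also have "\<dots> = ennreal (s ^ (m * ?n)) * facet_flux m U h u"
    unfolding facet_flux_def by (rule nn_integral_cmult[OF measurable_facet_flux])
  finally show ?thesis .
qed

theorem prescribed_curvature:
  assumes pm: "p \<noteq> real m * real DIM('a)"
  shows "\<exists>h. facet_body U h \<and> (\<forall>\<eta>. affine_dual_curvature p m (poly_body U h) \<eta> = (\<Sum>u\<in>U. ennreal (\<alpha> u) * indicator \<eta> u))"
proof -
  obtain h where h0: "\<And>u. u \<in> U \<Longrightarrow> 0 \<le> h u" and N: "Nm h = 1" and P: "0 < Phi h"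
    and opt: "\<And>h'. (\<forall>u\<in>U. 0 \<le> h' u) \<Longrightarrow> 0 < Nm h' \<Longrightarrow> Phi h' \<le> Phi h * Nm h' powr ratio"
    using optimal_exists by blast
  have h: "0 < h u" if "u \<in> U" for u by (rule optimal_pos[OF h0 N P opt that])
  define K where "K = curvature_const TYPE('a) m"
  have K: "0 < K" unfolding K_def by (rule curvature_const_pos[OF m])
  define q where "q = real (m * DIM('a))"
  have q: "p \<noteq> q" using pm by (simp add: q_def)
  \<comment> \<open>After dilation by \<open>s\<close> all masses equal \<open>\<alpha> u\<close>
    times the common factor \<open>K * Phi h * s powr (q - p)\<close>; this \<open>s\<close> makes
    the factor 1, which is where \<open>p \<noteq> q\<close> enters.\<close>
  define s where "s = (K * Phi h) powr (1 / (p - q))"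
  have KP: "0 < K * Phi h" using K P by simp
  have s: "0 < s" using K P by (simp add: s_def)
  have s1: "K * Phi h * (s powr (- p) * s powr q) = 1"
  proof -
    have "s powr (- p) * s powr q = s powr (q - p)" by (simp add: powr_add[symmetric])
    also have "\<dots> = (K * Phi h) powr (1 / (p - q) * (q - p))" by (simp add: s_def powr_powr)
    also have "1 / (p - q) * (q - p) = - 1" using q by (simp add: field_simps)
    finally show ?thesis using K P by (simp add: powr_minus field_simps)
  qed
  interpret S: facet_body U "\<lambda>u. s * h u" by standard (simp add: s h)
  have "affine_dual_curvature p m (poly_body U (\<lambda>u. s * h u)) \<eta> = (\<Sum>u\<in>U. ennreal (\<alpha> u) * indicator \<eta> u)" for \<eta>
    unfolding S.curvature_poly_body[OF m]
  proof (rule sum.cong[OF refl])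
    fix u assume u: "u \<in> U"
    have sq: "s ^ (m * DIM('a)) = s powr q" using s unfolding q_def by (intro powr_realpow[symmetric])
    have hp: "h u powr (- p) * h u powr p = 1" using h[OF u] by (simp add: powr_add[symmetric])
    have "K * (s * h u) powr (- p) * (s powr q * (Phi h * (\<alpha> u * h u powr p))) =
       (K * Phi h * (s powr (- p) * s powr q)) * \<alpha> u * (h u powr (- p) * h u powr p)"
      using s h[OF u] by (simp add: powr_mult mult_ac)
    also have "\<dots> = \<alpha> u" unfolding s1 hp by simp
    finally have e: "K * (s * h u) powr (- p) * (s powr q * (Phi h * (\<alpha> u * h u powr p))) = \<alpha> u" .
    have nn: "0 \<le> Phi h * (\<alpha> u * h u powr p)" using P \<alpha>[OF u] by simp
    have fl: "facet_flux m U h u = ennreal (Phi h * (\<alpha> u * h u powr p))" by (rule optimal_flux[OF h N opt u])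
    have "ennreal (K * (s * h u) powr (- p)) * facet_flux m U (\<lambda>u. s * h u) u =
      ennreal (K * (s * h u) powr (- p)) * (ennreal (s powr q) * ennreal (Phi h * (\<alpha> u * h u powr p)))"
      unfolding facet_flux_scale[OF s] fl sq ..
    also have "\<dots> = ennreal (K * (s * h u) powr (- p) * (s powr q * (Phi h * (\<alpha> u * h u powr p))))"
      using nn K by (simp only: ennreal_mult[symmetric] powr_ge_zero mult_nonneg_nonneg less_imp_le)
    also have "\<dots> = ennreal (\<alpha> u)" unfolding e ..
    finally show "indicator \<eta> u * (ennreal (curvature_const TYPE('a) m * (s * h u) powr (- p)) * facet_flux m U (\<lambda>u. s * h u) u) =
       ennreal (\<alpha> u) * indicator \<eta> u"
      unfolding K_def by (simp add: mult.commute)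
  qed
  then show ?thesis using S.facet_body_axioms by blast
qed

end

theorem theorem1p1:
  fixes m :: nat and p :: real and \<mu> :: "(real ^ 'n) measure"
  assumes "CARD('n) \<ge> 2"
    and "1 \<le> m" and "m \<le> CARD('n) - 1"
    and "p > 1" and "p \<noteq> real m * real CARD('n)"
    and "discrete_sphere_measure \<mu>"
    and "\<not> (\<exists>v \<in> sphere 0 1. concentrated_on \<mu> (closed_hemisphere v))"
  shows "\<exists>P :: (real ^ 'n) set.
           polytope P \<and> measure lborel P > 0 \<and> 0 \<in> interior P \<and>
           (\<forall>\<eta> \<in> sets (restrict_space borel (sphere 0 1)).
              affine_dual_curvature p m P \<eta> = emeasure \<mu> \<eta>)"
proof -
  obtain U \<alpha> where s\<mu>: "sets \<mu> = sets (restrict_space borel (sphere 0 1))"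
    and U: "finite U" "U \<subseteq> sphere 0 1" "\<And>u. u \<in> U \<Longrightarrow> 0 < \<alpha> u"
    and \<mu>: "\<And>A. A \<in> sets \<mu> \<Longrightarrow> emeasure \<mu> A = (\<Sum>u\<in>U. ennreal (\<alpha> u) * indicator A u)"
    using assms(6) unfolding discrete_sphere_measure_def by blast
  have sp: "space \<mu> = sphere 0 1" using sets_eq_imp_space_eq[OF s\<mu>] by (simp add: space_restrict_space)
  have pos: "\<exists>u\<in>U. 0 < x \<bullet> u" if x: "x \<noteq> 0" for x :: "real ^ 'n"
  proof -
    \<comment> \<open>Mass outside the closed hemisphere around \<open>- sgn x\<close> yields an
      atom with positive inner product with \<open>x\<close>.\<close>
    define v where "v = - sgn x"
    have "v \<in> sphere 0 1" using x by (simp add: v_def norm_sgn)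
    then have nz: "emeasure \<mu> (space \<mu> - closed_hemisphere v) \<noteq> 0" using assms(7) by (auto simp: concentrated_on_def)
    \<comment> \<open>\<open>emeasure\<close> is 0 outside the sigma-algebra, so nonzero mass
      already shows measurability.\<close>
    then have "space \<mu> - closed_hemisphere v \<in> sets \<mu>" using emeasure_notin_sets by blast
    from nz[unfolded \<mu>[OF this]] obtain u where u: "u \<in> U" "u \<in> space \<mu> - closed_hemisphere v"
      by (metis (no_types, lifting) indicator_simps(2) mult_zero_right sum.neutral)
    then have "u \<bullet> v < 0" by (auto simp: sp closed_hemisphere_def)
    then have "0 < x \<bullet> u" using x by (simp add: v_def sgn_div_norm inner_commute zero_less_mult_iff)
    then show ?thesis using u(1) by blast
  qed
  have D: "DIM(real ^ 'n) = CARD('n)" by simp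
  interpret section_problem U m p \<alpha>
    using U pos assms by unfold_locales (auto simp: D)
  obtain h where h: "facet_body U h"
    and C: "\<And>\<eta>. affine_dual_curvature p m (poly_body U h) \<eta> = (\<Sum>u\<in>U. ennreal (\<alpha> u) * indicator \<eta> u)"
    using prescribed_curvature assms(5) unfolding D by blast
  interpret facet_body U h by (rule h)
  have "measure lborel P > 0"
  proof -
    obtain e where e: "0 < e" "ball 0 e \<subseteq> P" using zero_interior mem_interior by blast
    obtain r where "P \<subseteq> cball 0 r" using poly_body_cball[of h] by blast
    then have "emeasure lborel P < top"
      using emeasure_mono[of P "cball 0 r" lborel] emeasure_lborel_cball_finite[of "0 :: real ^ 'n" r] by (auto intro: le_less_trans)
    then have "P \<in> fmeasurable lborel" by (intro fmeasurableI) (simp_all add: poly_body_borel)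
    then have "measure lborel (ball (0 :: real ^ 'n) e) \<le> measure lborel P" using e(2) by (intro measure_mono_fmeasurable) auto
    moreover have "0 < measure lborel (ball (0 :: real ^ 'n) e)" using e(1) by (simp add: content_ball)
    ultimately show ?thesis by linarith
  qed
  then show ?thesis using polytope_P zero_interior C \<mu> s\<mu> by (intro exI[of _ P]) auto
qed

end
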